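(* Assume that $V$ satisfies (V5) $V\in C^1(\mathbb{R}^N)$ is $\mathbb{Z}^N$-periodic; (V6) $V(x)\ge0$, and $V(x)=0$ if and only if $x\in\mathbb{Z}^N$. Then for every $c\in[0,c_p)$ there exist $k_c\in\mathbb{N}$ and a finite set $\{\xi^1,\ldots,\xi^{k_c}\}\subset\mathbb{Z}^N\setminus\{0\}$ satisfying $$\xi^i\ne\xi^j\ \text{ for } i\neq j,\quad\text{and}\quad\{n_1\xi^1+\ldots+n_{k_c}\xi^{k_c}:\ n_1,\ldots,n_{k_c}\in\mathbb{Z}\}=\mathbb{Z}^N,$$ for which, given any $j\in\{1,\ldots,k_c\}$, there is a solution $q_{c,j}\in C^2(\mathbb{R},\mathbb{R}^N)$ of $\ddot q=\nabla V(q)$ on $\mathbb{R}$ with energy $E_{q_{c,j}}(t):=\tfrac12|\dot q_{c,j}(t)|^2-V(q_{c,j}(t))=-c$ for any $t\in\mathbb{R}$, verifying $$\inf_{t\in\mathbb{R}}\mathrm{dist}(q_{c,j}(t),\mathcal{V}^c_0)=\inf_{t\in\mathbb{R}}\mathrm{dist}(q_{c,j}(t),\mathcal{V}^c_{\xi^j})=0\quad\text{and}\quad\|q_{c,j}\|_{L^\infty(\mathbb{R},\mathbb{R}^N)}\le R_p+1,$$ where $R_p$ is the constant (independent of $c$) described in the context.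
   Context: $N\ge2$ is an integer; $\mathrm{dist}$ is Euclidean distance from a point to a set; $B_r(x)$ is the Euclidean ball of radius $r$ centred at $x$; $\mathcal{V}^c:=\{x\in\mathbb{R}^N:V(x)\le c\}$. $c_p>0$ is fixed so that $\mathcal{V}^c\subset\bigcup_{\xi\in\mathbb{Z}^N}B_{1/3}(\xi)$ for any $c\in[0,c_p)$ (such $c_p$ exists by continuity and periodicity, since $\mathcal{V}^0=\mathbb{Z}^N$). For $c\in[0,c_p)$ and $\xi\in\mathbb{Z}^N$, $\mathcal{V}^c_\xi:=\mathcal{V}^c\cap B_{1/3}(\xi)$. Let $M_p:=\frac12+\max_{|x|\le1}V(x)$ and, for an interval $(\sigma,\tau)$, $J_{c,(\sigma,\tau)}(q):=\int_\sigma^\tau\tfrac12|\dot q(t)|^2+(V(q(t))-c)\,dt$. $R_p>0$ denotes a constant with the following property: for any $c\in[0,c_p)$, if $q\in W^{1,2}_{loc}(\mathbb{R},\mathbb{R}^N)$ and $(\sigma,\tau)\subset\mathbb{R}$ are such that $V(q(t))\ge c$ for $t\in(\sigma,\tau)$ and $J_{c,(\sigma,\tau)}(q)\le M_p+1$, then $|q(\tau)-q(\sigma)|\le R_p$. *)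

theory Defs
  imports "HOL-Analysis.Analysis" "HOL-Probability.Essential_Supremum"
begin

definition int_vecs :: "(real ^ 'n) set" where
  "int_vecs = {x. \<forall>i. x $ i \<in> \<int>}"

definition grad :: "(real ^ 'n \<Rightarrow> real) \<Rightarrow> real ^ 'n \<Rightarrow> real ^ 'n" where
  "grad V x = (THE D. GDERIV V x :> D)"

definition C1_fun :: "(real ^ 'n \<Rightarrow> real) \<Rightarrow> bool" where
  "C1_fun V \<longleftrightarrow> V differentiable_on UNIV \<and> continuous_on UNIV (grad V)"

definition int_periodic :: "(real ^ 'n \<Rightarrow> real) \<Rightarrow> bool" where
  "int_periodic V \<longleftrightarrow> (\<forall>x. \<forall>\<xi>\<in>int_vecs. V (x + \<xi>) = V x)"

definition sublevel :: "(real ^ 'n \<Rightarrow> real) \<Rightarrow> real \<Rightarrow> (real ^ 'n) set" where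
  "sublevel V c = {x. V x \<le> c}"

definition sublevel_at :: "(real ^ 'n \<Rightarrow> real) \<Rightarrow> real \<Rightarrow> real ^ 'n \<Rightarrow> (real ^ 'n) set" where
  "sublevel_at V c \<xi> = sublevel V c \<inter> ball \<xi> (1/3)"

text \<open>The supremum is a maximum for continuous \<open>V\<close>, the closed unit ball being compact.\<close>

definition M_p :: "(real ^ 'n \<Rightarrow> real) \<Rightarrow> real" where
  "M_p V = 1/2 + (SUP x\<in>cball 0 1. V x)"

definition test_fun :: "(real \<Rightarrow> real) \<Rightarrow> bool" where
  "test_fun \<phi> \<longleftrightarrow>
     (\<forall>k. (deriv ^^ k) \<phi> differentiable_on UNIV) \<and> (\<exists>a b. \<forall>t. t \<notin> {a..b} \<longrightarrow> \<phi> t = 0)"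

definition L2_loc :: "(real \<Rightarrow> real ^ 'n) \<Rightarrow> bool" where
  "L2_loc f \<longleftrightarrow>
     f \<in> borel_measurable lborel \<and> (\<forall>a b. set_integrable lborel {a..b} (\<lambda>t. (norm (f t))\<^sup>2))"

definition weak_deriv :: "(real \<Rightarrow> real ^ 'n) \<Rightarrow> (real \<Rightarrow> real ^ 'n) \<Rightarrow> bool" where
  "weak_deriv q q' \<longleftrightarrow>
     (\<forall>\<phi>. test_fun \<phi> \<longrightarrow>
        (\<integral>t. deriv \<phi> t *\<^sub>R q t \<partial>lborel) = - (\<integral>t. \<phi> t *\<^sub>R q' t \<partial>lborel))"

text \<open>
  \<open>q\<close> is (the continuous representative of) an element of the Sobolev space
  $W^{1,2}_{loc}(\mathbb{R},\mathbb{R}^N)$, and \<open>q'\<close> is its weak derivative, which is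
  determined only almost everywhere and is therefore carried along as a second argument.
\<close>

definition W12_loc :: "(real \<Rightarrow> real ^ 'n) \<Rightarrow> (real \<Rightarrow> real ^ 'n) \<Rightarrow> bool" where
  "W12_loc q q' \<longleftrightarrow> continuous_on UNIV q \<and> L2_loc q \<and> L2_loc q' \<and> weak_deriv q q'"

text \<open>
  The functional $J_{c,(\sigma,\tau)}(q)$, with \<open>q'\<close> the weak derivative of \<open>q\<close>. For
  continuous \<open>V\<close>, \<open>W12_loc q q'\<close> and real \<open>\<sigma>\<close>, \<open>\<tau>\<close> the integrand is integrable, so
  the value is never the default value 0 of a nonexistent integral.
\<close>

definition J :: "(real ^ 'n \<Rightarrow> real) \<Rightarrow> real \<Rightarrow> real \<Rightarrow> real \<Rightarrow>
    (real \<Rightarrow> real ^ 'n) \<Rightarrow> (real \<Rightarrow> real ^ 'n) \<Rightarrow> real" where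
  "J V c \<sigma> \<tau> q q' =
     (LINT t:{\<sigma><..<\<tau>}|lborel. 1/2 * (norm (q' t))\<^sup>2 + (V (q t) - c))"

definition vel :: "(real \<Rightarrow> real ^ 'n) \<Rightarrow> real \<Rightarrow> real ^ 'n" where
  "vel q t = vector_derivative q (at t)"

definition C2_curve :: "(real \<Rightarrow> real ^ 'n) \<Rightarrow> bool" where
  "C2_curve q \<longleftrightarrow>
     q differentiable_on UNIV \<and> vel q differentiable_on UNIV \<and> continuous_on UNIV (vel (vel q))"

definition energy :: "(real ^ 'n \<Rightarrow> real) \<Rightarrow> (real \<Rightarrow> real ^ 'n) \<Rightarrow> real \<Rightarrow> real" where
  "energy V q t = 1/2 * (norm (vel q t))\<^sup>2 - V (q t)"

definition Linf_norm :: "(real \<Rightarrow> real ^ 'n) \<Rightarrow> ereal" where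
  "Linf_norm q = esssup lborel (\<lambda>t. ereal (norm (q t)))"

end

theory Submission
  imports Defs
begin

text \<open>Put \<open>W = max (V - c) 0\<close>. Let \<open>L\<close> be the subgroup generated by the finitely many lattice
  vectors reached by a good orbit. If it were proper, a connection from the central well to a well
  outside \<open>L\<close>, minimal among all connections from wells in \<open>L\<close> to wells outside \<open>L\<close>, would give
  another such vector. Minimality and translation by \<open>L\<close> keep the connection off the sublevel set
  in between, and prevent it from lingering near an intermediate well.

  To avoid Sobolev spaces, the action is discretised with time step \<open>h\<close> and each unit of time is
  charged an extra \<open>\<epsilon>\<close>, so that the number of steps is bounded and minimisers exist by compactness.
  A minimiser satisfies the discrete Euler-Lagrange equation, so its velocities are equi-Lipschitz
  and \<open>h, \<epsilon> \<rightarrow> 0\<close> produces a classical solution. Its energy is obtained by comparing \<open>k\<close> steps of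
  the minimiser with a straight path of \<open>k + 1\<close> or \<open>k - 1\<close> steps. The action accumulated along the
  path is carried along as an additional component of the scheme, so that the bound \<open>M_p V\<close> survives
  in the limit and the displacement bound applies to the limit orbit.\<close>

section \<open>Discrete action and minimal paths\<close>

text \<open>The bound \<open>M_p V\<close> comes from a coordinate vector: a proper subgroup misses
  one, and the straight segment to it, run in unit time, has kinetic cost 1/2 and stays in the unit
  ball. The energy is not imposed as a constraint: the number of steps is free, and extremals of a
  free-time problem with potential \<open>W\<close> balance kinetic energy against \<open>W\<close>,
  which is energy -c.

  Two obstacles shape the details. \<open>W\<close> may fail to be differentiable on the boundary of
  the sublevel set, so it is arranged that only the end nodes of a minimal path lie in wells. And
  \<open>grad V\<close> is merely continuous, so solutions need not be unique; the limit is taken by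
  compactness, and facts about the orbit come from the discrete paths or from conservation of
  energy.

  Travel times may stay bounded or diverge as the mesh shrinks. If bounded, the orbit touches the
  well; if not, it is only shown to come arbitrarily close. The well at the far end is selected
  last: the orbit is bounded, so only finitely many are in question.\<close>

definition step_cost :: "('a::real_normed_vector \<Rightarrow> real) \<Rightarrow> real \<Rightarrow> real \<Rightarrow> 'a \<Rightarrow> 'a \<Rightarrow> real" where
  "step_cost W h \<epsilon> u w = (norm (w - u))\<^sup>2 / (2 * h) + h * (W u + \<epsilon>)"

definition path_cost :: "('a::real_normed_vector \<Rightarrow> real) \<Rightarrow> real \<Rightarrow> real \<Rightarrow> (nat \<Rightarrow> 'a) \<Rightarrow> nat \<Rightarrow> nat \<Rightarrow> real" where
  "path_cost W h \<epsilon> x i j = (\<Sum>k\<in>{i..<j}. step_cost W h \<epsilon> (x k) (x (Suc k)))"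

definition path_costs :: "('a::real_normed_vector \<Rightarrow> real) \<Rightarrow> real \<Rightarrow> real \<Rightarrow> 'a \<Rightarrow> 'a \<Rightarrow> real set" where
  "path_costs W h \<epsilon> u w = {path_cost W h \<epsilon> x 0 n | x n. x 0 = u \<and> x n = w}"

lemma path_cost_split: "i \<le> j \<Longrightarrow> j \<le> k \<Longrightarrow> path_cost W h \<epsilon> x i j + path_cost W h \<epsilon> x j k = path_cost W h \<epsilon> x i k"
  unfolding path_cost_def by (rule sum.atLeastLessThan_concat)

lemma path_cost_shift: "path_cost W h \<epsilon> (\<lambda>k. x (k + i)) 0 n = path_cost W h \<epsilon> x i (i + n)"
  unfolding path_cost_def using sum.shift_bounds_nat_ivl[of "\<lambda>k. step_cost W h \<epsilon> (x k) (x (Suc k))" 0 i n]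
  by (simp add: add.commute)

lemma path_cost_cong:
  "(\<And>k. i \<le> k \<Longrightarrow> k \<le> j \<Longrightarrow> x k = y k) \<Longrightarrow> path_cost W h \<epsilon> x i j = path_cost W h \<epsilon> y i j"
  unfolding path_cost_def by (rule sum.cong) auto

lemma segment_in_path_costs:
  assumes "i \<le> j"
  shows "path_cost W h \<epsilon> x i j \<in> path_costs W h \<epsilon> (x i) (x j)"
  unfolding path_costs_def
proof (intro CollectI exI conjI)
  show "path_cost W h \<epsilon> x i j = path_cost W h \<epsilon> (\<lambda>k. x (k + i)) 0 (j - i)"
    using assms by (simp add: path_cost_shift)
qed (use assms in auto)

lemma path_costs_trans:
  assumes "a \<in> path_costs W h \<epsilon> u v" "b \<in> path_costs W h \<epsilon> v w"
  shows "a + b \<in> path_costs W h \<epsilon> u w"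
proof -
  obtain x n y m where x: "a = path_cost W h \<epsilon> x 0 n" "x 0 = u" "x n = v"
    and y: "b = path_cost W h \<epsilon> y 0 m" "y 0 = v" "y m = w"
    using assms unfolding path_costs_def by auto
  define q where "q k = (if k \<le> n then x k else y (k - n))" for k
  have "path_cost W h \<epsilon> q 0 n = a"
    unfolding x by (rule path_cost_cong) (simp add: q_def)
  moreover have "path_cost W h \<epsilon> q n (n + m) = b"
    unfolding y path_cost_shift[symmetric] by (rule path_cost_cong) (use x y in \<open>auto simp: q_def\<close>)
  ultimately have "a + b = path_cost W h \<epsilon> q 0 (n + m)"
    using path_cost_split[of 0 n "n + m" W h \<epsilon> q] by simp
  also have "\<dots> \<in> path_costs W h \<epsilon> (q 0) (q (n + m))"
    by (rule segment_in_path_costs) simp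
  finally show ?thesis using x y by (auto simp: q_def split: if_splits)
qed

lemma path_costs_translate:
  assumes "\<And>x. W (x + \<eta>) = W x" "a \<in> path_costs W h \<epsilon> u w"
  shows "a \<in> path_costs W h \<epsilon> (u + \<eta>) (w + \<eta>)"
proof -
  obtain x n where x: "a = path_cost W h \<epsilon> x 0 n" "x 0 = u" "x n = w"
    using assms(2) unfolding path_costs_def by auto
  have "a = path_cost W h \<epsilon> (\<lambda>k. x k + \<eta>) 0 n"
    unfolding x path_cost_def step_cost_def using assms(1) by simp
  also have "\<dots> \<in> path_costs W h \<epsilon> (x 0 + \<eta>) (x n + \<eta>)"
    by (rule segment_in_path_costs) simp
  finally show ?thesis by (simp add: x)
qed

text \<open>The standard competitor against a minimiser: uniform motion along a segment, where the
  choice of \<open>k\<close> sets the duration \<open>h * k\<close>.\<close>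

lemma line_in_path_costs:
  assumes "k > 0" "h > 0"
  shows "(norm (w - u))\<^sup>2 / (2 * h * k) + h * (\<Sum>i<k. W (u + (real i / k) *\<^sub>R (w - u)) + \<epsilon>)
    \<in> path_costs W h \<epsilon> u w"
proof -
  define x where "x i = u + (real i / k) *\<^sub>R (w - u)" for i
  have "x (Suc i) - x i = (1 / k) *\<^sub>R (w - u)" for i
    by (simp add: x_def scaleR_diff_left[symmetric] add_divide_distrib)
  then have st: "step_cost W h \<epsilon> (x i) (x (Suc i)) = (norm (w - u) / k)\<^sup>2 / (2 * h) + h * (W (x i) + \<epsilon>)" for i
    unfolding step_cost_def by simp
  have "path_cost W h \<epsilon> x 0 k = k * ((norm (w - u) / k)\<^sup>2 / (2 * h)) + h * (\<Sum>i<k. W (x i) + \<epsilon>)"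
    unfolding path_cost_def st by (simp add: sum.distrib sum_distrib_left atLeast0LessThan distrib_left)
  also have "k * ((norm (w - u) / k)\<^sup>2 / (2 * h)) = (norm (w - u))\<^sup>2 / (2 * h * k)"
    using assms by (simp add: field_simps power2_eq_square)
  finally have "path_cost W h \<epsilon> x 0 k = (norm (w - u))\<^sup>2 / (2 * h * k) + h * (\<Sum>i<k. W (x i) + \<epsilon>)" .
  moreover have "path_cost W h \<epsilon> x 0 k \<in> path_costs W h \<epsilon> (x 0) (x k)"
    by (rule segment_in_path_costs) simp
  moreover have "x 0 = u" "x k = w" using assms by (auto simp: x_def)
  ultimately show ?thesis by (simp add: x_def)
qed

section \<open>Existence of minimising paths\<close>

lemma compact_Pi_UNIV:
  fixes K :: "'i \<Rightarrow> 'a::topological_space set"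
  assumes "\<And>i. compact (K i)"
  shows "compact {f. \<forall>i. f i \<in> K i}"
proof -
  have "compactin (product_topology (\<lambda>i. euclidean) UNIV) (PiE UNIV K)"
    using assms by (subst compactin_PiE) auto
  moreover have "PiE UNIV K = {f. \<forall>i. f i \<in> K i}"
    by auto
  ultimately show ?thesis
    unfolding euclidean_product_topology compactin_euclidean_iff by simp
qed

text \<open>The term \<open>\<epsilon>\<close> bounds the number of steps of a path of given cost, so that only finitely
  many compact minimisation problems have to be compared.\<close>

lemma minimal_path_exists:
  fixes W :: "'a::euclidean_space \<Rightarrow> real"
  assumes A: "compact A" "A \<noteq> {}" and Z: "closed Z" "Z \<noteq> {}"
    and W: "continuous_on UNIV W" "\<And>x. W x \<ge> 0" and h: "h > 0" and \<epsilon>: "\<epsilon> > 0"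
  obtains x N where "x 0 \<in> A" "x N \<in> Z"
    "\<And>u w a. u \<in> A \<Longrightarrow> w \<in> Z \<Longrightarrow> a \<in> path_costs W h \<epsilon> u w \<Longrightarrow> path_cost W h \<epsilon> x 0 N \<le> a"
proof -
  obtain u0 w0 where u0: "u0 \<in> A" and w0: "w0 \<in> Z" using A Z by auto
  \<comment> \<open>The one-step path from \<open>u0\<close> to \<open>w0\<close> supplies a
    ceiling: only paths of cost at most \<open>M\<close> have to compete, and these have at most
    \<open>n0\<close> steps, each of length at most \<open>sqrt (2 * h * M)\<close>.\<close>
  define M where "M = path_cost W h \<epsilon> (\<lambda>i. if i = 0 then u0 else w0) 0 1"
  define n0 where "n0 = nat \<lceil>M / (h * \<epsilon>)\<rceil>"
  obtain R0 where R0: "\<And>u. u \<in> A \<Longrightarrow> norm u \<le> R0" using compact_imp_bounded[OF A(1)] by (auto simp: bounded_iff)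
  define R where "R = R0 + n0 * sqrt (2 * h * M)"
  have st0: "step_cost W h \<epsilon> u w \<ge> h * \<epsilon>" "(norm (w - u))\<^sup>2 / (2 * h) \<le> step_cost W h \<epsilon> u w" for u w
    unfolding step_cost_def using mult_nonneg_nonneg[of h "W u"] mult_nonneg_nonneg[of h "W u + \<epsilon>"] W(2)[of u] h \<epsilon>
    by (auto simp: distrib_left intro: add_increasing)
  have st_nonneg: "step_cost W h \<epsilon> u w \<ge> 0" for u w
    using st0(1)[of u w] h \<epsilon> by (meson less_imp_le mult_pos_pos order_trans)
  have M0: "M \<ge> 0" unfolding M_def path_cost_def by (intro sum_nonneg st_nonneg)
  \<comment> \<open>Paths of \<open>n\<close> steps are placed in the space of all sequences, where
    Tychonoff applies. Coordinates beyond \<open>n\<close> do not affect the cost; a competitor is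
    frozen after step \<open>n\<close> to keep them in the ball.\<close>
  define K where "K n = {x. \<forall>i::nat. x i \<in> (if i = 0 then A else UNIV) \<inter> (if i = n then Z else UNIV) \<inter> cball 0 R}" for n
  have K: "compact (K n)" for n
    unfolding K_def using A Z
    by (intro compact_Pi_UNIV closed_Int_compact compact_cball closed_Int) (auto intro: compact_imp_closed)
  have cont: "continuous_on S (\<lambda>x. path_cost W h \<epsilon> x 0 n)" for S n
    unfolding path_cost_def step_cost_def
    by (intro continuous_intros continuous_on_compose2[OF W(1)] continuous_on_subset[OF continuous_on_product_coordinates]) (use h in auto)
  define F where "F = {n. n \<le> n0 \<and> K n \<noteq> {}}"
  have "\<exists>y\<in>K n. \<forall>z\<in>K n. path_cost W h \<epsilon> y 0 n \<le> path_cost W h \<epsilon> z 0 n" if "n \<in> F" for n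
    using that continuous_attains_inf[OF K _ cont] by (auto simp: F_def)
  then obtain X where X: "\<And>n. n \<in> F \<Longrightarrow> X n \<in> K n"
    "\<And>n z. n \<in> F \<Longrightarrow> z \<in> K n \<Longrightarrow> path_cost W h \<epsilon> (X n) 0 n \<le> path_cost W h \<epsilon> z 0 n"
    by metis
  have cheap: "\<exists>m\<in>F. \<exists>z\<in>K m. path_cost W h \<epsilon> z 0 m = path_cost W h \<epsilon> y 0 n"
    if y: "y 0 \<in> A" "y n \<in> Z" "path_cost W h \<epsilon> y 0 n \<le> M" for y n
  proof -
    have "n * (h * \<epsilon>) \<le> path_cost W h \<epsilon> y 0 n"
      unfolding path_cost_def using sum_bounded_below[of "{0..<n}" "h * \<epsilon>"] st0(1) by fastforce
    then have "real n \<le> M / (h * \<epsilon>)" using y h \<epsilon> by (simp add: field_simps)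
    then have n: "n \<le> n0" unfolding n0_def by linarith
    have len: "norm (y (Suc i) - y i) \<le> sqrt (2 * h * M)" if "i < n" for i
    proof -
      have "step_cost W h \<epsilon> (y i) (y (Suc i)) \<le> path_cost W h \<epsilon> y 0 n"
        unfolding path_cost_def by (rule member_le_sum) (use that st_nonneg in auto)
      then have "(norm (y (Suc i) - y i))\<^sup>2 / (2 * h) \<le> M"
        using st0(2)[of "y (Suc i)" "y i"] y(3) by linarith
      then have "(norm (y (Suc i) - y i))\<^sup>2 \<le> 2 * h * M" using h by (simp add: field_simps)
      then show ?thesis by (simp add: real_le_rsqrt)
    qed
    have "norm (y i) \<le> R0 + i * sqrt (2 * h * M)" if "i \<le> n" for i
      using that
    proof (induction i)
      case 0 then show ?case using R0 y by simp
    next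
      case (Suc i)
      then have "norm (y (Suc i)) \<le> norm (y i) + sqrt (2 * h * M)"
        using len[of i] norm_triangle_sub[of "y (Suc i)" "y i"] by simp
      with Suc show ?case by (simp add: algebra_simps)
    qed
    moreover have "i * sqrt (2 * h * M) \<le> n0 * sqrt (2 * h * M)" if "i \<le> n" for i
      using that n M0 h by (intro mult_right_mono) auto
    ultimately have yR: "norm (y i) \<le> R" if "i \<le> n" for i
      using that unfolding R_def by fastforce
    define z where "z i = y (min i n)" for i
    have "z \<in> K n" using y yR by (auto simp: K_def z_def)
    moreover have "path_cost W h \<epsilon> z 0 n = path_cost W h \<epsilon> y 0 n"
      by (rule path_cost_cong) (simp add: z_def)
    ultimately show ?thesis using n unfolding F_def by blast
  qed
  have "F \<noteq> {}"
    using cheap[of "\<lambda>i. if i = 0 then u0 else w0" 1] u0 w0 by (auto simp: M_def)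
  moreover have "finite F" unfolding F_def by simp
  ultimately obtain N where N: "N \<in> F" "\<And>n. n \<in> F \<Longrightarrow> path_cost W h \<epsilon> (X N) 0 N \<le> path_cost W h \<epsilon> (X n) 0 n"
    using arg_min_if_finite[of F "\<lambda>n. path_cost W h \<epsilon> (X n) 0 n"] by (auto simp: not_less)
  have minM: "path_cost W h \<epsilon> (X N) 0 N \<le> path_cost W h \<epsilon> y 0 n"
    if y: "y 0 \<in> A" "y n \<in> Z" "path_cost W h \<epsilon> y 0 n \<le> M" for y n
  proof -
    obtain m z where m: "m \<in> F" "z \<in> K m" "path_cost W h \<epsilon> z 0 m = path_cost W h \<epsilon> y 0 n"
      using cheap[OF y] by auto
    show ?thesis using N(2)[OF m(1)] X(2)[OF m(1,2)] m(3) by linarith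
  qed
  have leM: "path_cost W h \<epsilon> (X N) 0 N \<le> M"
    unfolding M_def by (rule minM) (use u0 w0 in \<open>auto simp: M_def\<close>)
  show thesis
  proof (rule that[of "X N" N])
    show "X N 0 \<in> A" "X N N \<in> Z" using X(1)[OF N(1)] unfolding K_def by (auto split: if_splits)
    show "path_cost W h \<epsilon> (X N) 0 N \<le> a" if uwa: "u \<in> A" "w \<in> Z" "a \<in> path_costs W h \<epsilon> u w" for u w a
    proof -
      obtain y n where y: "a = path_cost W h \<epsilon> y 0 n" "y 0 = u" "y n = w"
        using uwa(3) unfolding path_costs_def by auto
      show ?thesis
        using minM[of y n] leM uwa(1,2) unfolding y(1) y(2,3)[symmetric] by fastforce
    qed
  qed
qed

text \<open>The constant is \<open>sqrt (4 * (B + 1))\<close>: the midpoint comparison bounds the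
  squared speed by \<open>4 * (W + \<epsilon>)\<close>, with \<open>W \<le> B\<close> and
  \<open>\<epsilon> \<le> 1\<close>.\<close>

definition speed_bound :: "real \<Rightarrow> real" where
  "speed_bound B = 2 * sqrt (B + 1)"

section \<open>Paths all of whose segments are minimal\<close>

locale geodesic_path =
  fixes W :: "'a::euclidean_space \<Rightarrow> real" and \<Lambda> B h \<epsilon> :: real and x :: "nat \<Rightarrow> 'a" and N :: nat
  assumes W_nonneg: "\<And>x. W x \<ge> 0" and W_le: "\<And>x. W x \<le> B"
    and W_lipschitz: "\<And>x y. \<bar>W x - W y\<bar> \<le> \<Lambda> * norm (x - y)" and \<Lambda>_nonneg: "\<Lambda> \<ge> 0"
    and h_pos: "h > 0" and \<epsilon>_pos: "\<epsilon> > 0" and \<epsilon>_le: "\<epsilon> \<le> 1"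
    and minimal: "\<And>i j a. i \<le> j \<Longrightarrow> j \<le> N \<Longrightarrow> a \<in> path_costs W h \<epsilon> (x i) (x j) \<Longrightarrow> path_cost W h \<epsilon> x i j \<le> a"
begin

abbreviation "C \<equiv> speed_bound B"

lemma B_nonneg: "B \<ge> 0"
  using W_nonneg[of 0] W_le[of 0] by linarith

lemma C_nonneg: "C \<ge> 0"
  unfolding speed_bound_def using B_nonneg by simp

lemma step_cost_nonneg: "step_cost W h \<epsilon> u w \<ge> 0"
  unfolding step_cost_def using W_nonneg[of u] h_pos \<epsilon>_pos by simp

lemma path_cost_nonneg: "path_cost W h \<epsilon> y i j \<ge> 0"
  unfolding path_cost_def by (intro sum_nonneg step_cost_nonneg)

text \<open>Compare a single step with two half steps: the kinetic cost halves.\<close>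

lemma step_le_midpoint:
  assumes "i < N"
  shows "(norm (x (Suc i) - x i))\<^sup>2 \<le> 4 * h\<^sup>2 * (W (midpoint (x i) (x (Suc i))) + \<epsilon>)"
proof -
  define D where "D = norm (x (Suc i) - x i)"
  have mid: "x i + (1 / 2) *\<^sub>R (x (Suc i) - x i) = midpoint (x i) (x (Suc i))"
    by (simp add: midpoint_def algebra_simps) (simp flip: scaleR_add_left)
  have "D\<^sup>2 / (2 * h * real 2) + h * (\<Sum>k<2. W (x i + (real k / real 2) *\<^sub>R (x (Suc i) - x i)) + \<epsilon>)
      \<in> path_costs W h \<epsilon> (x i) (x (Suc i))"
    unfolding D_def by (rule line_in_path_costs) (use h_pos in auto)
  \<comment> \<open>The potential at \<open>x i\<close> is paid by both paths and cancels; the half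
    steps pay in addition only the potential at the midpoint.\<close>
  moreover have "(\<Sum>k<2. W (x i + (real k / real 2) *\<^sub>R (x (Suc i) - x i)) + \<epsilon>)
      = W (x i) + \<epsilon> + (W (midpoint (x i) (x (Suc i))) + \<epsilon>)"
    using mid by (simp add: numeral_2_eq_2)
  ultimately have "path_cost W h \<epsilon> x i (Suc i)
      \<le> D\<^sup>2 / (2 * h * real 2) + h * (W (x i) + \<epsilon> + (W (midpoint (x i) (x (Suc i))) + \<epsilon>))"
    using minimal[of i "Suc i"] assms by simp
  then have "D\<^sup>2 / (2 * h) \<le> D\<^sup>2 / (4 * h) + h * (W (midpoint (x i) (x (Suc i))) + \<epsilon>)"
    by (simp add: path_cost_def step_cost_def D_def[symmetric] algebra_simps)
  then have "D\<^sup>2 / (4 * h) \<le> h * (W (midpoint (x i) (x (Suc i))) + \<epsilon>)"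
    by simp
  then show ?thesis unfolding D_def[symmetric] using h_pos by (simp add: field_simps power2_eq_square)
qed

lemma step_le:
  assumes "i < N"
  shows "norm (x (Suc i) - x i) \<le> C * h"
proof -
  have "4 * h\<^sup>2 * (W (midpoint (x i) (x (Suc i))) + \<epsilon>) \<le> 4 * h\<^sup>2 * (B + 1)"
    using W_le[of "midpoint (x i) (x (Suc i))"] \<epsilon>_le by (intro mult_left_mono) auto
  also have "\<dots> = (C * h)\<^sup>2"
    using B_nonneg by (simp add: speed_bound_def power_mult_distrib)
  finally have "(norm (x (Suc i) - x i))\<^sup>2 \<le> (C * h)\<^sup>2"
    using step_le_midpoint[OF assms] by linarith
  then show ?thesis
    by (rule power2_le_imp_le) (use C_nonneg h_pos in simp)
qed

lemma steps_le:
  assumes "i \<le> j" "j \<le> N"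
  shows "norm (x j - x i) \<le> C * h * real (j - i)"
  using assms
proof (induction j)
  case (Suc j)
  show ?case
  proof (cases "i = Suc j")
    case False
    then have ij: "i \<le> j" using Suc.prems by simp
    then have "norm (x j - x i) \<le> C * h * real (j - i)" using Suc.IH Suc.prems by simp
    moreover have "norm (x (Suc j) - x i) \<le> norm (x (Suc j) - x j) + norm (x j - x i)"
      using norm_triangle_ineq[of "x (Suc j) - x j" "x j - x i"] by simp
    moreover have "C * h * real (Suc j - i) = C * h * real (j - i) + C * h"
      using ij by (simp add: Suc_diff_le distrib_left)
    moreover have "norm (x (Suc j) - x j) \<le> C * h" using step_le[of j] Suc.prems by simp
    ultimately show ?thesis by linarith
  qed simp
qed simp

text \<open>A zero of \<open>W\<close> at one end of the step makes the midpoint value at most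
  \<open>\<Lambda> * C * h\<close>, so the midpoint comparison gives a speed of order
  \<open>sqrt (h + \<epsilon>)\<close>. This is the discrete trace of zero velocity on the boundary
  of a well.\<close>

lemma end_step_le:
  assumes "i < N" "W (x i) = 0 \<or> W (x (Suc i)) = 0"
  shows "norm (x (Suc i) - x i) \<le> h * (2 * sqrt (\<Lambda> * C * h + \<epsilon>))"
proof -
  let ?m = "midpoint (x i) (x (Suc i))"
  have d: "norm (?m - x i) \<le> C * h" "norm (?m - x (Suc i)) \<le> C * h"
    using step_le[OF assms(1)] dist_midpoint(3,4)[of "x i" "x (Suc i)"]
      norm_ge_zero[of "?m - x i"] norm_ge_zero[of "?m - x (Suc i)"]
    unfolding dist_norm norm_minus_commute[of "x i" "x (Suc i)"] by linarith+
  then have "\<Lambda> * norm (?m - x i) \<le> \<Lambda> * (C * h)" "\<Lambda> * norm (?m - x (Suc i)) \<le> \<Lambda> * (C * h)"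
    using \<Lambda>_nonneg by (auto intro: mult_left_mono)
  then have "W ?m \<le> \<Lambda> * C * h"
    using assms(2) W_lipschitz[of ?m "x i"] W_lipschitz[of ?m "x (Suc i)"]
    by (auto simp: mult.assoc)
  then have "4 * h\<^sup>2 * (W ?m + \<epsilon>) \<le> 4 * h\<^sup>2 * (\<Lambda> * C * h + \<epsilon>)"
    by (intro mult_left_mono) auto
  also have "\<dots> = (h * (2 * sqrt (\<Lambda> * C * h + \<epsilon>)))\<^sup>2"
    using \<Lambda>_nonneg C_nonneg h_pos \<epsilon>_pos by (simp add: power_mult_distrib)
  finally have "(norm (x (Suc i) - x i))\<^sup>2 \<le> (h * (2 * sqrt (\<Lambda> * C * h + \<epsilon>)))\<^sup>2"
    using step_le_midpoint[OF assms(1)] by linarith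
  then show ?thesis
    by (rule power2_le_imp_le) (use \<Lambda>_nonneg C_nonneg h_pos \<epsilon>_pos in simp)
qed

text \<open>The cost of the two steps around node \<open>i\<close>, as a function
  \<open>\<phi>\<close> of the middle node alone, is minimal at \<open>x i\<close>, so its gradient
  \<open>g'\<close> vanishes there. \<open>W\<close> has to be differentiable only at that
  node.\<close>

lemma discrete_euler_lagrange:
  assumes i: "0 < i" "i < N" and g: "(W has_derivative (\<lambda>d. g \<bullet> d)) (at (x i))"
  shows "x (Suc i) - x i - (x i - x (i - 1)) = h\<^sup>2 *\<^sub>R g"
proof -
  define \<phi> where "\<phi> y = ((y - x (i - 1)) \<bullet> (y - x (i - 1))) / (2 * h) + ((y - x (Suc i)) \<bullet> (y - x (Suc i))) / (2 * h) + h * W y" for y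
  have min: "\<phi> (x i) \<le> \<phi> y" for y
  proof -
    have step: "step_cost W h \<epsilon> u w \<in> path_costs W h \<epsilon> u w" for u w
      using segment_in_path_costs[of 0 1 W h \<epsilon> "\<lambda>k. if k = 0 then u else w"] by (simp add: path_cost_def)
    have "step_cost W h \<epsilon> (x (i - 1)) y + step_cost W h \<epsilon> y (x (Suc i)) \<in> path_costs W h \<epsilon> (x (i - 1)) (x (Suc i))"
      by (rule path_costs_trans[OF step step])
    from minimal[OF _ _ this]
    have "path_cost W h \<epsilon> x (i - 1) (Suc i) \<le> step_cost W h \<epsilon> (x (i - 1)) y + step_cost W h \<epsilon> y (x (Suc i))"
      using i by simp
    moreover have "path_cost W h \<epsilon> x (i - 1) (Suc i) = step_cost W h \<epsilon> (x (i - 1)) (x i) + step_cost W h \<epsilon> (x i) (x (Suc i))"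
      using i by (cases i) (auto simp: path_cost_def)
    ultimately show ?thesis
      unfolding step_cost_def \<phi>_def norm_minus_commute[of "x (Suc i)"]
      by (simp add: power2_norm_eq_inner distrib_left)
  qed
  define g' where "g' = (1 / h) *\<^sub>R (x i - x (i - 1)) - (1 / h) *\<^sub>R (x (Suc i) - x i) + h *\<^sub>R g"
  have sq: "((\<lambda>y. (y - p) \<bullet> (y - p) / (2 * h)) has_derivative (\<lambda>d. ((1 / h) *\<^sub>R (x i - p)) \<bullet> d)) (at (x i))" for p
    using h_pos by (auto intro!: derivative_eq_intros simp: inner_commute)
  have "(\<phi> has_derivative (\<lambda>d. ((1 / h) *\<^sub>R (x i - x (i - 1))) \<bullet> d + ((1 / h) *\<^sub>R (x i - x (Suc i))) \<bullet> d + h * (g \<bullet> d))) (at (x i))"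
    unfolding \<phi>_def by (intro has_derivative_add sq has_derivative_mult_right g)
  moreover have "(\<lambda>d. ((1 / h) *\<^sub>R (x i - x (i - 1))) \<bullet> d + ((1 / h) *\<^sub>R (x i - x (Suc i))) \<bullet> d + h * (g \<bullet> d)) = (\<lambda>d. g' \<bullet> d)"
    by (simp add: g'_def fun_eq_iff inner_simps algebra_simps)
  ultimately have "(\<phi> has_derivative (\<lambda>d. g' \<bullet> d)) (at (x i))" by simp
  then have "(\<lambda>d. g' \<bullet> d) = (\<lambda>d. 0)"
    by (rule has_derivative_local_min) (use min in auto)
  then have "g' \<bullet> g' = 0" by metis
  then have "h *\<^sub>R g' = 0" by simp
  then have "(x i - x (i - 1)) - (x (Suc i) - x i) + h\<^sup>2 *\<^sub>R g = 0"
    unfolding g'_def using h_pos by (simp add: scaleR_add_right scaleR_diff_right power2_eq_square)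
  then show ?thesis by (simp add: algebra_simps)
qed

text \<open>Traversing a short stretch of the path in \<open>k'\<close> instead of \<open>k\<close> steps changes its duration
  but not its end points. This discrete variation of the time is what fixes the energy.\<close>

lemma resampling_inequality:
  fixes k k' :: nat
  assumes k: "k > 0" "k' > 0" "i + k \<le> N" and D: "D = norm (x (i + k) - x i)"
  shows "D\<^sup>2 / (2 * h * k) + h * k * (W (x i) + \<epsilon> - \<Lambda> * (C * h * k))
    \<le> D\<^sup>2 / (2 * h * k') + h * k' * (W (x i) + \<epsilon> + \<Lambda> * (C * h * k))"
proof -
  have DC: "D \<le> C * h * k" unfolding D using steps_le[of i "i + k"] k by simp
  have "h * (\<Sum>j<k'. W (x i + (real j / k') *\<^sub>R (x (i + k) - x i)) + \<epsilon>) \<le> h * (\<Sum>j<k'. W (x i) + \<epsilon> + \<Lambda> * (C * h * k))"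
  proof (intro mult_left_mono sum_mono)
    fix j assume j: "j \<in> {..<k'}"
    have "norm ((real j / k') *\<^sub>R (x (i + k) - x i)) \<le> 1 * D"
      unfolding D norm_scaleR by (rule mult_right_mono) (use j k in auto)
    then have "\<Lambda> * norm ((real j / k') *\<^sub>R (x (i + k) - x i)) \<le> \<Lambda> * (C * h * k)"
      using DC \<Lambda>_nonneg by (intro mult_left_mono) auto
    then show "W (x i + (real j / k') *\<^sub>R (x (i + k) - x i)) + \<epsilon> \<le> W (x i) + \<epsilon> + \<Lambda> * (C * h * k)"
      using W_lipschitz[of "x i + (real j / k') *\<^sub>R (x (i + k) - x i)" "x i"] by simp
  qed (use h_pos in simp)
  also have "\<dots> = h * k' * (W (x i) + \<epsilon> + \<Lambda> * (C * h * k))" by simp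
  finally have up: "path_cost W h \<epsilon> x i (i + k) \<le> D\<^sup>2 / (2 * h * k') + h * k' * (W (x i) + \<epsilon> + \<Lambda> * (C * h * k))"
    using minimal[OF _ _ line_in_path_costs[OF k(2) h_pos, of "x (i + k)" "x i" W \<epsilon>]] k
    by (simp add: D[symmetric])
  \<comment> \<open>By Cauchy-Schwarz the \<open>k\<close> steps of the minimiser cost at least the
    kinetic energy of uniform motion along the chord, so both sides can be compared in terms of
    \<open>D\<close>.\<close>
  have "D \<le> (\<Sum>j\<in>{i..<i + k}. norm (x (Suc j) - x j))"
    unfolding D using sum_Suc_diff'[of i "i + k" x] norm_sum[of "\<lambda>j. x (Suc j) - x j" "{i..<i + k}"] by simp
  then have "D\<^sup>2 \<le> (\<Sum>j\<in>{i..<i + k}. norm (x (Suc j) - x j))\<^sup>2"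
    by (rule power_mono) (simp add: D)
  also have "\<dots> \<le> (\<Sum>j\<in>{i..<i + k}. (norm (x (Suc j) - x j))\<^sup>2) * card {i..<i + k}"
    by (rule sum_squared_le_sum_of_squares)
  finally have "D\<^sup>2 / (2 * h * k) \<le> (\<Sum>j\<in>{i..<i + k}. (norm (x (Suc j) - x j))\<^sup>2) / (2 * h)"
    using k h_pos by (simp add: field_simps)
  moreover have "h * (\<Sum>j\<in>{i..<i + k}. W (x i) + \<epsilon> - \<Lambda> * (C * h * k)) \<le> h * (\<Sum>j\<in>{i..<i + k}. W (x j) + \<epsilon>)"
  proof (intro mult_left_mono sum_mono)
    fix j assume j: "j \<in> {i..<i + k}"
    have "norm (x j - x i) \<le> C * h * real (j - i)" using j k by (intro steps_le) auto
    also have "\<dots> \<le> C * h * k" using j C_nonneg h_pos by (intro mult_left_mono) auto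
    finally have "\<Lambda> * norm (x j - x i) \<le> \<Lambda> * (C * h * k)"
      using \<Lambda>_nonneg by (intro mult_left_mono) auto
    then show "W (x i) + \<epsilon> - \<Lambda> * (C * h * k) \<le> W (x j) + \<epsilon>"
      using W_lipschitz[of "x j" "x i"] by simp
  qed (use h_pos in simp)
  moreover have "path_cost W h \<epsilon> x i (i + k) =
      (\<Sum>j\<in>{i..<i + k}. (norm (x (Suc j) - x j))\<^sup>2) / (2 * h) + h * (\<Sum>j\<in>{i..<i + k}. W (x j) + \<epsilon>)"
    unfolding path_cost_def step_cost_def sum_divide_distrib sum_distrib_left by (rule sum.distrib)
  moreover have "h * (\<Sum>j\<in>{i..<i + k}. W (x i) + \<epsilon> - \<Lambda> * (C * h * k)) = h * k * (W (x i) + \<epsilon> - \<Lambda> * (C * h * k))"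
    by (simp only: sum_constant card_atLeastLessThan) simp
  ultimately show ?thesis using up by linarith
qed

end

text \<open>Walk straight from \<open>y\<close> to \<open>u\<close> with speed at most 1. The
  kinetic part costs at most 1/2 per unit time, \<open>W\<close> is at most
  \<open>\<Lambda> * \<rho>\<close> on the way, and rounding the duration \<open>\<rho>\<close> up
  to a multiple of \<open>h\<close> gives the factor \<open>\<rho> + h\<close>.\<close>

lemma cheap_access_path:
  fixes W :: "'a::real_normed_vector \<Rightarrow> real"
  assumes "\<And>x y. \<bar>W x - W y\<bar> \<le> \<Lambda> * norm (x - y)" "\<Lambda> \<ge> 0" "h > 0" "\<epsilon> > 0"
    and "W y = 0" "norm (u - y) \<le> \<rho>" "\<rho> > 0"
  obtains a where "a \<in> path_costs W h \<epsilon> y u" "a \<le> (\<rho> + h) * (1 / 2 + \<Lambda> * \<rho> + \<epsilon>)"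
proof -
  define k where "k = nat \<lceil>\<rho> / h\<rceil>"
  have "\<rho> / h > 0" using assms by simp
  then have kge: "real k \<ge> \<rho> / h" and kle: "real k \<le> \<rho> / h + 1" and k: "k > 0"
    unfolding k_def by linarith+
  have hk: "\<rho> \<le> h * k" "h * k \<le> \<rho> + h" using kge kle assms by (auto simp: field_simps)
  have "(norm (u - y))\<^sup>2 \<le> \<rho>\<^sup>2" using assms by (intro power_mono) auto
  also have "\<rho>\<^sup>2 \<le> \<rho> * (h * k)" using hk assms by (simp add: power2_eq_square)
  finally have kin: "(norm (u - y))\<^sup>2 / (2 * h * k) \<le> \<rho> / 2"
    using k assms by (simp add: field_simps)
  have "h * (\<Sum>i<k. W (y + (real i / k) *\<^sub>R (u - y)) + \<epsilon>) \<le> h * (\<Sum>i<k. \<Lambda> * \<rho> + \<epsilon>)"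
  proof (intro mult_left_mono sum_mono)
    fix j assume j: "j \<in> {..<k}"
    have "norm ((real j / k) *\<^sub>R (u - y)) \<le> 1 * norm (u - y)"
      unfolding norm_scaleR by (rule mult_right_mono) (use j k in auto)
    then have "\<Lambda> * norm ((real j / k) *\<^sub>R (u - y)) \<le> \<Lambda> * \<rho>"
      using assms by (intro mult_left_mono) auto
    then show "W (y + (real j / k) *\<^sub>R (u - y)) + \<epsilon> \<le> \<Lambda> * \<rho> + \<epsilon>"
      using assms(1)[of "y + (real j / k) *\<^sub>R (u - y)" y] assms(5) by simp
  qed (use assms in simp)
  also have "\<dots> = h * k * (\<Lambda> * \<rho> + \<epsilon>)" by simp
  also have "\<dots> \<le> (\<rho> + h) * (\<Lambda> * \<rho> + \<epsilon>)"
    using hk assms by (intro mult_right_mono) auto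
  finally have pot: "h * (\<Sum>i<k. W (y + (real i / k) *\<^sub>R (u - y)) + \<epsilon>) \<le> (\<rho> + h) * (\<Lambda> * \<rho> + \<epsilon>)" .
  have "\<rho> / 2 + (\<rho> + h) * (\<Lambda> * \<rho> + \<epsilon>) \<le> (\<rho> + h) * (1 / 2 + \<Lambda> * \<rho> + \<epsilon>)"
    using assms(3) by (simp add: algebra_simps)
  then have "(norm (u - y))\<^sup>2 / (2 * h * k) + h * (\<Sum>i<k. W (y + (real i / k) *\<^sub>R (u - y)) + \<epsilon>)
      \<le> (\<rho> + h) * (1 / 2 + \<Lambda> * \<rho> + \<epsilon>)"
    by (rule order_trans[OF add_mono[OF kin pot]])
  then show thesis by (rule that[OF line_in_path_costs[OF k assms(3)]])
qed

section \<open>Limits of Euler schemes\<close>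

text \<open>The diagonal argument in topological form: the product of the closures is compact, and
  for a countable index type also sequentially compact.\<close>

lemma pointwise_convergent_subsequence:
  fixes f :: "nat \<Rightarrow> 'i::countable \<Rightarrow> 'a::heine_borel"
  assumes "\<And>i. bounded (range (\<lambda>n. f n i))"
  obtains r where "strict_mono (r :: nat \<Rightarrow> nat)" "\<And>i. convergent (\<lambda>n. f (r n) i)"
proof -
  define S where "S = {g. \<forall>i. g i \<in> closure (range (\<lambda>n. f n i))}"
  have "compact S"
    unfolding S_def by (rule compact_Pi_UNIV) (simp add: compact_closure assms)
  then have "seq_compact S"
    by (rule compact_imp_seq_compact)
  moreover have "\<forall>n. f n \<in> S"
    by (auto simp: S_def intro: closure_subset[THEN subsetD])
  ultimately obtain g r where "g \<in> S" and r: "strict_mono (r :: nat \<Rightarrow> nat)" and lim: "(f \<circ> r) \<longlonglongrightarrow> g"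
    by (rule seq_compactE)
  have "(\<lambda>n. f (r n) i) \<longlonglongrightarrow> g i" for i
  proof -
    have "isCont (\<lambda>x::'i \<Rightarrow> 'a. x i) g"
      using continuous_on_product_coordinates[of i] continuous_on_eq_continuous_at by blast
    from isCont_tendsto_compose[OF this lim] show ?thesis by (simp add: o_def)
  qed
  then show thesis using that[OF r] by (auto simp: convergent_def)
qed

lemma floor_mult_approx:
  assumes "(h::real) > 0"
  shows "\<bar>of_int \<lfloor>t / h\<rfloor> * h - t\<bar> \<le> h" "of_int \<lfloor>t / h\<rfloor> * h \<le> t"
proof -
  have "of_int \<lfloor>t / h\<rfloor> * h \<le> t / h * h" "t / h * h \<le> (of_int \<lfloor>t / h\<rfloor> + 1) * h"
    by (intro mult_right_mono; use assms in linarith)+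
  then show "\<bar>of_int \<lfloor>t / h\<rfloor> * h - t\<bar> \<le> h" "of_int \<lfloor>t / h\<rfloor> * h \<le> t" 
    using assms by (auto simp: algebra_simps abs_le_iff)
qed

lemma floor_mult_tendsto:
  fixes h :: "nat \<Rightarrow> real"
  assumes "\<And>n. h n > 0" "h \<longlonglongrightarrow> 0"
  shows "(\<lambda>n. of_int \<lfloor>t / h n\<rfloor> * h n) \<longlonglongrightarrow> t"
proof -
  have "(\<lambda>n. of_int \<lfloor>t / h n\<rfloor> * h n - t) \<longlonglongrightarrow> 0"
    by (rule Lim_null_comparison[OF always_eventually assms(2)])
      (use floor_mult_approx(1)[OF assms(1)] in auto)
  then show ?thesis using tendsto_add[of _ 0 _ "\<lambda>_. t" t] by fastforce
qed

text \<open>The error is only required to be small after summation over windows of bounded length;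
  this allows for occasional exceptional steps whose error is not of order \<open>h\<close>.\<close>

lemma euler_scheme_limit:
  fixes \<Phi> :: "'a::euclidean_space \<Rightarrow> 'a" and z :: "nat \<Rightarrow> int \<Rightarrow> 'a" and h e :: "nat \<Rightarrow> real"
  assumes cont: "continuous_on UNIV \<Phi>"
    and h: "\<And>n. h n > 0" "h \<longlonglongrightarrow> 0"
    and e: "\<And>n. e n \<ge> 0" "e \<longlonglongrightarrow> 0"
    and bnd: "\<And>n l. norm (\<Phi> (z n l)) \<le> K"
    and z0: "\<And>n. norm (z n 0) \<le> B"
    and step: "\<And>n i j. i \<le> j \<Longrightarrow>
      norm (z n j - z n i - h n *\<^sub>R (\<Sum>l\<in>{i..<j}. \<Phi> (z n l))) \<le> e n * (1 + of_int (j - i) * h n)"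
  obtains r Z where "strict_mono (r :: nat \<Rightarrow> nat)"
    "\<And>t. (Z has_vector_derivative \<Phi> (Z t)) (at t)"
    "\<And>s l t. strict_mono (s :: nat \<Rightarrow> nat) \<Longrightarrow> (\<lambda>m. of_int (l m) * h (r (s m))) \<longlonglongrightarrow> t
       \<Longrightarrow> (\<lambda>m. z (r (s m)) (l m)) \<longlonglongrightarrow> Z t"
proof -
  have K0: "K \<ge> 0" using bnd[of 0 0] norm_ge_zero order_trans by blast
  have "Bseq h" "Bseq e" using h(2) e(2) by (auto intro!: convergent_imp_Bseq convergentI)
  then obtain hm em where "\<And>n. norm (h n) \<le> hm" "\<And>n. norm (e n) \<le> em"
    by (metis BseqE)
  then have hm: "h n \<le> hm" and em: "e n \<le> em" for n
    by (auto simp: abs_le_iff)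
  have incr0: "norm (z n j - z n i) \<le> K * (of_int (j - i) * h n) + e n * (1 + of_int (j - i) * h n)"
    if "i \<le> j" for n i j
  proof -
    have "norm (\<Sum>l\<in>{i..<j}. \<Phi> (z n l)) \<le> (\<Sum>l\<in>{i..<j}. K)"
      by (rule sum_norm_le) (rule bnd)
    then have "norm (h n *\<^sub>R (\<Sum>l\<in>{i..<j}. \<Phi> (z n l))) \<le> h n * (\<Sum>l\<in>{i..<j}. K)"
      using h(1)[of n] by (simp del: sum_constant)
    also have "\<dots> = K * (of_int (j - i) * h n)" using that by simp
    finally have "norm (h n *\<^sub>R (\<Sum>l\<in>{i..<j}. \<Phi> (z n l))) \<le> K * (of_int (j - i) * h n)" .
    moreover have "norm (z n j - z n i) \<le> norm (z n j - z n i - h n *\<^sub>R (\<Sum>l\<in>{i..<j}. \<Phi> (z n l)))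
        + norm (h n *\<^sub>R (\<Sum>l\<in>{i..<j}. \<Phi> (z n l)))"
      by (metis norm_triangle_sub add.commute)
    ultimately show ?thesis using step[OF that, of n] by linarith
  qed
  \<comment> \<open>Equicontinuity up to a remainder that vanishes with \<open>n\<close>. This
    suffices to carry convergence from rational times to all times.\<close>
  have incr: "norm (z n j - z n i) \<le> K * d + e n * (1 + d)"
    if "\<bar>of_int j * h n - of_int i * h n\<bar> \<le> d" for n i j d
  proof -
    have *: "norm (z n j - z n i) \<le> K * d + e n * (1 + d)"
      if "i \<le> j" and d: "\<bar>of_int j * h n - of_int i * h n\<bar> \<le> d" for i j
    proof -
      have "of_int (j - i) * h n \<le> d" using d by (simp add: algebra_simps)
      then have "K * (of_int (j - i) * h n) + e n * (1 + of_int (j - i) * h n) \<le> K * d + e n * (1 + d)"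
        by (intro add_mono mult_left_mono) (use K0 e(1) in auto)
      then show ?thesis using incr0[OF \<open>i \<le> j\<close>, of n] by linarith
    qed
    show ?thesis
      using *[of i j] *[of j i] that by (cases "i \<le> j") (auto simp: norm_minus_commute abs_minus_commute)
  qed
  define f where "f n t = z n \<lfloor>t / h n\<rfloor>" for n t
  have f_incr: "norm (f n t - f n s) \<le> K * (\<bar>t - s\<bar> + 2 * h n) + e n * (1 + (\<bar>t - s\<bar> + 2 * h n))" for n t s
    unfolding f_def
    by (rule incr) (use floor_mult_approx(1)[OF h(1), of t n] floor_mult_approx(1)[OF h(1), of s n] in linarith)
  have f_bdd: "norm (f n t) \<le> B + (K * (\<bar>t\<bar> + 2 * hm) + em * (1 + (\<bar>t\<bar> + 2 * hm)))" for n t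
  proof -
    have "norm (f n t) \<le> norm (f n 0) + norm (f n t - f n 0)"
      by (metis norm_triangle_sub)
    moreover have "norm (f n 0) \<le> B" unfolding f_def using z0 by simp
    moreover have "K * (\<bar>t - 0\<bar> + 2 * h n) + e n * (1 + (\<bar>t - 0\<bar> + 2 * h n)) \<le> K * (\<bar>t\<bar> + 2 * hm) + em * (1 + (\<bar>t\<bar> + 2 * hm))"
      by (intro add_mono mult_left_mono mult_mono) (use K0 hm[of n] em[of n] e(1)[of n] h(1)[of n] in auto)
    ultimately show ?thesis using f_incr[of n t 0] by linarith
  qed
  have "bounded (range (\<lambda>n. f n (of_rat q)))" for q
    using f_bdd by (auto simp: bounded_iff)
  then obtain r where r: "strict_mono (r :: nat \<Rightarrow> nat)"
    and rconv: "\<And>q. convergent (\<lambda>n. f (r n) (of_rat q))"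
    using pointwise_convergent_subsequence[of "\<lambda>n q. f n (of_rat q)"] by auto
  have hr: "(\<lambda>n. h (r n)) \<longlonglongrightarrow> 0" and er: "(\<lambda>n. e (r n)) \<longlonglongrightarrow> 0"
    using LIMSEQ_subseq_LIMSEQ[OF _ r] h(2) e(2) by (auto simp: o_def)
  have mod_lim: "(\<lambda>n. K * (d + 2 * h (r n)) + e (r n) * (1 + (d + 2 * h (r n)))) \<longlonglongrightarrow> K * d" for d
    by (rule tendsto_eq_intros hr er refl | simp)+
  have conv: "convergent (\<lambda>n. f (r n) t)" for t
  proof (rule Cauchy_convergent, rule metric_CauchyI)
    fix \<epsilon> :: real assume \<epsilon>: "\<epsilon> > 0"
    define d where "d = \<epsilon> / (8 * (K + 1))"
    have d: "d > 0" using \<epsilon> K0 by (auto simp: d_def)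
    obtain q where q: "t < of_rat q" "of_rat q < t + d"
      using of_rat_dense[of t "t + d"] d by auto
    have "K * \<bar>t - of_rat q\<bar> \<le> K * d" by (rule mult_left_mono) (use q K0 in auto)
    also have "K * d \<le> (K + 1) * d" using d by simp
    also have "(K + 1) * d = \<epsilon> / 8" using K0 by (simp add: d_def divide_simps)
    also have "\<epsilon> / 8 < \<epsilon> / 4" using \<epsilon> by simp
    finally have "eventually (\<lambda>n. K * (\<bar>t - of_rat q\<bar> + 2 * h (r n)) + e (r n) * (1 + (\<bar>t - of_rat q\<bar> + 2 * h (r n))) < \<epsilon> / 4) sequentially"
      by (rule order_tendstoD(2)[OF mod_lim])
    then obtain N1 where N1: "\<And>n. n \<ge> N1 \<Longrightarrow> norm (f (r n) t - f (r n) (of_rat q)) < \<epsilon> / 4"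
      using f_incr unfolding eventually_sequentially by (meson order_le_less_trans)
    have "Cauchy (\<lambda>n. f (r n) (of_rat q))" using rconv convergent_Cauchy by blast
    then obtain N2 where N2: "\<And>m n. m \<ge> N2 \<Longrightarrow> n \<ge> N2 \<Longrightarrow> dist (f (r m) (of_rat q)) (f (r n) (of_rat q)) < \<epsilon> / 4"
      using \<epsilon> unfolding Cauchy_def by (meson zero_less_divide_iff zero_less_numeral)
    show "\<exists>M. \<forall>m\<ge>M. \<forall>n\<ge>M. dist (f (r m) t) (f (r n) t) < \<epsilon>"
    proof (intro exI allI impI)
      fix m n assume mn: "m \<ge> max N1 N2" "n \<ge> max N1 N2"
      have "dist (f (r m) t) (f (r n) t) \<le> dist (f (r m) t) (f (r m) (of_rat q))
          + dist (f (r m) (of_rat q)) (f (r n) (of_rat q)) + dist (f (r n) t) (f (r n) (of_rat q))"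
        by (smt (verit) dist_commute dist_triangle)
      then show "dist (f (r m) t) (f (r n) t) < \<epsilon>"
        using N1[of m] N1[of n] N2[of m n] mn \<epsilon> by (simp add: dist_norm)
    qed
  qed
  define Z where "Z t = lim (\<lambda>n. f (r n) t)" for t
  have Z: "(\<lambda>n. f (r n) t) \<longlonglongrightarrow> Z t" for t
    using conv unfolding Z_def by (simp add: convergent_LIMSEQ_iff)
  \<comment> \<open>Indices may vary with \<open>m\<close> and further subsequences are allowed,
    because later the interesting times depend on the path and converge only after
    extraction.\<close>
  have seqlim: "(\<lambda>m. z (r (s m)) (l m)) \<longlonglongrightarrow> Z t"
    if s: "strict_mono (s :: nat \<Rightarrow> nat)" and l: "(\<lambda>m. of_int (l m) * h (r (s m))) \<longlonglongrightarrow> t" for s l t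
  proof -
    define d where "d m = \<bar>of_int (l m) * h (r (s m)) - t\<bar> + h (r (s m))" for m
    have hrs: "(\<lambda>n. h (r (s n))) \<longlonglongrightarrow> 0" and ers: "(\<lambda>n. e (r (s n))) \<longlonglongrightarrow> 0"
      using LIMSEQ_subseq_LIMSEQ[OF hr s] LIMSEQ_subseq_LIMSEQ[OF er s] by (auto simp: o_def)
    have "d \<longlonglongrightarrow> 0"
      using tendsto_add[OF tendsto_rabs[OF tendsto_diff[OF l tendsto_const[of t]]] hrs] by (simp add: d_def[abs_def])
    with ers have "(\<lambda>m. K * d m + e (r (s m)) * (1 + d m)) \<longlonglongrightarrow> K * 0 + 0 * (1 + 0)"
      by (intro tendsto_intros)
    then have lim0: "(\<lambda>m. K * d m + e (r (s m)) * (1 + d m)) \<longlonglongrightarrow> 0" by simp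
    have "norm (z (r (s m)) (l m) - f (r (s m)) t) \<le> K * d m + e (r (s m)) * (1 + d m)" for m
      unfolding f_def d_def
      by (rule incr) (use floor_mult_approx(1)[OF h(1), of t "r (s m)"] in linarith)
    then have "(\<lambda>m. z (r (s m)) (l m) - f (r (s m)) t) \<longlonglongrightarrow> 0"
      by (intro Lim_null_comparison[OF always_eventually lim0] allI)
    moreover have "(\<lambda>m. f (r (s m)) t) \<longlonglongrightarrow> Z t"
      using LIMSEQ_subseq_LIMSEQ[OF Z s] by (simp add: o_def)
    ultimately show ?thesis using tendsto_add by fastforce
  qed
  \<comment> \<open>Near time \<open>t\<close> all values of the scheme lie where
    \<open>\<Phi>\<close> is within \<open>\<epsilon>\<close> of \<open>\<Phi> (Z t)\<close>, so the
    Euler sums over \<open>[a, b]\<close> are almost linear, and the estimate survives the limit.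
    Only continuity of \<open>\<Phi>\<close> enters.\<close>
  have deriv: "(Z has_vector_derivative \<Phi> (Z t)) (at t)" for t
    unfolding has_vector_derivative_def has_derivative_within_alt
  proof (intro conjI allI impI)
    show "bounded_linear (\<lambda>x. x *\<^sub>R \<Phi> (Z t))" by (rule bounded_linear_scaleR_left)
    fix \<epsilon> :: real assume \<epsilon>: "\<epsilon> > 0"
    obtain \<delta> where \<delta>: "\<delta> > 0" "\<And>y. norm (y - Z t) < \<delta> \<Longrightarrow> norm (\<Phi> y - \<Phi> (Z t)) < \<epsilon>"
      using cont \<epsilon> unfolding continuous_on_iff dist_norm by (metis UNIV_I)
    define d where "d = \<delta> / (8 * (K + 1))"
    have d: "d > 0" using \<delta> K0 by (auto simp: d_def)
    have "K * d \<le> (K + 1) * d" using d by simp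
    also have "(K + 1) * d = \<delta> / 8" using K0 by (simp add: d_def divide_simps)
    also have "\<delta> / 8 < \<delta> / 4" using \<delta> by simp
    finally have Kd: "K * d < \<delta> / 4" .
    have main: "norm (Z b - Z a - (b - a) *\<^sub>R \<Phi> (Z t)) \<le> \<epsilon> * (b - a)"
      if ab: "a \<le> b" "\<bar>a - t\<bar> < d" "\<bar>b - t\<bar> < d" for a b
    proof -
      define i j where "i n = \<lfloor>a / h (r n)\<rfloor>" and "j n = \<lfloor>b / h (r n)\<rfloor>" for n
      have ij: "i n \<le> j n" for n
        unfolding i_def j_def using ab h(1)[of "r n"] by (intro floor_mono divide_right_mono) auto
      have len: "(\<lambda>n. of_int (j n - i n) * h (r n)) \<longlonglongrightarrow> b - a"
        using tendsto_diff[OF floor_mult_tendsto[OF h(1) hr, of b] floor_mult_tendsto[OF h(1) hr, of a]] by (simp add: i_def j_def algebra_simps)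
      have ev1: "eventually (\<lambda>n. K * (d + 2 * h (r n)) + e (r n) * (1 + (d + 2 * h (r n))) < \<delta> / 4) sequentially"
        by (rule order_tendstoD(2)[OF mod_lim Kd])
      have ev2: "eventually (\<lambda>n. norm (f (r n) t - Z t) < \<delta> / 4) sequentially"
        using Z[of t] \<delta>(1) unfolding tendsto_iff dist_norm by (meson zero_less_divide_iff zero_less_numeral)
      have "eventually (\<lambda>n. norm (z (r n) (j n) - z (r n) (i n) - (of_int (j n - i n) * h (r n)) *\<^sub>R \<Phi> (Z t))
          \<le> e (r n) * (1 + of_int (j n - i n) * h (r n)) + \<epsilon> * (of_int (j n - i n) * h (r n))) sequentially"
        using ev1 ev2
      proof eventually_elim
        case (elim n)
        have close: "norm (\<Phi> (z (r n) l) - \<Phi> (Z t)) \<le> \<epsilon>" if l: "l \<in> {i n..<j n}" for l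
        proof -
          have "of_int (i n) * h (r n) \<le> of_int l * h (r n)" "of_int l * h (r n) \<le> of_int (j n) * h (r n)"
            using l h(1)[of "r n"] by (auto intro!: mult_right_mono)
          then have "\<bar>of_int l * h (r n) - of_int \<lfloor>t / h (r n)\<rfloor> * h (r n)\<bar> \<le> d + 2 * h (r n)"
            using floor_mult_approx(1)[OF h(1), of t "r n"] floor_mult_approx(1)[OF h(1), of a "r n"]
              floor_mult_approx(2)[OF h(1), of b "r n"] ab unfolding i_def j_def by linarith
          from incr[OF this] have "norm (z (r n) l - f (r n) t) < \<delta> / 4"
            using elim unfolding f_def by linarith
          then have "norm (z (r n) l - Z t) < \<delta>"
            using elim(2) norm_triangle_lt[of "z (r n) l - f (r n) t" "f (r n) t - Z t" \<delta>] \<delta>(1) by simp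
          then show ?thesis using \<delta>(2) less_imp_le by blast
        qed
        have "norm (h (r n) *\<^sub>R (\<Sum>l\<in>{i n..<j n}. \<Phi> (z (r n) l)) - (of_int (j n - i n) * h (r n)) *\<^sub>R \<Phi> (Z t))
          = norm (h (r n) *\<^sub>R (\<Sum>l\<in>{i n..<j n}. \<Phi> (z (r n) l) - \<Phi> (Z t)))"
          using ij[of n] by (simp add: sum_subtractf scaleR_diff_right sum_constant_scaleR mult.commute)
        also have "\<dots> \<le> h (r n) * (\<Sum>l\<in>{i n..<j n}. \<epsilon>)"
          using sum_norm_le[of "{i n..<j n}" "\<lambda>l. \<Phi> (z (r n) l) - \<Phi> (Z t)" "\<lambda>_. \<epsilon>"] close h(1)[of "r n"]
          by (simp del: sum_constant)
        also have "\<dots> = \<epsilon> * (of_int (j n - i n) * h (r n))" using ij[of n] by simp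
        finally show ?case
          using step[OF ij[of n], of "r n"]
            norm_triangle_ineq[of "z (r n) (j n) - z (r n) (i n) - h (r n) *\<^sub>R (\<Sum>l\<in>{i n..<j n}. \<Phi> (z (r n) l))"
              "h (r n) *\<^sub>R (\<Sum>l\<in>{i n..<j n}. \<Phi> (z (r n) l)) - (of_int (j n - i n) * h (r n)) *\<^sub>R \<Phi> (Z t)"]
          by simp
      qed
      moreover have "(\<lambda>n. norm (z (r n) (j n) - z (r n) (i n) - (of_int (j n - i n) * h (r n)) *\<^sub>R \<Phi> (Z t)))
          \<longlonglongrightarrow> norm (Z b - Z a - (b - a) *\<^sub>R \<Phi> (Z t))"
        using Z[of a] Z[of b] len unfolding f_def i_def[symmetric] j_def[symmetric]
        by (intro tendsto_intros)
      moreover have "(\<lambda>n. e (r n) * (1 + of_int (j n - i n) * h (r n)) + \<epsilon> * (of_int (j n - i n) * h (r n)))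
          \<longlonglongrightarrow> \<epsilon> * (b - a)"
        by (rule tendsto_eq_intros er len refl | simp)+
      ultimately show ?thesis
        by (intro tendsto_le[OF sequentially_bot])
    qed
    show "\<exists>d>0. \<forall>y\<in>UNIV. norm (y - t) < d \<longrightarrow>
        norm (Z y - Z t - (y - t) *\<^sub>R \<Phi> (Z t)) \<le> \<epsilon> * norm (y - t)"
    proof (intro exI[of _ d] conjI ballI impI d)
      fix y assume y: "norm (y - t) < d"
      show "norm (Z y - Z t - (y - t) *\<^sub>R \<Phi> (Z t)) \<le> \<epsilon> * norm (y - t)"
      proof (cases "t \<le> y")
        case True
        then show ?thesis using main[of t y] y d by auto
      next
        case False
        have "norm (Z y - Z t - (y - t) *\<^sub>R \<Phi> (Z t)) = norm (Z t - Z y - (t - y) *\<^sub>R \<Phi> (Z t))"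
          by (subst norm_minus_commute) (simp add: algebra_simps)
        then show ?thesis using main[of y t] y d False by auto
      qed
    qed
  qed
  show thesis using that[OF r deriv seqlim] .
qed

section \<open>The reflected discrete path as an Euler scheme\<close>

text \<open>A path is extended to all integer times by reflection at its two end points. The discrete
  Euler-Lagrange equation then fails only at the reflection times, and only by the size of the end
  velocities, which is small since \<open>W\<close> vanishes there. In the limit this yields a solution on the
  whole line, also when the connection takes finite time.\<close>

definition fold_index :: "nat \<Rightarrow> int \<Rightarrow> int" where
  "fold_index N i = \<bar>(i + int N) mod (2 * int N) - int N\<bar>"

text \<open>Here \<open>s\<close> represents \<open>i\<close> modulo \<open>2 * N\<close> in
  \<open>(-N, N]\<close>, and folding is the absolute value of \<open>s\<close>. Stepping back never
  leaves the range of the formula; stepping forward does so only at \<open>s = N\<close>, hence the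
  case distinction. Reflection happens at \<open>s = 0\<close> and \<open>s = N\<close>, both
  multiples of \<open>N\<close>.\<close>

lemma fold_index_neighbours:
  assumes "N > 0"
  obtains s where "1 - int N \<le> s" "s \<le> int N" "fold_index N i = \<bar>s\<bar>" "fold_index N (i - 1) = \<bar>s - 1\<bar>"
    "fold_index N (i + 1) = (if s = int N then int N - 1 else \<bar>s + 1\<bar>)" "s = 0 \<or> s = int N \<longrightarrow> int N dvd i"
proof -
  define m where "m = (i - 1 + int N) mod (2 * int N)"
  have m: "0 \<le> m" "m < 2 * int N" using assms unfolding m_def by auto
  have suc: "(a + 1) mod (2 * int N) = (if a mod (2 * int N) = 2 * int N - 1 then 0 else a mod (2 * int N) + 1)" for a
  proof -
    define b where "b = a mod (2 * int N)"
    have b: "0 \<le> b" "b < 2 * int N" using assms unfolding b_def by auto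
    have "(a + 1) mod (2 * int N) = (b + 1) mod (2 * int N)" unfolding b_def by (simp add: mod_add_left_eq)
    also have "\<dots> = (if b = 2 * int N - 1 then 0 else b + 1)" using b by auto
    finally show ?thesis unfolding b_def .
  qed
  have m1: "(i + int N) mod (2 * int N) = (if m = 2 * int N - 1 then 0 else m + 1)"
    using suc[of "i - 1 + int N"] by (simp add: m_def algebra_simps)
  have m2: "(i + 1 + int N) mod (2 * int N) = (if (i + int N) mod (2 * int N) = 2 * int N - 1 then 0 else (i + int N) mod (2 * int N) + 1)"
    using suc[of "i + int N"] by (simp add: algebra_simps)
  show thesis
  \<comment> \<open>The residue \<open>m\<close> was taken at \<open>i - 1\<close>, so that the
    predecessor needs no wrap-around and only the two successors do.\<close>
  proof (rule that[of "m + 1 - int N"])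
    show "fold_index N i = \<bar>m + 1 - int N\<bar>" "fold_index N (i - 1) = \<bar>m + 1 - int N - 1\<bar>"
      unfolding fold_index_def m1 m_def[symmetric] using m by auto
    show "fold_index N (i + 1) = (if m + 1 - int N = int N then int N - 1 else \<bar>m + 1 - int N + 1\<bar>)"
      unfolding fold_index_def m2 m1 using m by auto presburger+
    show "m + 1 - int N = 0 \<or> m + 1 - int N = int N \<longrightarrow> int N dvd i"
    proof
      assume "m + 1 - int N = 0 \<or> m + 1 - int N = int N"
      moreover have "i - 1 + int N = 2 * int N * ((i - 1 + int N) div (2 * int N)) + m"
        unfolding m_def by simp
      ultimately have "i = int N * (2 * ((i - 1 + int N) div (2 * int N))) \<or> i = int N * (2 * ((i - 1 + int N) div (2 * int N)) + 1)"
        by (auto simp: algebra_simps)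
      then show "int N dvd i" by (elim disjE) (erule dvdI)+
    qed
  qed (use m in auto)
qed

lemma fold_index_range: "0 \<le> fold_index N i" "N > 0 \<Longrightarrow> fold_index N i \<le> int N"
proof -
  show "0 \<le> fold_index N i" unfolding fold_index_def by simp
  assume N: "N > 0"
  show "fold_index N i \<le> int N" by (rule fold_index_neighbours[OF N, of i]) auto
qed

lemma fold_index_id:
  assumes "N > 0" "0 \<le> i" "i \<le> int N"
  shows "fold_index N i = i"
proof (cases "i = int N")
  case False
  then show ?thesis using assms unfolding fold_index_def by simp
next
  case True
  then have "i + int N = 2 * int N" by simp
  then show ?thesis using True unfolding fold_index_def by simp
qed

lemma fold_index_lipschitz:
  assumes "N > 0"
  shows "\<bar>fold_index N (i + l) - fold_index N i\<bar> \<le> \<bar>l\<bar>"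
proof -
  have one: "\<bar>fold_index N (j + 1) - fold_index N j\<bar> \<le> 1" for j
    by (rule fold_index_neighbours[OF assms, of "j + 1"]) auto
  have pos: "\<bar>fold_index N (j + int k) - fold_index N j\<bar> \<le> int k" for j k
  proof (induction k)
    case (Suc k)
    then show ?case using one[of "j + int k"] by (simp add: algebra_simps)
  qed simp
  show ?thesis
    using pos[of i "nat l"] pos[of "i + l" "nat (- l)"] by (cases "l \<ge> 0") auto
qed

text \<open>The quotient by \<open>N\<close> jumps by one exactly at multiples of \<open>N\<close>,
  so the count telescopes to a difference of two quotients. It bounds the number of reflections in a
  window.\<close>

lemma count_multiples_le:
  assumes "N > 0" "i \<le> j"
  shows "(\<Sum>l\<in>{i..<j}. if int N dvd p + l then 1 else 0 :: real) \<le> of_int (j - i) / N + 1"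
proof -
  have jump: "(m div int N) - ((m - 1) div int N) = (if int N dvd m then 1 else 0)" for m
  proof (cases "int N dvd m")
    case True
    then obtain k where k: "m = int N * k" by blast
    have "(m - 1) div int N = k - 1"
      by (rule int_div_pos_eq[where r = "int N - 1"]) (use assms k in \<open>auto simp: algebra_simps\<close>)
    then show ?thesis using True k assms by simp
  next
    case False
    define k r where "k = m div int N" and "r = m mod int N"
    have m: "m = int N * k + r" "r \<noteq> 0" "0 \<le> r" "r < int N"
      using False assms by (auto simp: k_def r_def dvd_eq_mod_eq_0)
    have "(m - 1) div int N = k"
      by (rule int_div_pos_eq[where r = "r - 1"]) (use m in auto)
    then show ?thesis using False by (simp add: k_def)
  qed
  have "(\<Sum>l\<in>{i..<j}. if int N dvd p + l then 1 else 0 :: real)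
      = of_int ((p + j - 1) div int N) - of_int ((p + i - 1) div int N)"
    using assms(2)
  proof (induction j rule: int_ge_induct)
    case (step j)
    have "{i..<j + 1} = insert j {i..<j}" using step by auto
    then show ?case using step jump[of "p + j"] by (simp add: algebra_simps of_int_diff[symmetric] del: of_int_diff)
  qed simp
  also have "\<dots> \<le> of_int (j - i) / N + 1"
  proof -
    have a: "real_of_int (m div int N) \<le> of_int m / N" "of_int m / N < real_of_int (m div int N) + 1" for m
      using floor_divide_of_int_eq[of m "int N", where ?'a = real] floor_correct[of "real_of_int m / real N"]
      by auto
    show ?thesis using a(1)[of "p + j - 1"] a(2)[of "p + i - 1"]
      by (simp add: diff_divide_distrib add_divide_distrib)
  qed
  finally show ?thesis .
qed

definition reflected :: "(nat \<Rightarrow> 'a) \<Rightarrow> nat \<Rightarrow> nat \<Rightarrow> int \<Rightarrow> 'a" where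
  "reflected x N p l = x (nat (fold_index N (int p + l)))"

definition velocity :: "real \<Rightarrow> (int \<Rightarrow> 'a::real_normed_vector) \<Rightarrow> int \<Rightarrow> 'a" where
  "velocity h X l = (1 / h) *\<^sub>R (X l - X (l - 1))"

text \<open>A signed discrete integral from time 0; one of the two sums is always empty. As
  \<open>velocity\<close> is a backward difference, index \<open>k + 1\<close> pairs the step
  leaving \<open>X k\<close> with the potential at \<open>X k\<close>, as in
  \<open>step_cost\<close>, but without the charge \<open>\<epsilon>\<close>.\<close>

definition accumulated_action :: "('a::real_normed_vector \<Rightarrow> real) \<Rightarrow> real \<Rightarrow> (int \<Rightarrow> 'a) \<Rightarrow> int \<Rightarrow> real" where
  "accumulated_action W h X l =
     (\<Sum>k\<in>{0..<l}. h * (1 / 2 * (norm (velocity h X (k + 1)))\<^sup>2 + W (X k)))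
     - (\<Sum>k\<in>{l..<0}. h * (1 / 2 * (norm (velocity h X (k + 1)))\<^sup>2 + W (X k)))"

definition phase_point :: "('a::real_normed_vector \<Rightarrow> real) \<Rightarrow> real \<Rightarrow> (int \<Rightarrow> 'a) \<Rightarrow> int \<Rightarrow> 'a \<times> 'a \<times> real" where
  "phase_point W h X l = (X l, velocity h X l, accumulated_action W h X l)"

definition phase_field :: "('a::real_normed_vector \<Rightarrow> real) \<Rightarrow> ('a \<Rightarrow> 'a) \<Rightarrow> 'a \<times> 'a \<times> real \<Rightarrow> 'a \<times> 'a \<times> real" where
  "phase_field W g = (\<lambda>(q, v, s). (v, g q, 1 / 2 * (norm v)\<^sup>2 + W q))"

lemma sum_int_atLeastLessThan_Suc: "i \<le> j \<Longrightarrow> sum f {i..<j + 1} = sum f {i..<j} + f (j :: int)" for f :: "int \<Rightarrow> 'b::comm_monoid_add"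
proof -
  assume "i \<le> j"
  then have "{i..<j + 1} = insert j {i..<j}" by auto
  then show ?thesis by (simp add: add.commute)
qed

lemma accumulated_action_diff:
  assumes "i \<le> j"
  shows "accumulated_action W h X j - accumulated_action W h X i =
    (\<Sum>k\<in>{i..<j}. h * (1 / 2 * (norm (velocity h X (k + 1)))\<^sup>2 + W (X k)))"
  using assms
proof (induction j rule: int_ge_induct)
  case (step j)
  have "accumulated_action W h X (j + 1) - accumulated_action W h X j =
      h * (1 / 2 * (norm (velocity h X (j + 1)))\<^sup>2 + W (X j))"
  proof (cases "j \<ge> 0")
    case True
    then show ?thesis unfolding accumulated_action_def by (simp add: sum_int_atLeastLessThan_Suc)
  next
    case False
    then have "{j..<0} = insert j {j + 1..<0}" by auto
    then show ?thesis using False unfolding accumulated_action_def by simp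
  qed
  with step show ?case by (simp add: sum_int_atLeastLessThan_Suc)
qed simp

text \<open>The first summand is the consistency error per unit time at regular nodes. The second is
  the defect at one reflection, times \<open>1 + 1 / d\<close>, since paths of duration at least
  \<open>d\<close> have at most \<open>t / d + 1\<close> reflections in time
  \<open>t\<close>.\<close>

definition scheme_error :: "real \<Rightarrow> real \<Rightarrow> real \<Rightarrow> real \<Rightarrow> real \<Rightarrow> real" where
  "scheme_error \<Lambda> B d h \<epsilon> = h * \<Lambda> * (1 + speed_bound B)
     + (2 * (2 * sqrt (\<Lambda> * speed_bound B * h + \<epsilon>)) + h * \<Lambda>) * (1 + h * (1 + speed_bound B)) * (1 + 1 / d)"

text \<open>The field \<open>g\<close> has to be the gradient of \<open>W\<close> only at inner
  nodes, since \<open>W\<close> may fail to be differentiable at the ends. The number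
  \<open>d\<close> bounds the duration of the path from below and thereby the frequency of
  reflections.\<close>

locale reflected_geodesic = geodesic_path W \<Lambda> B h \<epsilon> x N
  for W :: "'a::euclidean_space \<Rightarrow> real" and \<Lambda> B h \<epsilon> x N +
  fixes g :: "'a \<Rightarrow> 'a" and p :: nat and d :: real
  assumes W_ends: "W (x 0) = 0" "W (x N) = 0" and N_pos: "N > 0" and p_le: "p \<le> N"
    and g: "\<And>i. 0 < i \<Longrightarrow> i < N \<Longrightarrow> (W has_derivative (\<lambda>d. g (x i) \<bullet> d)) (at (x i))"
    and g_le: "\<And>y. norm (g y) \<le> \<Lambda>"
    and d: "d > 0" "d \<le> h * N"
begin

abbreviation "X \<equiv> reflected x N p"
abbreviation "\<rho> \<equiv> 2 * sqrt (\<Lambda> * C * h + \<epsilon>)"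

lemma velocity_le: "norm (velocity h X l) \<le> C"
proof -
  obtain s where s: "1 - int N \<le> s" "s \<le> int N" "fold_index N (p + l) = \<bar>s\<bar>" "fold_index N (p + l - 1) = \<bar>s - 1\<bar>"
    by (rule fold_index_neighbours[OF N_pos])
  have X: "X l = x (nat \<bar>s\<bar>)" "X (l - 1) = x (nat \<bar>s - 1\<bar>)"
    unfolding reflected_def using s by (simp_all add: add_diff_eq)
  have "norm (X l - X (l - 1)) \<le> C * h"
  proof (cases "s > 0")
    case True
    then show ?thesis using step_le[of "nat (s - 1)"] s X by (simp add: Suc_nat_eq_nat_zadd1 add.commute)
  next
    case False
    then show ?thesis using step_le[of "nat (- s)"] s X by (simp add: Suc_nat_eq_nat_zadd1 norm_minus_commute)
  qed
  then show ?thesis using h_pos unfolding velocity_def norm_scaleR by (simp add: divide_simps mult.commute)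
qed

text \<open>Away from reflections this is the discrete Euler-Lagrange equation, which is invariant
  under time reversal. At a reflection the second difference is twice the end step, of size at most
  \<open>2 * h * \<rho>\<close>.\<close>

lemma velocity_step:
  fixes l :: int
  shows "norm (velocity h X (l + 1) - velocity h X l - h *\<^sub>R g (X l)) \<le> (2 * \<rho> + h * \<Lambda>) * (if int N dvd p + l then 1 else 0)"
proof -
  obtain s where s: "1 - int N \<le> s" "s \<le> int N" "fold_index N (p + l) = \<bar>s\<bar>" "fold_index N (p + l - 1) = \<bar>s - 1\<bar>"
    "fold_index N (p + l + 1) = (if s = int N then int N - 1 else \<bar>s + 1\<bar>)" "s = 0 \<or> s = int N \<longrightarrow> int N dvd p + l"
    by (rule fold_index_neighbours[OF N_pos, of "int p + l"])
  have X: "X l = x (nat \<bar>s\<bar>)" "X (l - 1) = x (nat \<bar>s - 1\<bar>)" "X (l + 1) = x (nat (if s = int N then int N - 1 else \<bar>s + 1\<bar>))"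
    unfolding reflected_def using s by (simp_all add: add_diff_eq add.assoc)
  define a where "a = X (l + 1) - X l - (X l - X (l - 1))"
  have va: "velocity h X (l + 1) - velocity h X l = (1 / h) *\<^sub>R a"
    unfolding velocity_def a_def by (simp add: scaleR_diff_right)
  show ?thesis
  proof (cases "s = 0 \<or> s = int N")
    case True
    have "norm a \<le> 2 * (h * \<rho>)"
    proof (cases "s = 0")
      case True
      then have "a = 2 *\<^sub>R (x (Suc 0) - x 0)" using X N_pos by (auto simp: a_def scaleR_2 algebra_simps nat_eq_iff)
      then show ?thesis using end_step_le[of 0] W_ends N_pos by simp
    next
      case False
      then have "s = int N" using True by simp
      then have "X l = x N" "X (l - 1) = x (N - 1)" "X (l + 1) = x (N - 1)"
        using X N_pos by (auto simp: nat_diff_distrib)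
      then have "a = 2 *\<^sub>R (x (N - 1) - x N)" by (simp add: a_def scaleR_2)
      then show ?thesis using end_step_le[of "N - 1"] W_ends N_pos by (simp add: norm_minus_commute)
    qed
    then have "norm ((1 / h) *\<^sub>R a) \<le> 2 * \<rho>" using h_pos unfolding norm_scaleR by (simp add: divide_simps mult_ac)
    moreover have "norm (h *\<^sub>R g (X l)) \<le> h * \<Lambda>" using g_le h_pos by simp
    ultimately show ?thesis
      using norm_triangle_ineq4[of "(1 / h) *\<^sub>R a" "h *\<^sub>R g (X l)"] s(6) True unfolding va by simp
  next
    case False
    define f where "f = nat \<bar>s\<bar>"
    have f: "0 < f" "f < N" using False s(1,2) unfolding f_def by auto
    have X3: "X (l + 1) = x (nat \<bar>s + 1\<bar>)" using X(3) False by simp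
    have "a = x (Suc f) - x f - (x f - x (f - 1))"
    proof (cases "s > 0")
      case True
      then have "nat \<bar>s - 1\<bar> = f - 1" "nat \<bar>s + 1\<bar> = Suc f" unfolding f_def by auto
      then show ?thesis unfolding a_def X(1,2) X3 f_def[symmetric] by (simp only:)
    next
      case neg: False
      then have "nat \<bar>s - 1\<bar> = Suc f" "nat \<bar>s + 1\<bar> = f - 1" using False unfolding f_def by auto
      then show ?thesis unfolding a_def X(1,2) X3 f_def[symmetric] by (simp only:) (simp add: algebra_simps)
    qed
    then have "a = h\<^sup>2 *\<^sub>R g (x f)" using discrete_euler_lagrange[OF f g[OF f]] by simp
    then have "velocity h X (l + 1) - velocity h X l = h *\<^sub>R g (X l)"
      unfolding va X f_def using h_pos by (simp add: power2_eq_square)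
    moreover have "0 \<le> 2 * \<rho> + h * \<Lambda>"
      using h_pos \<epsilon>_pos \<Lambda>_nonneg C_nonneg by simp
    ultimately show ?thesis by simp
  qed
qed

lemma phase_step:
  fixes l :: int
  shows "norm (phase_point W h X (l + 1) - phase_point W h X l - h *\<^sub>R phase_field W g (phase_point W h X l))
    \<le> h * (h * \<Lambda> * (1 + C)) + (2 * \<rho> + h * \<Lambda>) * (1 + h * (1 + C)) * (if int N dvd p + l then 1 else 0)"
proof -
  define v v' r where "v = velocity h X l" and "v' = velocity h X (l + 1)" and "r = v' - v - h *\<^sub>R g (X l)"
  define R where "R = (2 * \<rho> + h * \<Lambda>) * (if int N dvd p + l then 1 else 0)"
  have r: "norm r \<le> R" unfolding r_def v_def v'_def R_def by (rule velocity_step)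
  have "norm (v' - v) \<le> norm r + norm (h *\<^sub>R g (X l))"
    unfolding r_def by (metis diff_add_cancel norm_triangle_ineq)
  also have "norm (h *\<^sub>R g (X l)) \<le> h * \<Lambda>" using g_le h_pos by simp
  finally have vv: "norm (v' - v) \<le> R + h * \<Lambda>" using r by simp
  have X: "X (l + 1) - X l = h *\<^sub>R v'" unfolding v'_def velocity_def using h_pos by simp
  have G: "accumulated_action W h X (l + 1) - accumulated_action W h X l = h * (1 / 2 * (norm v')\<^sup>2 + W (X l))"
    using accumulated_action_diff[of l "l + 1" W h X] by (simp add: sum_int_atLeastLessThan_Suc v'_def)
  \<comment> \<open>Position and action advance with the new velocity \<open>v'\<close> whereas the
    Euler scheme uses \<open>v\<close>; both errors are therefore controlled by
    \<open>v' - v\<close>, with the speed bound \<open>C\<close> used for the squares.\<close>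
  have "phase_point W h X (l + 1) - phase_point W h X l - h *\<^sub>R phase_field W g (phase_point W h X l)
      = (h *\<^sub>R (v' - v), r, h * (1 / 2 * ((norm v')\<^sup>2 - (norm v)\<^sup>2)))"
    unfolding phase_point_def phase_field_def r_def v_def[symmetric] v'_def[symmetric]
    using X G by (simp add: scaleR_diff_right algebra_simps)
  also have "norm \<dots> \<le> norm (h *\<^sub>R (v' - v)) + (norm r + norm (h * (1 / 2 * ((norm v')\<^sup>2 - (norm v)\<^sup>2))))"
    by (intro order_trans[OF norm_Pair_le] add_mono order_refl)
  also have "norm (h *\<^sub>R (v' - v)) \<le> h * (R + h * \<Lambda>)"
    using vv h_pos by simp
  also have "norm (h * (1 / 2 * ((norm v')\<^sup>2 - (norm v)\<^sup>2))) \<le> h * (C * (R + h * \<Lambda>))"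
  proof -
    have "\<bar>(norm v')\<^sup>2 - (norm v)\<^sup>2\<bar> = \<bar>norm v' - norm v\<bar> * (norm v' + norm v)"
      by (simp add: power2_eq_square square_diff_square_factored abs_mult)
    also have "\<dots> \<le> (R + h * \<Lambda>) * (C + C)"
      using norm_triangle_ineq3[of v' v] vv velocity_le[of l] velocity_le[of "l + 1"]
      unfolding v_def[symmetric] v'_def[symmetric] by (intro mult_mono add_mono) auto
    finally have "\<bar>(norm v')\<^sup>2 - (norm v)\<^sup>2\<bar> / 2 \<le> C * (R + h * \<Lambda>)" by (simp add: algebra_simps)
    then have "h * (\<bar>(norm v')\<^sup>2 - (norm v)\<^sup>2\<bar> / 2) \<le> h * (C * (R + h * \<Lambda>))"
      by (rule mult_left_mono) (use h_pos in simp)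
    then show ?thesis using h_pos by (simp add: abs_mult)
  qed
  finally have "norm (phase_point W h X (l + 1) - phase_point W h X l - h *\<^sub>R phase_field W g (phase_point W h X l))
      \<le> h * (R + h * \<Lambda>) + (R + h * (C * (R + h * \<Lambda>)))" using r by simp
  also have "\<dots> = h * (h * \<Lambda> * (1 + C)) + R * (1 + h * (1 + C))" by (simp add: algebra_simps)
  finally show ?thesis unfolding R_def by (simp add: mult_ac)
qed

lemma scheme_error_nonneg: "0 \<le> scheme_error \<Lambda> B d h \<epsilon>"
  unfolding scheme_error_def using h_pos \<epsilon>_pos \<Lambda>_nonneg C_nonneg d by simp

lemma phase_error:
  assumes "i \<le> j"
  shows "norm (phase_point W h X j - phase_point W h X i - h *\<^sub>R (\<Sum>l\<in>{i..<j}. phase_field W g (phase_point W h X l)))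
    \<le> scheme_error \<Lambda> B d h \<epsilon> * (1 + of_int (j - i) * h)"
proof -
  let ?z = "phase_point W h X" and ?\<Phi> = "phase_field W g"
  define a b where "a = h * \<Lambda> * (1 + C)" and "b = (2 * \<rho> + h * \<Lambda>) * (1 + h * (1 + C))"
  define c :: "int \<Rightarrow> real" where "c = (\<lambda>l. if int N dvd int p + l then 1 else 0)"
  have a: "a \<ge> 0" and b: "b \<ge> 0" using h_pos \<epsilon>_pos \<Lambda>_nonneg C_nonneg by (auto simp: a_def b_def)
  have count: "(\<Sum>l\<in>{i..<j}. c l) \<le> of_int (j - i) / N + 1"
    unfolding c_def by (rule count_multiples_le[OF N_pos assms])
  have "?z j - ?z i - h *\<^sub>R (\<Sum>l\<in>{i..<j}. ?\<Phi> (?z l)) = (\<Sum>l\<in>{i..<j}. ?z (l + 1) - ?z l - h *\<^sub>R ?\<Phi> (?z l))"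
    using assms
  proof (induction j rule: int_ge_induct)
    case (step j)
    show ?case unfolding sum_int_atLeastLessThan_Suc[OF step(1)] step(2)[symmetric]
      by (simp add: algebra_simps)
  qed simp
  also have "norm \<dots> \<le> (\<Sum>l\<in>{i..<j}. h * a + b * c l)"
    unfolding a_def b_def c_def by (rule sum_norm_le) (rule phase_step)
  also have "\<dots> = of_int (j - i) * h * a + b * (\<Sum>l\<in>{i..<j}. c l)"
    using assms unfolding sum.distrib sum_distrib_left[of b, symmetric] by simp
  also have "\<dots> \<le> of_int (j - i) * h * a + b * (of_int (j - i) * h / d + 1)"
  proof -
    \<comment> \<open>This converts one reflection per \<open>N\<close> steps into at most one per
      time \<open>d\<close>, a rate independent of \<open>h\<close>.\<close>
    have "of_int (j - i) / real N \<le> of_int (j - i) * h / d"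
    proof -
      have "of_int (j - i) * d \<le> of_int (j - i) * (h * N)"
        using d assms by (intro mult_left_mono) auto
      then show ?thesis using d N_pos by (simp add: field_simps)
    qed
    then show ?thesis
      using count b by (intro add_mono order_refl mult_left_mono) auto
  qed
  also have "\<dots> \<le> (a + b * (1 + 1 / d)) * (1 + of_int (j - i) * h)"
  proof -
    define t where "t = of_int (j - i) * h"
    have t: "t \<ge> 0" unfolding t_def using assms h_pos by simp
    have "(1 + 1 / d) * (1 + t) - (t / d + 1) = t + 1 / d"
      using d by (simp add: field_simps)
    moreover have "t + 1 / d \<ge> 0" using t d by simp
    ultimately have "b * (t / d + 1) \<le> b * ((1 + 1 / d) * (1 + t))"
      using b by (intro mult_left_mono) auto
    moreover have "t * a \<le> a * (1 + t)" using a by (simp add: algebra_simps)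
    ultimately show ?thesis unfolding t_def[symmetric] by (simp add: distrib_right mult.assoc)
  qed
  finally show ?thesis unfolding scheme_error_def a_def b_def .
qed

text \<open>On the unreflected window the accumulated action is a part of the path cost with the
  nonnegative \<open>\<epsilon>\<close> terms dropped. Past the window each further traversal adds
  its action again, so the range of \<open>l\<close> matters.\<close>

lemma accumulated_action_bound:
  assumes "- int p \<le> l" "l \<le> int N - int p"
  shows "\<bar>accumulated_action W h X l\<bar> \<le> path_cost W h \<epsilon> x 0 N"
proof -
  have X: "X l = x (nat (int p + l))" if "- int p \<le> l" "l \<le> int N - int p" for l
    unfolding reflected_def using that by (subst fold_index_id[OF N_pos]) auto
  have diff: "accumulated_action W h X j - accumulated_action W h X i \<le> path_cost W h \<epsilon> x 0 N"
    if ij: "- int p \<le> i" "i \<le> j" "j \<le> int N - int p" for i j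
  proof -
    have "accumulated_action W h X j - accumulated_action W h X i
      \<le> (\<Sum>k\<in>{i..<j}. step_cost W h \<epsilon> (x (nat (int p + k))) (x (Suc (nat (int p + k)))))"
      unfolding accumulated_action_diff[OF ij(2)]
    proof (rule sum_mono)
      fix k assume k: "k \<in> {i..<j}"
      then have Xk: "X k = x (nat (int p + k))" "X (k + 1) = x (Suc (nat (int p + k)))"
        using ij by (auto simp: X Suc_nat_eq_nat_zadd1 algebra_simps)
      then have "norm (velocity h X (k + 1)) = norm (x (Suc (nat (int p + k))) - x (nat (int p + k))) / h"
        unfolding velocity_def norm_scaleR using h_pos by simp
      then show "h * (1 / 2 * (norm (velocity h X (k + 1)))\<^sup>2 + W (X k)) \<le>
          step_cost W h \<epsilon> (x (nat (int p + k))) (x (Suc (nat (int p + k))))"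
        unfolding step_cost_def Xk(1) using h_pos \<epsilon>_pos
        by (simp add: power_divide distrib_left) (simp add: power2_eq_square)
    qed
    also have "\<dots> = (\<Sum>k\<in>(\<lambda>k. nat (int p + k)) ` {i..<j}. step_cost W h \<epsilon> (x k) (x (Suc k)))"
      by (subst sum.reindex) (use ij in \<open>auto simp: inj_on_def nat_eq_iff\<close>)
    also have "\<dots> \<le> path_cost W h \<epsilon> x 0 N"
      unfolding path_cost_def by (rule sum_mono2) (use ij step_cost_nonneg in auto)
    finally show ?thesis .
  qed
  have "accumulated_action W h X 0 = 0" unfolding accumulated_action_def by simp
  moreover have mono: "0 \<le> accumulated_action W h X j - accumulated_action W h X i" if "i \<le> j" for i j
    unfolding accumulated_action_diff[OF that] using h_pos W_nonneg by (intro sum_nonneg) auto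
  ultimately show ?thesis
    using diff[of 0 l] diff[of l 0] mono[of 0 l] mono[of l 0] assms p_le by (cases "l \<ge> 0") auto
qed

text \<open>Every position is already attained on the original path, where the action is bounded.
  That \<open>\<bar>l'\<bar>\<close> does not exceed \<open>\<bar>l\<bar>\<close> keeps the
  corresponding times bounded in the limit.\<close>

lemma reflected_folds:
  obtains l' where "X l' = X l" "- int p \<le> l'" "l' \<le> int N - int p" "\<bar>l'\<bar> \<le> \<bar>l\<bar>"
proof (rule that[of "fold_index N (p + l) - p"])
  show "X (fold_index N (p + l) - p) = X l"
    unfolding reflected_def using fold_index_range[of N "p + l"] N_pos by (simp add: fold_index_id)
  show "\<bar>fold_index N (int p + l) - int p\<bar> \<le> \<bar>l\<bar>"
    using fold_index_lipschitz[OF N_pos, of p l] fold_index_id[OF N_pos, of p] p_le by simp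
qed (use fold_index_range[of N "p + l"] N_pos in auto)

end

section \<open>Sobolev functions, gradients and lattice vectors\<close>

lemma L2_loc_continuous:
  fixes f :: "real \<Rightarrow> real ^ 'n"
  assumes "continuous_on UNIV f"
  shows "L2_loc f"
  unfolding L2_loc_def
proof (intro conjI allI)
  show "f \<in> borel_measurable lborel"
    using borel_measurable_continuous_onI[OF assms] by simp
  fix a b :: real
  show "set_integrable lborel {a..b} (\<lambda>t. (norm (f t))\<^sup>2)"
    by (intro borel_integrable_atLeastAtMost' continuous_intros continuous_on_subset[OF assms]) auto
qed

text \<open>Integration by parts on an interval extending beyond the support of
  \<open>\<phi>\<close> by one unit on either side, so that the boundary terms vanish and
  \<open>deriv \<phi>\<close> is zero outside.\<close>

lemma weak_deriv_C1:
  fixes q :: "real \<Rightarrow> real ^ 'n"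
  assumes q: "\<And>t. (q has_vector_derivative q' t) (at t)" and q': "continuous_on UNIV q'"
  shows "weak_deriv q q'"
  unfolding weak_deriv_def
proof (intro allI impI)
  fix \<phi> :: "real \<Rightarrow> real" assume \<phi>: "test_fun \<phi>"
  have "(deriv ^^ 0) \<phi> differentiable_on UNIV" "(deriv ^^ 1) \<phi> differentiable_on UNIV"
    using \<phi> unfolding test_fun_def by blast+
  then have d0: "\<phi> differentiable_on UNIV" and d1: "deriv \<phi> differentiable_on UNIV" by simp_all
  have \<phi>': "(\<phi> has_real_derivative deriv \<phi> t) (at t)" for t
    using d0 unfolding differentiable_on_def
    by (simp add: DERIV_deriv_iff_real_differentiable)
  have cq: "continuous_on UNIV q"
    using q by (meson continuous_at_imp_continuous_on has_vector_derivative_continuous)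
  have c\<phi>: "continuous_on UNIV \<phi>" "continuous_on UNIV (deriv \<phi>)"
    using d0 d1 by (auto intro: differentiable_imp_continuous_on)
  obtain a0 b0 where ab0: "\<And>t. t \<notin> {a0..b0} \<Longrightarrow> \<phi> t = 0"
    using \<phi> unfolding test_fun_def by blast
  define a b where "a = min a0 b0 - 1" and "b = max a0 b0 + 1"
  have ab: "a \<le> b" by (auto simp: a_def b_def)
  have zero: "\<phi> t = 0" if "t \<notin> {a<..<b}" for t
  proof -
    have "t \<notin> {a0..b0}"
      using that by (auto simp: a_def b_def min_def max_def split: if_splits)
    then show ?thesis by (rule ab0)
  qed
  have zero': "deriv \<phi> t = 0" if "t \<notin> {a..b}" for t
  proof -
    have "eventually (\<lambda>s. s \<in> - {a..b}) (nhds t)"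
      using that by (intro eventually_nhds_in_open) auto
    then have "eventually (\<lambda>s. \<phi> s = 0) (nhds t)"
      by eventually_elim (auto intro: zero)
    then have "((\<lambda>_. 0) has_real_derivative deriv \<phi> t) (at t)"
      using \<phi>'[of t] by (subst (asm) DERIV_cong_ev[OF refl _ refl])
    then show ?thesis using DERIV_unique[OF _ DERIV_const] by blast
  qed
  let ?I = "indicat_real {a..b}"
  have i1: "integrable lborel (\<lambda>t. ?I t *\<^sub>R (deriv \<phi> t *\<^sub>R q t))"
    and i2: "integrable lborel (\<lambda>t. ?I t *\<^sub>R (\<phi> t *\<^sub>R q' t))"
    using borel_integrable_atLeastAtMost'[of a b "\<lambda>t. deriv \<phi> t *\<^sub>R q t"]
      borel_integrable_atLeastAtMost'[of a b "\<lambda>t. \<phi> t *\<^sub>R q' t"]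
      continuous_on_subset[OF cq] continuous_on_subset[OF q'] continuous_on_subset[OF c\<phi>(1)] continuous_on_subset[OF c\<phi>(2)]
    unfolding set_integrable_def by (auto intro!: continuous_intros)
  have "((\<lambda>t. \<phi> t *\<^sub>R q t) has_vector_derivative \<phi> t *\<^sub>R q' t + deriv \<phi> t *\<^sub>R q t) (at t within {a..b})" for t
    using has_vector_derivative_scaleR[OF \<phi>' q, of t] has_vector_derivative_at_within by blast
  then have "has_bochner_integral lborel (\<lambda>t. ?I t *\<^sub>R (\<phi> t *\<^sub>R q' t + deriv \<phi> t *\<^sub>R q t)) (\<phi> b *\<^sub>R q b - \<phi> a *\<^sub>R q a)"
    using ab continuous_on_subset[OF cq] continuous_on_subset[OF q'] continuous_on_subset[OF c\<phi>(1)] continuous_on_subset[OF c\<phi>(2)]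
    by (intro has_bochner_integral_FTC_Icc) (auto intro!: continuous_intros)
  then have "(\<integral>t. ?I t *\<^sub>R (\<phi> t *\<^sub>R q' t) + ?I t *\<^sub>R (deriv \<phi> t *\<^sub>R q t) \<partial>lborel) = 0"
    using zero[of a] zero[of b] by (simp add: has_bochner_integral_integral_eq scaleR_add_right)
  then have "(\<integral>t. ?I t *\<^sub>R (\<phi> t *\<^sub>R q' t) \<partial>lborel) + (\<integral>t. ?I t *\<^sub>R (deriv \<phi> t *\<^sub>R q t) \<partial>lborel) = 0"
    using i1 i2 by simp
  moreover have "(\<lambda>t. ?I t *\<^sub>R (\<phi> t *\<^sub>R q' t)) = (\<lambda>t. \<phi> t *\<^sub>R q' t)"
  proof
    show "?I t *\<^sub>R (\<phi> t *\<^sub>R q' t) = \<phi> t *\<^sub>R q' t" for t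
      using zero[of t] by (cases "t \<in> {a..b}") auto
  qed
  moreover have "(\<lambda>t. ?I t *\<^sub>R (deriv \<phi> t *\<^sub>R q t)) = (\<lambda>t. deriv \<phi> t *\<^sub>R q t)"
  proof
    show "?I t *\<^sub>R (deriv \<phi> t *\<^sub>R q t) = deriv \<phi> t *\<^sub>R q t" for t
      using zero'[of t] by (cases "t \<in> {a..b}") auto
  qed
  ultimately show "(\<integral>t. deriv \<phi> t *\<^sub>R q t \<partial>lborel) = - (\<integral>t. \<phi> t *\<^sub>R q' t \<partial>lborel)"
    by (simp add: eq_neg_iff_add_eq_0 add.commute)
qed

lemma W12_loc_C1:
  fixes q :: "real \<Rightarrow> real ^ 'n"
  assumes "\<And>t. (q has_vector_derivative q' t) (at t)" "continuous_on UNIV q'"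
  shows "W12_loc q q'"
proof -
  have "continuous_on UNIV q"
    using assms(1) by (meson continuous_at_imp_continuous_on has_vector_derivative_continuous)
  then show ?thesis
    unfolding W12_loc_def using assms by (auto intro: L2_loc_continuous weak_deriv_C1)
qed

lemma J_antiderivative:
  fixes q :: "real \<Rightarrow> real ^ 'n"
  assumes G: "\<And>t. (G has_vector_derivative 1/2 * (norm (q' t))\<^sup>2 + (V (q t) - c)) (at t)"
    and "continuous_on UNIV q" "continuous_on UNIV q'" "continuous_on UNIV V" "\<sigma> < \<tau>"
  shows "J V c \<sigma> \<tau> q q' = G \<tau> - G \<sigma>"
proof -
  have cont: "continuous_on S (\<lambda>t. 1/2 * (norm (q' t))\<^sup>2 + (V (q t) - c))" for S
    by (intro continuous_intros continuous_on_compose2[OF assms(4)] continuous_on_subset[OF assms(2)]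
        continuous_on_subset[OF assms(3)]) auto
  have "has_bochner_integral lborel (\<lambda>t. indicat_real {\<sigma>..\<tau>} t *\<^sub>R (1/2 * (norm (q' t))\<^sup>2 + (V (q t) - c))) (G \<tau> - G \<sigma>)"
    using assms(5) G by (intro has_bochner_integral_FTC_Icc cont) (auto intro: has_vector_derivative_at_within)
  then have "(LINT t:{\<sigma>..\<tau>}|lborel. 1/2 * (norm (q' t))\<^sup>2 + (V (q t) - c)) = G \<tau> - G \<sigma>"
    unfolding set_lebesgue_integral_def by (rule has_bochner_integral_integral_eq)
  moreover have "J V c \<sigma> \<tau> q q' = (LINT t:{\<sigma>..\<tau>}|lborel. 1/2 * (norm (q' t))\<^sup>2 + (V (q t) - c))"
    unfolding J_def set_lebesgue_integral_def
  proof (rule integral_cong_AE)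
    show "AE t in lborel. indicat_real {\<sigma><..<\<tau>} t *\<^sub>R (1/2 * (norm (q' t))\<^sup>2 + (V (q t) - c)) =
        indicat_real {\<sigma>..\<tau>} t *\<^sub>R (1/2 * (norm (q' t))\<^sup>2 + (V (q t) - c))"
      using AE_lborel_singleton[of \<sigma>] AE_lborel_singleton[of \<tau>]
      by eventually_elim (auto simp: indicator_def)
  qed (use borel_measurable_continuous_onI[OF cont] in \<open>auto intro!: borel_measurable_scaleR\<close>)
  ultimately show ?thesis by simp
qed

text \<open>As \<open>grad\<close> is a definite description, a representing vector must exist and
  be unique. It is the adjoint of the derivative applied to 1.\<close>

lemma grad_works:
  fixes V :: "real ^ 'n \<Rightarrow> real"
  assumes "V differentiable (at x)"
  shows "(V has_derivative (\<lambda>d. grad V x \<bullet> d)) (at x)"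
proof -
  obtain V' where V': "(V has_derivative V') (at x)" using assms unfolding differentiable_def by blast
  have lin: "linear V'" using V' has_derivative_linear by blast
  define D where "D = adjoint V' 1"
  have "V' = (\<lambda>d. D \<bullet> d)"
    using adjoint_works[OF lin, of _ 1] by (simp add: D_def inner_commute fun_eq_iff)
  then have D: "GDERIV V x :> D" using V' by (simp add: gderiv_def inner_commute)
  have "D' = D" if "GDERIV V x :> D'" for D'
  proof -
    have "(\<lambda>d. d \<bullet> D') = (\<lambda>d. d \<bullet> D)"
      using that D has_derivative_unique unfolding gderiv_def by blast
    then have "(D' - D) \<bullet> D' = (D' - D) \<bullet> D" by metis
    then have "(D' - D) \<bullet> (D' - D) = 0" by (simp add: inner_diff_right)
    then show ?thesis by simp
  qed
  then have "grad V x = D" unfolding grad_def using D by blast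
  then show ?thesis using D unfolding gderiv_def by (simp add: inner_commute)
qed

lemma grad_periodic:
  fixes V :: "real ^ 'n \<Rightarrow> real"
  assumes "\<And>x. V (x + \<xi>) = V x"
  shows "grad V (x + \<xi>) = grad V x"
proof -
  have "GDERIV V (x + \<xi>) :> D \<longleftrightarrow> GDERIV V x :> D" for D
  proof
    assume "GDERIV V (x + \<xi>) :> D"
    moreover have "((\<lambda>y. y + \<xi>) has_derivative (\<lambda>h. h)) (at x)"
      by (auto intro!: derivative_eq_intros)
    ultimately have "((\<lambda>y. V (y + \<xi>)) has_derivative (\<lambda>h. h \<bullet> D)) (at x)"
      unfolding gderiv_def by (intro has_derivative_compose[of "\<lambda>y. y + \<xi>" "\<lambda>h. h" x UNIV V])
    then show "GDERIV V x :> D" unfolding gderiv_def by (simp add: assms)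
  next
    assume "GDERIV V x :> D"
    moreover have "((\<lambda>y. y - \<xi>) has_derivative (\<lambda>h. h)) (at (x + \<xi>))"
      by (auto intro!: derivative_eq_intros)
    ultimately have "((\<lambda>y. V (y - \<xi>)) has_derivative (\<lambda>h. h \<bullet> D)) (at (x + \<xi>))"
      unfolding gderiv_def
      using has_derivative_compose[of "\<lambda>y. y - \<xi>" "\<lambda>h. h" "x + \<xi>" UNIV V "\<lambda>h. h \<bullet> D"] by simp
    moreover have "V (y - \<xi>) = V y" for y using assms[of "y - \<xi>"] by simp
    ultimately show "GDERIV V (x + \<xi>) :> D" unfolding gderiv_def by simp
  qed
  then have "gderiv V (x + \<xi>) = gderiv V x" by blast
  then show ?thesis unfolding grad_def by simp
qed

section \<open>Integer vectors and their subgroups\<close>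

lemma int_vecs_closed:
  "0 \<in> int_vecs" "x \<in> int_vecs \<Longrightarrow> y \<in> int_vecs \<Longrightarrow> x + y \<in> int_vecs"
  "x \<in> int_vecs \<Longrightarrow> - x \<in> int_vecs" "x \<in> int_vecs \<Longrightarrow> y \<in> int_vecs \<Longrightarrow> x - y \<in> int_vecs"
  "x \<in> int_vecs \<Longrightarrow> of_int n *\<^sub>R x \<in> int_vecs"
  by (auto simp: int_vecs_def)

lemma norm_int_vec_ge_1:
  assumes "x \<in> int_vecs" "x \<noteq> 0"
  shows "1 \<le> norm x"
proof -
  obtain i where "x $ i \<noteq> 0" using assms(2) by (auto simp: vec_eq_iff)
  moreover have "x $ i \<in> \<int>" using assms(1) by (simp add: int_vecs_def)
  ultimately have "1 \<le> \<bar>x $ i\<bar>" by (rule Ints_nonzero_abs_ge1[rotated])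
  then show ?thesis using component_le_norm_cart[of x i] by linarith
qed

lemma int_vecs_representative:
  fixes x :: "real ^ 'n"
  obtains \<xi> where "\<xi> \<in> int_vecs" "x + \<xi> \<in> cbox 0 1"
proof (rule that[of "\<chi> i. - of_int \<lfloor>x $ i\<rfloor>"])
  show "(\<chi> i. - of_int \<lfloor>x $ i\<rfloor>) \<in> int_vecs" by (simp add: int_vecs_def)
  show "x + (\<chi> i. - of_int \<lfloor>x $ i\<rfloor>) \<in> cbox 0 1"
    by (simp add: mem_box_cart) (smt (verit) of_int_floor_le real_of_int_floor_add_one_ge)
qed

lemma finite_int_vecs_bounded: "finite {x :: real ^ 'n. x \<in> int_vecs \<and> norm x \<le> R}"
proof -
  let ?S = "{x :: real ^ 'n. x \<in> int_vecs \<and> norm x \<le> R}"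
  have "?S \<subseteq> (\<lambda>f. \<chi> i. of_int (f i)) ` (PiE UNIV (\<lambda>_. {- \<lceil>R\<rceil>..\<lceil>R\<rceil>}))"
  proof
    fix x :: "real ^ 'n" assume x: "x \<in> ?S"
    have xi: "of_int \<lfloor>x $ i\<rfloor> = x $ i" for i using x by (simp add: int_vecs_def)
    have "\<lfloor>x $ i\<rfloor> \<in> {- \<lceil>R\<rceil>..\<lceil>R\<rceil>}" for i
      using xi[of i] component_le_norm_cart[of x i] x by simp linarith
    then show "x \<in> (\<lambda>f. \<chi> i. of_int (f i)) ` (PiE UNIV (\<lambda>_. {- \<lceil>R\<rceil>..\<lceil>R\<rceil>}))"
      by (intro image_eqI[of _ _ "\<lambda>i. \<lfloor>x $ i\<rfloor>"]) (auto simp: vec_eq_iff xi)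
  qed
  then show ?thesis by (rule finite_subset) (auto intro!: finite_PiE)
qed

text \<open>The coordinate vectors generate the lattice, so a proper subgroup misses one of them.
  Norm 1 is what keeps the segment from 0 inside the unit ball of \<open>M_p\<close>.\<close>

lemma axis_notin_proper_subgroup:
  fixes L :: "(real ^ 'n) set"
  assumes L: "L \<subseteq> int_vecs" "L \<noteq> int_vecs" "0 \<in> L" "\<And>x y. x \<in> L \<Longrightarrow> y \<in> L \<Longrightarrow> x + y \<in> L"
    "\<And>n x. x \<in> L \<Longrightarrow> of_int n *\<^sub>R x \<in> L"
  obtains e where "e \<in> int_vecs - L" "norm e = 1"
proof -
  have "\<exists>i. axis i 1 \<notin> L"
  proof (rule ccontr)
    assume "\<not> (\<exists>i. axis i 1 \<notin> L)"
    then have ax: "axis i 1 \<in> L" for i by blast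
    have sum_in: "(\<Sum>i\<in>S. of_int (n i) *\<^sub>R axis i 1) \<in> L" for S and n :: "'n \<Rightarrow> int"
      by (induction S rule: infinite_finite_induct) (auto intro: L(3-5) ax)
    have "x \<in> L" if x: "x \<in> int_vecs" for x
    proof -
      have "of_int \<lfloor>x $ i\<rfloor> = x $ i" for i using x by (simp add: int_vecs_def)
      then have "x = (\<Sum>i\<in>UNIV. of_int \<lfloor>x $ i\<rfloor> *\<^sub>R axis i 1)"
        using basis_expansion[of x] by (simp only: scalar_mult_eq_scaleR)
      also have "\<dots> \<in> L"
        by (rule sum_in)
      finally show ?thesis .
    qed
    then show False using L by blast
  qed
  then obtain i where "axis i 1 \<notin> L" by blast
  moreover have "axis i 1 \<in> int_vecs" by (simp add: int_vecs_def axis_def)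
  ultimately show thesis using that[of "axis i 1"] by (simp add: norm_axis_1)
qed

section \<open>Discrete connections between wells\<close>

text \<open>The constant \<open>w\<^sub>0\<close> is the height of the potential barrier on the
  sphere of radius 1/3 that separates the central well from the others. \<open>\<Lambda>\<close> and
  \<open>B\<close> are global because \<open>V\<close> is periodic.\<close>

locale lattice_wells =
  fixes V :: "real ^ 'n \<Rightarrow> real" and c \<Lambda> B w\<^sub>0 :: real and L :: "(real ^ 'n) set"
  assumes V_deriv: "\<And>x. (V has_derivative (\<lambda>d. grad V x \<bullet> d)) (at x)"
    and grad_cont: "continuous_on UNIV (grad V)"
    and V_periodic: "\<And>x \<xi>. \<xi> \<in> int_vecs \<Longrightarrow> V (x + \<xi>) = V x"
    and V_nonneg: "\<And>x. V x \<ge> 0" and V_zero: "\<And>x. x \<in> int_vecs \<Longrightarrow> V x = 0"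
    and c_nonneg: "c \<ge> 0"
    and covered: "\<And>x. V x \<le> c \<Longrightarrow> \<exists>\<xi>\<in>int_vecs. norm (x - \<xi>) < 1/3"
    and \<Lambda>: "\<Lambda> \<ge> 1" "\<And>x. norm (grad V x) \<le> \<Lambda>" and B: "\<And>x. V x \<le> B"
    and w\<^sub>0: "w\<^sub>0 > 0" "\<And>y. norm y = 1/3 \<Longrightarrow> c + w\<^sub>0 \<le> V y"
    and L: "L \<subseteq> int_vecs" "0 \<in> L" "\<And>x y. x \<in> L \<Longrightarrow> y \<in> L \<Longrightarrow> x + y \<in> L"
      "\<And>n x. x \<in> L \<Longrightarrow> of_int n *\<^sub>R x \<in> L"
begin

definition W :: "real ^ 'n \<Rightarrow> real" where "W x = max (V x - c) 0"

definition wells :: "(real ^ 'n) set \<Rightarrow> (real ^ 'n) set" where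
  "wells M = (\<Union>\<xi>\<in>M. sublevel_at V c \<xi>)"

lemma V_cont: "continuous_on UNIV V"
  using V_deriv has_derivative_continuous continuous_at_imp_continuous_on by blast

lemma V_lipschitz: "\<bar>V x - V y\<bar> \<le> \<Lambda> * norm (x - y)"
proof -
  have "norm (V x - V y) \<le> \<Lambda> * norm (x - y)"
  proof (rule differentiable_bound[of UNIV V "\<lambda>x d. grad V x \<bullet> d"])
    show "onorm (\<lambda>d. grad V z \<bullet> d) \<le> \<Lambda>" for z
    proof (rule onorm_bound)
      show "norm (grad V z \<bullet> d) \<le> \<Lambda> * norm d" for d
        using Cauchy_Schwarz_ineq2[of "grad V z" d] mult_right_mono[OF \<Lambda>(2)[of z], of "norm d"] by simp
    qed (use \<Lambda> in simp)
  qed (use V_deriv in \<open>auto intro: has_derivative_at_withinI\<close>)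
  then show ?thesis by simp
qed

lemma W_simps: "W x = 0 \<longleftrightarrow> V x \<le> c" "W x \<ge> 0" "W x \<le> V x" "W x \<le> B" "V x > c \<Longrightarrow> W x = V x - c"
  using V_nonneg[of x] c_nonneg B[of x] by (auto simp: W_def)

lemma W_lipschitz: "\<bar>W x - W y\<bar> \<le> \<Lambda> * norm (x - y)"
  using V_lipschitz[of x y] unfolding W_def by (auto simp: max_def abs_le_iff)

lemma W_cont: "continuous_on UNIV W"
  unfolding W_def by (intro continuous_intros V_cont)

lemma W_periodic: "\<xi> \<in> int_vecs \<Longrightarrow> W (x + \<xi>) = W x"
  unfolding W_def by (simp add: V_periodic)

lemma W_deriv:
  assumes "V x > c"
  shows "(W has_derivative (\<lambda>d. grad V x \<bullet> d)) (at x)"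
proof (rule has_derivative_transform_within_open)
  show "((\<lambda>x. V x - c) has_derivative (\<lambda>d. grad V x \<bullet> d)) (at x)"
    using has_derivative_diff[OF V_deriv has_derivative_const] by simp
  show "open {x. V x > c}"
    by (rule open_Collect_less) (auto intro: V_cont)
qed (use assms W_simps(5) in auto)

lemma int_balls_disjoint:
  assumes "\<xi> \<in> int_vecs" "\<eta> \<in> int_vecs" "norm (x - \<xi>) \<le> 1/3" "norm (x - \<eta>) < 1/3"
  shows "\<xi> = \<eta>"
proof (rule ccontr)
  assume "\<xi> \<noteq> \<eta>"
  then have "1 \<le> norm (\<xi> - \<eta>)" using norm_int_vec_ge_1[of "\<xi> - \<eta>"] int_vecs_closed(4)[OF assms(1,2)] by auto
  also have "norm (\<xi> - \<eta>) \<le> norm (x - \<xi>) + norm (x - \<eta>)"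
    using norm_triangle_ineq4[of "x - \<eta>" "x - \<xi>"] by simp
  finally show False using assms by linarith
qed

lemma sublevel_at_iff: "x \<in> sublevel_at V c \<xi> \<longleftrightarrow> V x \<le> c \<and> norm (x - \<xi>) < 1/3"
  by (auto simp: sublevel_at_def sublevel_def dist_norm norm_minus_commute)

lemma sublevel_at_translate:
  assumes "\<eta> \<in> int_vecs"
  shows "x + \<eta> \<in> sublevel_at V c (\<xi> + \<eta>) \<longleftrightarrow> x \<in> sublevel_at V c \<xi>"
  unfolding sublevel_at_iff using V_periodic[OF assms] by simp

lemma wells_int_vecs: "V x \<le> c \<longleftrightarrow> x \<in> wells int_vecs"
  unfolding wells_def using covered by (auto simp: sublevel_at_iff)

text \<open>\<open>M\<close> may be infinite. Instead of local finiteness, the union is rewritten as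
  the closed sublevel set minus the open balls around the remaining lattice points.\<close>

lemma closed_wells:
  assumes "M \<subseteq> int_vecs"
  shows "closed (wells M)"
proof -
  have "wells M = {x. V x \<le> c} \<inter> - (\<Union>\<xi>\<in>int_vecs - M. ball \<xi> (1/3))"
  proof (intro set_eqI iffI)
    fix x assume "x \<in> wells M"
    then obtain \<xi> where \<xi>: "\<xi> \<in> M" "V x \<le> c" "norm (x - \<xi>) < 1/3"
      unfolding wells_def by (auto simp: sublevel_at_iff)
    have "norm (x - \<eta>) \<ge> 1/3" if "\<eta> \<in> int_vecs - M" for \<eta>
      using int_balls_disjoint[of \<xi> \<eta> x] \<xi> that assms by fastforce
    then show "x \<in> {x. V x \<le> c} \<inter> - (\<Union>\<xi>\<in>int_vecs - M. ball \<xi> (1/3))"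
      using \<xi> by (force simp: dist_norm norm_minus_commute)
  next
    fix x assume x: "x \<in> {x. V x \<le> c} \<inter> - (\<Union>\<xi>\<in>int_vecs - M. ball \<xi> (1/3))"
    then obtain \<xi> where \<xi>: "\<xi> \<in> int_vecs" "norm (x - \<xi>) < 1/3" using covered by auto
    then have "\<xi> \<in> M" using x by (auto simp: dist_norm norm_minus_commute)
    then show "x \<in> wells M" unfolding wells_def using \<xi> x by (auto simp: sublevel_at_iff)
  qed
  moreover have "closed {x. V x \<le> c}"
    by (rule closed_Collect_le) (auto intro: V_cont)
  ultimately show ?thesis by auto
qed

lemma wells_singleton: "sublevel_at V c \<xi> = wells {\<xi>}"
  unfolding wells_def by simp

lemma compact_central_well: "compact (sublevel_at V c 0)"
proof -
  have "closed (sublevel_at V c 0)"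
    unfolding wells_singleton by (rule closed_wells) (simp add: int_vecs_closed(1))
  moreover have "bounded (sublevel_at V c 0)"
    unfolding sublevel_at_def by (auto intro: bounded_subset[OF bounded_ball])
  ultimately show ?thesis by (simp add: compact_eq_bounded_closed)
qed

lemma lattice_point_in_well: "\<xi> \<in> int_vecs \<Longrightarrow> \<xi> \<in> sublevel_at V c \<xi>"
  using V_zero[of \<xi>] c_nonneg by (simp add: sublevel_at_iff)

text \<open>On the part of the unit cell at distance at least \<open>\<rho>\<close> from the
  sublevel set, \<open>W\<close> has a positive minimum by compactness; periodicity spreads the
  threshold to the whole space.\<close>

lemma near_sublevel:
  assumes "\<rho> > 0"
  obtains \<delta> where "\<delta> > 0" "\<And>x. W x < \<delta> \<Longrightarrow> \<exists>y. V y \<le> c \<and> norm (x - y) < \<rho>"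
proof -
  define K where "K = cbox 0 1 \<inter> (\<Inter>y\<in>{y. V y \<le> c}. {x. \<rho> \<le> dist x y})"
  have "compact K"
    unfolding K_def by (intro compact_Int_closed compact_cbox closed_INT ballI closed_Collect_le continuous_intros)
  have pos: "W x > 0" if "x \<in> K" for x
  proof -
    have "\<not> V x \<le> c" using that assms unfolding K_def by force
    then show ?thesis using W_simps(5)[of x] by simp
  qed
  obtain \<delta> where \<delta>: "\<delta> > 0" "\<And>x. x \<in> K \<Longrightarrow> \<delta> \<le> W x"
  proof (cases "K = {}")
    case True
    then show ?thesis using that[of 1] by simp
  next
    case False
    then obtain x where "x \<in> K" "\<And>y. y \<in> K \<Longrightarrow> W x \<le> W y"
      using continuous_attains_inf[OF \<open>compact K\<close> False continuous_on_subset[OF W_cont]] by auto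
    then show ?thesis using that[of "W x"] pos by auto
  qed
  show thesis
  proof (rule that[OF \<delta>(1)])
    fix x assume x: "W x < \<delta>"
    obtain \<xi> where \<xi>: "\<xi> \<in> int_vecs" "x + \<xi> \<in> cbox 0 1" by (rule int_vecs_representative)
    have "x + \<xi> \<notin> K" using \<delta>(2)[of "x + \<xi>"] x W_periodic[OF \<xi>(1), of x] by auto
    then obtain y where y: "V y \<le> c" "norm (x + \<xi> - y) < \<rho>"
      using \<xi> unfolding K_def by (auto simp: dist_norm not_le)
    have "V (y - \<xi>) \<le> c" using y V_periodic[OF \<xi>(1), of "y - \<xi>"] by simp
    moreover have "norm (x - (y - \<xi>)) < \<rho>" using y by (simp add: algebra_simps)
    ultimately show "\<exists>y. V y \<le> c \<and> norm (x - y) < \<rho>" by blast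
  qed
qed

abbreviation "C \<equiv> speed_bound B"

lemma B_nonneg: "B \<ge> 0" using V_nonneg[of 0] B[of 0] by linarith

lemma C_pos: "C > 0" unfolding speed_bound_def using B_nonneg by simp

text \<open>At speed \<open>C\<close> the value of \<open>W\<close> changes by at most
  \<open>w\<^sub>0 / 8\<close> within time \<open>d\<^sub>0\<close>. The action
  \<open>\<delta>\<^sub>0\<close> is that of time \<open>d\<^sub>0\<close> spent where
  \<open>W\<close> is at least \<open>w\<^sub>0 / 4\<close>; every connection pays it before leaving
  the starting ball.\<close>

definition "d\<^sub>0 = w\<^sub>0 / (8 * \<Lambda> * C)"
definition "\<delta>\<^sub>0 = w\<^sub>0 / 4 * d\<^sub>0"

lemma d0_pos: "d\<^sub>0 > 0" "\<delta>\<^sub>0 > 0" "\<Lambda> * C * d\<^sub>0 = w\<^sub>0 / 8"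
  unfolding \<delta>\<^sub>0_def d\<^sub>0_def using w\<^sub>0 \<Lambda> C_pos by auto

lemma L_neg: "\<xi> \<in> L \<Longrightarrow> - \<xi> \<in> L"
  using L(4)[of \<xi> "-1"] by simp

lemma wells_complement_norm:
  assumes "x \<in> wells (int_vecs - L)"
  shows "norm x > 1/3"
proof -
  obtain \<xi> where \<xi>: "\<xi> \<in> int_vecs - L" "norm (x - \<xi>) < 1/3"
    using assms unfolding wells_def by (auto simp: sublevel_at_iff)
  show ?thesis
    using int_balls_disjoint[of 0 \<xi> x] \<xi> L(2) int_vecs_closed(1) by fastforce
qed

text \<open>Minimisation runs over starts in the central well only, which is compact; translation by
  vectors of \<open>L\<close> preserves costs and the target set, so the minimum also holds against
  all starts in \<open>wells L\<close>. The condition \<open>h * real k = 1\<close> makes the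
  straight competitor last exactly unit time.\<close>

lemma minimal_connection:
  assumes h: "h > 0" "h * real k = 1" and \<epsilon>: "\<epsilon> > 0" and e: "e \<in> int_vecs - L" "norm e = 1"
  obtains x N where "x 0 \<in> sublevel_at V c 0" "x N \<in> wells (int_vecs - L)"
    "path_cost W h \<epsilon> x 0 N \<le> M_p V + \<epsilon>"
    "\<And>u w a. u \<in> wells L \<Longrightarrow> w \<in> wells (int_vecs - L) \<Longrightarrow> a \<in> path_costs W h \<epsilon> u w \<Longrightarrow> path_cost W h \<epsilon> x 0 N \<le> a"
proof -
  have k: "k > 0" using h by (cases "k = 0") auto
  have start: "0 \<in> sublevel_at V c 0" by (rule lattice_point_in_well[OF int_vecs_closed(1)])
  have stop: "e \<in> wells (int_vecs - L)"
    unfolding wells_def using e lattice_point_in_well by blast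
  have ne: "sublevel_at V c 0 \<noteq> {}" "wells (int_vecs - L) \<noteq> {}" "int_vecs - L \<subseteq> int_vecs"
    using start stop by auto
  obtain x N where x: "x 0 \<in> sublevel_at V c 0" "x N \<in> wells (int_vecs - L)"
    and min: "\<And>u w a. u \<in> sublevel_at V c 0 \<Longrightarrow> w \<in> wells (int_vecs - L) \<Longrightarrow> a \<in> path_costs W h \<epsilon> u w \<Longrightarrow> path_cost W h \<epsilon> x 0 N \<le> a"
    using minimal_path_exists[OF compact_central_well ne(1) closed_wells[OF ne(3)] ne(2) W_cont W_simps(2) h(1) \<epsilon>] by blast
  show thesis
  proof (rule that[OF x])
    have "path_cost W h \<epsilon> x 0 N \<le> (norm (e - 0))\<^sup>2 / (2 * h * k) + h * (\<Sum>i<k. W (0 + (real i / k) *\<^sub>R (e - 0)) + \<epsilon>)"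
      by (rule min[OF start stop line_in_path_costs[OF k h(1)]])
    also have "\<dots> \<le> 1 / 2 + h * (\<Sum>i<k. (SUP x\<in>cball 0 1. V x) + \<epsilon>)"
    proof (intro add_mono mult_left_mono sum_mono order_refl)
      show "(norm (e - 0))\<^sup>2 / (2 * h * k) \<le> 1 / 2" using e h k by (simp add: mult.assoc)
      fix i assume i: "i \<in> {..<k}"
      have "bdd_above (V ` cball 0 1)" using B by (intro bdd_aboveI[of _ B]) auto
      moreover have "(real i / k) *\<^sub>R e \<in> cball 0 1" using i k e by simp
      ultimately have "V ((real i / k) *\<^sub>R e) \<le> (SUP x\<in>cball 0 1. V x)"
        by (rule cSUP_upper[rotated])
      then show "W (0 + (real i / k) *\<^sub>R (e - 0)) \<le> (SUP x\<in>cball 0 1. V x)"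
        using W_simps(3)[of "(real i / k) *\<^sub>R e"] by simp
    qed (use h in simp)
    also have "\<dots> = M_p V + \<epsilon>"
    proof -
      have "h * (\<Sum>i<k. (SUP x\<in>cball 0 1. V x) + \<epsilon>) = (h * real k) * ((SUP x\<in>cball 0 1. V x) + \<epsilon>)"
        by simp
      then show ?thesis unfolding M_p_def h(2) by simp
    qed
    finally show "path_cost W h \<epsilon> x 0 N \<le> M_p V + \<epsilon>" .
  next
    fix u w a assume u: "u \<in> wells L" and w: "w \<in> wells (int_vecs - L)" and a: "a \<in> path_costs W h \<epsilon> u w"
    obtain \<xi> where \<xi>: "\<xi> \<in> L" "u \<in> sublevel_at V c \<xi>" using u unfolding wells_def by blast
    obtain \<eta> where \<eta>: "\<eta> \<in> int_vecs" "\<eta> \<notin> L" "w \<in> sublevel_at V c \<eta>" using w unfolding wells_def by blast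
    have \<xi>': "- \<xi> \<in> int_vecs" "- \<xi> \<in> L" using \<xi> L L_neg by auto
    have "u + - \<xi> \<in> sublevel_at V c 0" using sublevel_at_translate[OF \<xi>'(1), of u \<xi>] \<xi> by simp
    moreover have "w + - \<xi> \<in> wells (int_vecs - L)"
    proof -
      have "\<eta> + - \<xi> \<notin> L" using L(3)[of "\<eta> + - \<xi>" \<xi>] \<xi> \<eta> by auto
      then show ?thesis
        unfolding wells_def using sublevel_at_translate[OF \<xi>'(1), of w \<eta>] \<eta> int_vecs_closed(2)[OF \<eta>(1) \<xi>'(1)] by blast
    qed
    moreover have "a \<in> path_costs W h \<epsilon> (u + - \<xi>) (w + - \<xi>)"
      by (rule path_costs_translate[OF _ a]) (rule W_periodic[OF \<xi>'(1)])
    ultimately show "path_cost W h \<epsilon> x 0 N \<le> a" by (rule min)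
  qed
qed

text \<open>The index \<open>p\<close> marks the first exit from the ball around the starting well; it serves as the
  time origin when passing to the limit.\<close>

definition discrete_connection :: "real \<Rightarrow> real \<Rightarrow> (nat \<Rightarrow> real ^ 'n) \<Rightarrow> nat \<Rightarrow> nat \<Rightarrow> bool" where
  "discrete_connection h \<epsilon> x N p \<longleftrightarrow>
     reflected_geodesic W \<Lambda> B h \<epsilon> x N (grad V) p d\<^sub>0 \<and>
     x 0 \<in> sublevel_at V c 0 \<and> x N \<in> wells (int_vecs - L) \<and> path_cost W h \<epsilon> x 0 N \<le> M_p V + \<epsilon> \<and>
     (\<forall>i<p. norm (x i) < 1/3) \<and> 1/3 \<le> norm (x p) \<and> norm (x p) \<le> 1/3 + C * h \<and>
     d\<^sub>0 \<le> h * real p \<and> d\<^sub>0 \<le> h * real (N - p) \<and>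
     (\<forall>i y \<rho>. p \<le> i \<and> i \<le> N \<and> y \<in> wells L \<and> norm (x i - y) \<le> \<rho> \<and> \<rho> > 0 \<longrightarrow>
        \<delta>\<^sub>0 \<le> (\<rho> + h) * (1 / 2 + \<Lambda> * \<rho> + \<epsilon>))"

text \<open>Replacing a segment of a minimal connection gives another connection, so all segments
  are minimal. The remaining clauses measure how much time and action the barrier
  \<open>w\<^sub>0\<close> forces on the path.\<close>

lemma discrete_connection_exists:
  assumes h: "h > 0" "h \<le> d\<^sub>0" "h * real k = 1" and \<epsilon>: "\<epsilon> > 0" "\<epsilon> \<le> 1" and e: "e \<in> int_vecs - L" "norm e = 1"
  obtains x N p where "discrete_connection h \<epsilon> x N p"
proof -
  obtain x N where x: "x 0 \<in> sublevel_at V c 0" "x N \<in> wells (int_vecs - L)"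
    and cost: "path_cost W h \<epsilon> x 0 N \<le> M_p V + \<epsilon>"
    and min: "\<And>u w a. u \<in> wells L \<Longrightarrow> w \<in> wells (int_vecs - L) \<Longrightarrow> a \<in> path_costs W h \<epsilon> u w \<Longrightarrow> path_cost W h \<epsilon> x 0 N \<le> a"
    using minimal_connection[OF h(1,3) \<epsilon>(1) e] by blast
  have x0: "x 0 \<in> wells L" unfolding wells_def using x L by blast
  have W0: "W (x 0) = 0" "W (x N) = 0"
    using x unfolding wells_def by (auto simp: W_simps sublevel_at_iff)
  interpret gp: geodesic_path W \<Lambda> B h \<epsilon> x N
  proof
    show "path_cost W h \<epsilon> x i j \<le> a" if ij: "i \<le> j" "j \<le> N" and a: "a \<in> path_costs W h \<epsilon> (x i) (x j)" for i j a
    proof -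
      have "path_cost W h \<epsilon> x 0 i + a + path_cost W h \<epsilon> x j N \<in> path_costs W h \<epsilon> (x 0) (x N)"
        using path_costs_trans[OF path_costs_trans[OF
            segment_in_path_costs[of 0 i W h \<epsilon> x] a] segment_in_path_costs[of j N W h \<epsilon> x]] ij by simp
      from min[OF x0 x(2) this] show ?thesis
        using path_cost_split[of 0 i j W h \<epsilon> x] path_cost_split[of 0 j N W h \<epsilon> x] ij by simp
    qed
  qed (use W_simps W_lipschitz \<Lambda> h \<epsilon> in auto)
  have seg_pos: "path_cost W h \<epsilon> x i j > 0" if "i < j" for i j
    unfolding path_cost_def
  proof (rule sum_pos)
    show "step_cost W h \<epsilon> (x k) (x (Suc k)) > 0" for k
      unfolding step_cost_def using W_simps(2)[of "x k"] h \<epsilon> by (intro add_nonneg_pos) auto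
  qed (use that in auto)
  \<comment> \<open>An inner node in the sublevel set would split the path into two pieces of
    positive cost, one of which is already a connection between the two families of wells.\<close>
  have inner: "V (x i) > c" if i: "0 < i" "i < N" for i
  proof (rule ccontr)
    assume "\<not> V (x i) > c"
    then have "x i \<in> wells int_vecs" using wells_int_vecs[of "x i"] by simp
    then consider "x i \<in> wells L" | "x i \<in> wells (int_vecs - L)" unfolding wells_def by blast
    then show False
    proof cases
      case 1
      have "path_cost W h \<epsilon> x 0 N \<le> path_cost W h \<epsilon> x i N"
        by (rule min[OF 1 x(2) segment_in_path_costs]) (use i in simp)
      then show False using path_cost_split[of 0 i N W h \<epsilon> x] seg_pos[of 0 i] i by simp
    next
      case 2
      have "path_cost W h \<epsilon> x 0 N \<le> path_cost W h \<epsilon> x 0 i"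
        by (rule min[OF x0 2 segment_in_path_costs]) simp
      then show False using path_cost_split[of 0 i N W h \<epsilon> x] seg_pos[of i N] i by simp
    qed
  qed
  have xN: "norm (x N) > 1/3" by (rule wells_complement_norm[OF x(2)])
  define p where "p = (LEAST i. 1/3 \<le> norm (x i))"
  have p: "1/3 \<le> norm (x p)" unfolding p_def by (rule LeastI[of _ N]) (use xN in simp)
  have pN: "p \<le> N" unfolding p_def by (rule Least_le) (use xN in simp)
  have before: "norm (x i) < 1/3" if "i < p" for i
    using not_less_Least[of i "\<lambda>i. 1/3 \<le> norm (x i)"] that unfolding p_def by simp
  have p0: "p > 0" using p x(1) by (cases p) (auto simp: sublevel_at_iff)
  have xp: "norm (x p) \<le> 1/3 + C * h"
  proof -
    have "p - 1 < N" "Suc (p - 1) = p" using p0 pN by auto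
    then show ?thesis
      using gp.step_le[of "p - 1"] before[of "p - 1"] norm_triangle_sub[of "x p" "x (p - 1)"] p0 by simp
  qed
  \<comment> \<open>Compare \<open>x p\<close> with its radial projection \<open>y\<close> onto the
    sphere of radius 1/3: they differ by at most \<open>C * h\<close>, hence by at most
    \<open>C * d\<^sub>0\<close>.\<close>
  have Wp: "W (x p) \<ge> w\<^sub>0 - w\<^sub>0 / 8"
  proof -
    define y where "y = (1 / (3 * norm (x p))) *\<^sub>R x p"
    have "x p \<noteq> 0" using p by auto
    then have "norm y = 1/3" unfolding y_def by simp
    then have "W y \<ge> w\<^sub>0" using w\<^sub>0(2)[of y] by (simp add: W_def)
    have "x p - y = (1 - 1 / (3 * norm (x p))) *\<^sub>R x p" unfolding y_def by (simp add: scaleR_diff_left)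
    then have "norm (x p - y) = \<bar>1 - 1 / (3 * norm (x p))\<bar> * norm (x p)" by simp
    also have "\<dots> = norm (x p) - 1/3"
    proof -
      have n: "norm (x p) > 0" using p by linarith
      then have "1 / (3 * norm (x p)) \<le> 1" using p by (subst divide_le_eq_1_pos) auto
      then have "\<bar>1 - 1 / (3 * norm (x p))\<bar> = 1 - 1 / (3 * norm (x p))" by simp
      then show ?thesis using n by (simp add: left_diff_distrib)
    qed
    also have "\<dots> \<le> C * d\<^sub>0" using xp mult_left_mono[OF h(2), of C] C_pos by linarith
    finally have "\<Lambda> * norm (x p - y) \<le> \<Lambda> * (C * d\<^sub>0)" by (rule mult_left_mono) (use \<Lambda> in simp)
    moreover have "\<Lambda> * (C * d\<^sub>0) = w\<^sub>0 / 8" using d0_pos(3) by (simp add: mult.assoc)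
    ultimately show ?thesis using W_lipschitz[of "x p" y] \<open>W y \<ge> w\<^sub>0\<close> by linarith
  qed
  have W_steps: "\<bar>W (x j) - W (x i)\<bar> \<le> \<Lambda> * C * (h * real (j - i))" if "i \<le> j" "j \<le> N" for i j
  proof -
    have "\<Lambda> * norm (x j - x i) \<le> \<Lambda> * (C * h * real (j - i))"
      by (rule mult_left_mono[OF gp.steps_le[OF that]]) (use \<Lambda> in simp)
    then show ?thesis using W_lipschitz[of "x j" "x i"] by (simp add: mult.assoc)
  qed
  have \<Lambda>C: "\<Lambda> * C > 0" using \<Lambda> C_pos by simp
  \<comment> \<open>\<open>W\<close> has to change between 0 and 7/8 of \<open>w\<^sub>0\<close> at
    rate at most \<open>\<Lambda> * C\<close>, while \<open>d\<^sub>0\<close> accounts for one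
    eighth: hence the factor 7.\<close>
  have long: "7 * d\<^sub>0 \<le> t" if "w\<^sub>0 - w\<^sub>0 / 8 \<le> \<Lambda> * C * t" for t
  proof -
    have "\<Lambda> * C * (7 * d\<^sub>0) \<le> \<Lambda> * C * t" using that d0_pos(3) by linarith
    then show ?thesis by (rule mult_left_le_imp_le[OF _ \<Lambda>C])
  qed
  have hp: "7 * d\<^sub>0 \<le> h * real p" 
  proof (rule long)
    have "\<bar>W (x p) - W (x 0)\<bar> \<le> \<Lambda> * C * (h * real p)" using W_steps[of 0 p] pN by simp
    then show "w\<^sub>0 - w\<^sub>0 / 8 \<le> \<Lambda> * C * (h * real p)" using W0 Wp by linarith
  qed
  have hNp: "7 * d\<^sub>0 \<le> h * real (N - p)" 
  proof (rule long)
    show "w\<^sub>0 - w\<^sub>0 / 8 \<le> \<Lambda> * C * (h * real (N - p))" using W_steps[of p N] pN W0 Wp by linarith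
  qed
  \<comment> \<open>The last \<open>m\<close> steps before \<open>p\<close> take a time between
    \<open>d\<^sub>0\<close> and \<open>2 * d\<^sub>0\<close>; during it \<open>W\<close> drops by
    at most two eighths of \<open>w\<^sub>0\<close> and so stays above
    \<open>w\<^sub>0 / 4\<close>.\<close>
  have cost_p: "\<delta>\<^sub>0 \<le> path_cost W h \<epsilon> x 0 p"
  proof -
    define m where "m = nat \<lfloor>2 * d\<^sub>0 / h\<rfloor>"
    have m: "real m \<le> 2 * d\<^sub>0 / h" "2 * d\<^sub>0 / h \<le> real m + 1"
    proof -
      have "real m = of_int \<lfloor>2 * d\<^sub>0 / h\<rfloor>" unfolding m_def using d0_pos h by simp
      then show "real m \<le> 2 * d\<^sub>0 / h" "2 * d\<^sub>0 / h \<le> real m + 1" by linarith+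
    qed
    then have hm: "h * m \<le> 2 * d\<^sub>0" "2 * d\<^sub>0 \<le> h * m + h" using h by (auto simp: field_simps)
    have "h * m \<le> h * p" using hm hp d0_pos by linarith
    then have mp: "m \<le> p" using mult_left_le_imp_le[OF _ h(1), of m p] by simp
    have "real m * (h * (w\<^sub>0 / 4)) \<le> path_cost W h \<epsilon> x (p - m) p"
    proof -
      have "(\<Sum>i\<in>{p - m..<p}. h * (w\<^sub>0 / 4)) \<le> path_cost W h \<epsilon> x (p - m) p"
        unfolding path_cost_def
      proof (rule sum_mono)
        fix i assume i: "i \<in> {p - m..<p}"
        have "h * real (p - i) \<le> h * m" using i h by (intro mult_left_mono) auto
        then have "\<Lambda> * C * (h * real (p - i)) \<le> \<Lambda> * C * (2 * d\<^sub>0)"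
          using hm \<Lambda>C by (intro mult_left_mono) auto
        moreover have "\<bar>W (x p) - W (x i)\<bar> \<le> \<Lambda> * C * (h * real (p - i))" using W_steps[of i p] i pN by simp
        ultimately have "W (x i) \<ge> w\<^sub>0 / 4" using Wp d0_pos(3) w\<^sub>0 by linarith
        then have "h * (w\<^sub>0 / 4) \<le> h * (W (x i) + \<epsilon>)" using h \<epsilon> by (intro mult_left_mono) auto
        then show "h * (w\<^sub>0 / 4) \<le> step_cost W h \<epsilon> (x i) (x (Suc i))"
          unfolding step_cost_def using h by (intro add_increasing) auto
      qed
      then show ?thesis using mp by simp
    qed
    moreover have "real m * (h * (w\<^sub>0 / 4)) \<ge> d\<^sub>0 * (w\<^sub>0 / 4)"
    proof -
      have "d\<^sub>0 \<le> h * m" using hm h by linarith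
      from mult_right_mono[OF this, of "w\<^sub>0 / 4"] show ?thesis using w\<^sub>0 by (simp add: mult_ac)
    qed
    moreover have "path_cost W h \<epsilon> x 0 (p - m) \<ge> 0" by (rule gp.path_cost_nonneg)
    ultimately show ?thesis
      using path_cost_split[of 0 "p - m" p W h \<epsilon> x] unfolding \<delta>\<^sub>0_def by (simp add: mult.commute)
  qed
  \<comment> \<open>Starting instead at \<open>y\<close>, one reaches \<open>x i\<close> cheaply and
    saves the whole initial part of cost at least \<open>\<delta>\<^sub>0\<close>. Minimality
    forbids a profit.\<close>
  have excl: "\<delta>\<^sub>0 \<le> (\<rho> + h) * (1 / 2 + \<Lambda> * \<rho> + \<epsilon>)"
    if i: "p \<le> i" "i \<le> N" and y: "y \<in> wells L" "norm (x i - y) \<le> \<rho>" "\<rho> > 0" for i y \<rho>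
  proof -
    have Wy: "W y = 0" using y unfolding wells_def by (auto simp: W_simps sublevel_at_iff)
    obtain a where a: "a \<in> path_costs W h \<epsilon> y (x i)" "a \<le> (\<rho> + h) * (1 / 2 + \<Lambda> * \<rho> + \<epsilon>)"
      by (rule cheap_access_path[OF W_lipschitz _ h(1) \<epsilon>(1) Wy y(2,3)]) (use \<Lambda> in auto)
    have "path_cost W h \<epsilon> x 0 N \<le> a + path_cost W h \<epsilon> x i N"
      by (rule min[OF y(1) x(2) path_costs_trans[OF a(1) segment_in_path_costs[OF i(2), of W h \<epsilon> x]]])
    then show ?thesis
      using a(2) cost_p path_cost_split[of 0 i N W h \<epsilon> x] path_cost_split[of 0 p i W h \<epsilon> x]
        gp.path_cost_nonneg[of x p i] i by simp
  qed
  have "reflected_geodesic W \<Lambda> B h \<epsilon> x N (grad V) p d\<^sub>0"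
  proof
    show "N > 0" using p0 pN by simp
    show "(W has_derivative (\<lambda>d. grad V (x i) \<bullet> d)) (at (x i))" if "0 < i" "i < N" for i
      by (rule W_deriv[OF inner[OF that]])
    have "h * real p \<le> h * N" using pN h by simp
    then show "d\<^sub>0 \<le> h * N" using hp d0_pos by linarith
  qed (use W0 pN \<Lambda> d0_pos in auto)
  then have "discrete_connection h \<epsilon> x N p"
    unfolding discrete_connection_def using x cost before p xp hp hNp d0_pos excl pN by auto
  then show thesis by (rule that)
qed

end

section \<open>The limit orbit\<close>

lemma convergent_subsequence_real:
  fixes t :: "nat \<Rightarrow> real"
  assumes "\<And>n. \<bar>t n\<bar> \<le> R"
  obtains s t' where "strict_mono (s :: nat \<Rightarrow> nat)" "(\<lambda>n. t (s n)) \<longlonglongrightarrow> t'"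
proof -
  have "bounded (range t)" using assms by (auto simp: bounded_iff)
  then show thesis using bounded_imp_convergent_subsequence[of t] that by (auto simp: o_def)
qed

lemma frequently_subsequence:
  assumes "\<not> eventually (\<lambda>n. \<not> P n) sequentially"
  shows "\<exists>s::nat \<Rightarrow> nat. strict_mono s \<and> (\<forall>n. P (s n))"
proof -
  have "infinite {n. P n}"
    using assms by (simp add: eventually_sequentially infinite_nat_iff_unbounded_le)
  then have "strict_mono (enumerate {n. P n})" "\<forall>n. P (enumerate {n. P n} n)"
    using strict_mono_enumerate[of "{n. P n}"] enumerate_in_set[of "{n. P n}"] by auto
  then show ?thesis by blast
qed

lemma le_of_le_scaled:
  fixes a b :: real
  assumes "\<And>n::nat. a \<le> (1 + 1 / real (Suc n)) * b"
  shows "a \<le> b"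
proof (rule LIMSEQ_le_const)
  have "(\<lambda>n. (1 + inverse (real (Suc n))) * b) \<longlonglongrightarrow> (1 + 0) * b"
    by (intro tendsto_intros LIMSEQ_inverse_real_of_nat)
  then show "(\<lambda>n. (1 + 1 / real (Suc n)) * b) \<longlonglongrightarrow> b" by (simp add: inverse_eq_divide)
qed (use assms in auto)

text \<open>The sequences are those remaining after extraction; \<open>q\<close>, \<open>v\<close>
  and \<open>G\<close> are the limits of position, velocity and accumulated action.\<close>

locale orbit_limit = lattice_wells V c \<Lambda> B w\<^sub>0 L
  for V :: "real ^ 'n \<Rightarrow> real" and c \<Lambda> B w\<^sub>0 L +
  fixes h \<epsilon> :: "nat \<Rightarrow> real" and x :: "nat \<Rightarrow> nat \<Rightarrow> real ^ 'n" and N p :: "nat \<Rightarrow> nat"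
    and q v :: "real \<Rightarrow> real ^ 'n" and G :: "real \<Rightarrow> real"
  assumes conn: "\<And>n. discrete_connection (h n) (\<epsilon> n) (x n) (N n) (p n)"
    and h: "\<And>n. h n > 0" "h \<longlonglongrightarrow> 0" and \<epsilon>: "\<epsilon> \<longlonglongrightarrow> 0"
    and q_deriv: "\<And>t. (q has_vector_derivative v t) (at t)"
    and v_deriv: "\<And>t. (v has_vector_derivative grad V (q t)) (at t)"
    and G_deriv: "\<And>t. (G has_vector_derivative 1 / 2 * (norm (v t))\<^sup>2 + W (q t)) (at t)"
    and lim: "\<And>s l t. strict_mono s \<Longrightarrow> (\<lambda>m. of_int (l m) * h (s m)) \<longlonglongrightarrow> t \<Longrightarrow>
      (\<lambda>m. phase_point W (h (s m)) (reflected (x (s m)) (N (s m)) (p (s m))) (l m)) \<longlonglongrightarrow> (q t, v t, G t)"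
begin

abbreviation "X n \<equiv> reflected (x n) (N n) (p n)"

lemma geodesic: "reflected_geodesic W \<Lambda> B (h n) (\<epsilon> n) (x n) (N n) (grad V) (p n) d\<^sub>0"
  using conn[of n] unfolding discrete_connection_def by blast

lemma p_le_N: "p n \<le> N n"
  using reflected_geodesic.p_le[OF geodesic] .

lemma lim_q:
  assumes "strict_mono s" "(\<lambda>m. of_int (l m) * h (s m)) \<longlonglongrightarrow> t"
  shows "(\<lambda>m. X (s m) (l m)) \<longlonglongrightarrow> q t"
  using tendsto_fst[OF lim[OF assms]] by (simp add: phase_point_def)

lemma lim_v:
  assumes "strict_mono s" "(\<lambda>m. of_int (l m) * h (s m)) \<longlonglongrightarrow> t"
  shows "(\<lambda>m. velocity (h (s m)) (X (s m)) (l m)) \<longlonglongrightarrow> v t"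
  using tendsto_fst[OF tendsto_snd[OF lim[OF assms]]] by (simp add: phase_point_def)

lemma lim_G:
  assumes "strict_mono s" "(\<lambda>m. of_int (l m) * h (s m)) \<longlonglongrightarrow> t"
  shows "(\<lambda>m. accumulated_action W (h (s m)) (X (s m)) (l m)) \<longlonglongrightarrow> G t"
  using tendsto_snd[OF tendsto_snd[OF lim[OF assms]]] by (simp add: phase_point_def)

lemma X_index:
  assumes "- int (p n) \<le> l" "l \<le> int (N n) - int (p n)"
  shows "X n l = x n (nat (int (p n) + l))"
  unfolding reflected_def
  by (subst fold_index_id[OF reflected_geodesic.N_pos[OF geodesic]]) (use assms in auto)

lemma const_index_tendsto:
  "(\<lambda>m. of_int l * h m) \<longlonglongrightarrow> 0"
  using tendsto_mult[OF tendsto_const h(2), of "of_int l"] by simp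

text \<open>The first node outside the open ball is at most one step of length \<open>C * h\<close>
  beyond it. This normalisation keeps the limit orbit from collapsing into a well.\<close>

lemma norm_q0: "norm (q 0) = 1/3"
proof (rule LIMSEQ_unique)
  show "(\<lambda>n. norm (X n 0)) \<longlonglongrightarrow> norm (q 0)"
    by (intro tendsto_norm) (use lim_q[OF strict_mono_id, of "\<lambda>_. 0" 0] in simp)
  have "X n 0 = x n (p n)" for n using X_index[of n 0] p_le_N[of n] by simp
  moreover have "norm (x n (p n)) \<ge> 1/3" "norm (x n (p n)) \<le> 1/3 + C * h n" for n
    using conn[of n] unfolding discrete_connection_def by blast+
  ultimately have X0: "norm (X n 0) \<ge> 1/3" "norm (X n 0) \<le> 1/3 + C * h n" for n by simp_all
  have "(\<lambda>n. 1/3 + C * h n) \<longlonglongrightarrow> 1/3 + C * 0" by (intro tendsto_intros h)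
  then have up: "(\<lambda>n. 1/3 + C * h n) \<longlonglongrightarrow> 1/3" by simp
  show "(\<lambda>n. norm (X n 0)) \<longlonglongrightarrow> 1/3"
    by (rule tendsto_sandwich[OF _ _ tendsto_const up]) (use X0 in auto)
qed

lemma V_q0: "V (q 0) > c"
  using w\<^sub>0(2)[OF norm_q0] w\<^sub>0(1) by linarith

text \<open>The resampling inequality at node \<open>p\<close>, divided by \<open>h\<close>, with
  \<open>k\<close> and \<open>k'\<close> fixed while \<open>h\<close> tends to 0. The chord of
  \<open>k\<close> steps then has length about \<open>k * h * norm (v 0)\<close>, and the Lipschitz
  errors disappear.\<close>

lemma resampled_energy:
  fixes k k' :: nat
  assumes k: "k > 0" "k' > 0"
  shows "(real k * norm (v 0))\<^sup>2 / (2 * k) + k * W (q 0) \<le> (real k * norm (v 0))\<^sup>2 / (2 * k') + k' * W (q 0)"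
proof -
  define D where "D n = norm (X n (int k) - X n 0) / h n" for n
  have D: "D \<longlonglongrightarrow> real k * norm (v 0)"
  proof -
    have "(\<lambda>n. \<Sum>j<k. velocity (h n) (X n) (int j + 1)) \<longlonglongrightarrow> (\<Sum>j<k. v 0)"
      using lim_v[OF strict_mono_id, of "\<lambda>_. int j + 1" 0 for j] const_index_tendsto[of "int j + 1" for j]
      by (intro tendsto_sum) simp
    then have "(\<lambda>n. norm (\<Sum>j<k. velocity (h n) (X n) (int j + 1))) \<longlonglongrightarrow> norm (real k *\<^sub>R v 0)"
      by (intro tendsto_norm) (simp add: sum_constant_scaleR del: sum_constant)
    moreover have "norm (\<Sum>j<k. velocity (h n) (X n) (int j + 1)) = D n" for n
    proof -
      have "(\<Sum>j<k. velocity (h n) (X n) (int j + 1)) = (1 / h n) *\<^sub>R (\<Sum>j<k. X n (int (Suc j)) - X n (int j))"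
        unfolding velocity_def by (simp add: scaleR_sum_right add.commute)
      also have "\<dots> = (1 / h n) *\<^sub>R (X n (int k) - X n 0)"
        by (subst sum_lessThan_telescope) simp
      finally show ?thesis using h(1)[of n] by (simp add: D_def)
    qed
    ultimately show ?thesis by simp
  qed
  have X0: "(\<lambda>n. W (X n 0)) \<longlonglongrightarrow> W (q 0)"
    using continuous_on_tendsto_compose[OF W_cont lim_q[OF strict_mono_id, of "\<lambda>_. 0" 0]] by simp
  have "eventually (\<lambda>n. real k * h n < d\<^sub>0) sequentially"
    using order_tendstoD(2)[OF const_index_tendsto[of "int k"] d0_pos(1)] by simp
  then have "eventually (\<lambda>n. (D n)\<^sup>2 / (2 * k) + k * (W (X n 0) + \<epsilon> n - \<Lambda> * (C * h n * k))
      \<le> (D n)\<^sup>2 / (2 * k') + k' * (W (X n 0) + \<epsilon> n + \<Lambda> * (C * h n * k))) sequentially"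
  proof eventually_elim
    case (elim n)
    interpret rg: reflected_geodesic W \<Lambda> B "h n" "\<epsilon> n" "x n" "N n" "grad V" "p n" d\<^sub>0 by (rule geodesic)
    have "d\<^sub>0 \<le> h n * real (N n - p n)" using conn[of n] unfolding discrete_connection_def by blast
    then have "h n * real k < h n * real (N n - p n)" using elim by (simp add: mult.commute)
    then have pk: "p n + k \<le> N n" using h(1)[of n] by simp
    have X: "X n 0 = x n (p n)" "X n (int k) = x n (p n + k)"
      using X_index[of n 0] X_index[of n "int k"] pk by (auto simp: nat_add_distrib)
    define d where "d = norm (x n (p n + k) - x n (p n))"
    have dD: "d = h n * D n" unfolding d_def D_def X using h(1)[of n] by simp
    have "h n * ((D n)\<^sup>2 / (2 * k) + k * (W (X n 0) + \<epsilon> n - \<Lambda> * (C * h n * k)))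
      \<le> h n * ((D n)\<^sup>2 / (2 * k') + k' * (W (X n 0) + \<epsilon> n + \<Lambda> * (C * h n * k)))"
      using rg.resampling_inequality[OF k pk d_def] h(1)[of n] unfolding dD X
      by (simp add: power_mult_distrib power2_eq_square distrib_left mult_ac)
    then show ?case using h(1)[of n] by (rule mult_left_le_imp_le)
  qed
  moreover have "(\<lambda>n. (D n)\<^sup>2 / (2 * k) + k * (W (X n 0) + \<epsilon> n - \<Lambda> * (C * h n * k)))
      \<longlonglongrightarrow> (real k * norm (v 0))\<^sup>2 / (2 * k) + k * (W (q 0) + 0 - \<Lambda> * (C * 0 * k))"
    using k by (intro tendsto_intros D X0 \<epsilon> h) auto
  moreover have "(\<lambda>n. (D n)\<^sup>2 / (2 * k') + k' * (W (X n 0) + \<epsilon> n + \<Lambda> * (C * h n * k)))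
      \<longlonglongrightarrow> (real k * norm (v 0))\<^sup>2 / (2 * k') + k' * (W (q 0) + 0 + \<Lambda> * (C * 0 * k))"
    using k by (intro tendsto_intros D X0 \<epsilon> h) auto
  ultimately show ?thesis
    using tendsto_le[OF sequentially_bot] by fastforce
qed

text \<open>Taking \<open>k' = k + 1\<close> and \<open>k' = k - 1\<close> lengthens or shortens the
  duration by a relative amount \<open>1 / k\<close>. As \<open>k\<close> grows, the two
  inequalities become the two halves of the equality.\<close>

lemma energy_at_0: "1 / 2 * (norm (v 0))\<^sup>2 = W (q 0)"
proof (rule antisym)
  define a w where "a = 1 / 2 * (norm (v 0))\<^sup>2" and "w = W (q 0)"
  have r: "real k * a + real k * w \<le> (real k)\<^sup>2 * a / real k' + real k' * w" if "k > 0" "k' > 0" for k k' :: nat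
  proof -
    have "(real k * norm (v 0))\<^sup>2 / (2 * real k) = real k * a"
      using that by (simp add: a_def power_mult_distrib power2_eq_square)
    moreover have "(real k * norm (v 0))\<^sup>2 / (2 * real k') = (real k)\<^sup>2 * a / real k'"
      by (simp add: a_def power_mult_distrib)
    ultimately show ?thesis using resampled_energy[OF that] unfolding w_def by simp
  qed
  have "a \<le> w"
  proof (rule le_of_le_scaled)
    fix n :: nat
    define K where "K = real (Suc n)"
    have K: "K > 0" "real (Suc n + 1) = K + 1" by (auto simp: K_def)
    have "K * a + K * w \<le> K\<^sup>2 * a / (K + 1) + (K + 1) * w"
      using r[of "Suc n" "Suc n + 1"] unfolding K(2) K_def[symmetric] by simp
    moreover have "K\<^sup>2 * a / (K + 1) = K * a - K * a / (K + 1)"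
      using K by (simp add: field_simps power2_eq_square)
    ultimately have "K * a / (K + 1) \<le> w" by (simp add: algebra_simps)
    then show "a \<le> (1 + 1 / real (Suc n)) * w"
      unfolding K_def[symmetric] using K(1) by (simp add: field_simps)
  qed
  then show "1 / 2 * (norm (v 0))\<^sup>2 \<le> W (q 0)" unfolding a_def w_def .
  have "w \<le> a"
  proof (rule le_of_le_scaled)
    fix n :: nat
    define K where "K = real (Suc n)"
    have K: "K > 0" "real (Suc n + 1) = K + 1" by (auto simp: K_def)
    have "(K + 1) * a + (K + 1) * w \<le> (K + 1)\<^sup>2 * a / K + K * w"
      using r[of "Suc n + 1" "Suc n"] unfolding K(2) K_def[symmetric] by simp
    moreover have "(K + 1)\<^sup>2 * a / K = (K + 1) * a + (1 + 1 / K) * a"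
      using K by (simp add: field_simps power2_eq_square)
    ultimately show "w \<le> (1 + 1 / real (Suc n)) * a"
      unfolding K_def[symmetric] by (simp add: algebra_simps)
  qed
  then show "W (q 0) \<le> 1 / 2 * (norm (v 0))\<^sup>2" unfolding a_def w_def .
qed

text \<open>Constancy follows from the equation of motion; the value is found at time 0, where
  \<open>V > c\<close> and therefore \<open>W = V - c\<close>. In turn it yields
  \<open>V \<ge> c\<close> along the whole orbit, so that \<open>G\<close> is an antiderivative of
  the integrand of \<open>J\<close>.\<close>

lemma energy_conserved: "V (q t) - 1 / 2 * (norm (v t))\<^sup>2 = c"
proof -
  have "\<forall>t. ((\<lambda>t. V (q t) - 1 / 2 * (v t \<bullet> v t)) has_real_derivative 0) (at t)"
  proof
    fix t
    have "((\<lambda>t. V (q t)) has_derivative (\<lambda>s. grad V (q t) \<bullet> (s *\<^sub>R v t))) (at t)"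
      by (rule has_derivative_compose[OF q_deriv[unfolded has_vector_derivative_def] V_deriv])
    moreover have "((\<lambda>t. v t \<bullet> v t) has_derivative (\<lambda>s. v t \<bullet> (s *\<^sub>R grad V (q t)) + (s *\<^sub>R grad V (q t)) \<bullet> v t)) (at t)"
      using has_derivative_inner[OF v_deriv[unfolded has_vector_derivative_def] v_deriv[unfolded has_vector_derivative_def]] .
    ultimately have D: "((\<lambda>t. V (q t) - 1 / 2 * (v t \<bullet> v t)) has_derivative
        (\<lambda>s. grad V (q t) \<bullet> (s *\<^sub>R v t) - 1 / 2 * (v t \<bullet> (s *\<^sub>R grad V (q t)) + (s *\<^sub>R grad V (q t)) \<bullet> v t))) (at t)"
      by (intro has_derivative_diff has_derivative_mult_right)
    then show "((\<lambda>t. V (q t) - 1 / 2 * (v t \<bullet> v t)) has_real_derivative 0) (at t)"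
      unfolding has_field_derivative_def
      by (rule has_derivative_eq_rhs) (auto simp: inner_commute fun_eq_iff)
  qed
  from DERIV_isconst_all[OF this, of t 0]
  have "V (q t) - 1 / 2 * (v t \<bullet> v t) = V (q 0) - 1 / 2 * (v 0 \<bullet> v 0)" .
  then show ?thesis
    using energy_at_0 W_simps(5)[OF V_q0] unfolding power2_norm_eq_inner by linarith
qed

lemma V_q_ge: "V (q t) \<ge> c"
  using energy_conserved[of t] zero_le_power2[of "norm (v t)"] by linarith

lemma q_cont: "continuous_on UNIV q" and v_cont: "continuous_on UNIV v"
  using q_deriv v_deriv by (meson continuous_at_imp_continuous_on has_vector_derivative_continuous)+

lemma J_eq:
  assumes "\<sigma> < \<tau>"
  shows "J V c \<sigma> \<tau> q v = G \<tau> - G \<sigma>"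
proof (rule J_antiderivative)
  show "(G has_vector_derivative 1 / 2 * (norm (v t))\<^sup>2 + (V (q t) - c)) (at t)" for t
    using G_deriv[of t] V_q_ge[of t] by (simp add: W_def)
qed (use assms q_cont v_cont V_cont in auto)

lemma G_0: "G 0 = 0"
  using lim_G[OF strict_mono_id, of "\<lambda>_. 0" 0] by (simp add: accumulated_action_def LIMSEQ_const_iff)

lemma G_limit_bound:
  assumes s: "strict_mono s" and l: "(\<lambda>m. of_int (l m) * h (s m)) \<longlonglongrightarrow> t"
    and r: "eventually (\<lambda>m. - int (p (s m)) \<le> l m \<and> l m \<le> int (N (s m)) - int (p (s m))) sequentially"
  shows "\<bar>G t\<bar> \<le> M_p V"
proof (rule tendsto_le[OF sequentially_bot])
  show "(\<lambda>m. \<bar>accumulated_action W (h (s m)) (X (s m)) (l m)\<bar>) \<longlonglongrightarrow> \<bar>G t\<bar>"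
    by (intro tendsto_rabs lim_G s l)
  show "(\<lambda>m. M_p V + \<epsilon> (s m)) \<longlonglongrightarrow> M_p V"
    using tendsto_add[OF tendsto_const LIMSEQ_subseq_LIMSEQ[OF \<epsilon> s], of "M_p V"] by (simp add: o_def)
  show "eventually (\<lambda>m. \<bar>accumulated_action W (h (s m)) (X (s m)) (l m)\<bar> \<le> M_p V + \<epsilon> (s m)) sequentially"
    using r
  proof eventually_elim
    case (elim m)
    then have "\<bar>accumulated_action W (h (s m)) (X (s m)) (l m)\<bar> \<le> path_cost W (h (s m)) (\<epsilon> (s m)) (x (s m)) 0 (N (s m))"
      using reflected_geodesic.accumulated_action_bound[OF geodesic] by blast
    also have "\<dots> \<le> M_p V + \<epsilon> (s m)" using conn[of "s m"] unfolding discrete_connection_def by blast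
    finally show ?case .
  qed
qed

text \<open>Reflection lets \<open>G\<close> grow without bound along the orbit, so each position is
  traced back to a time inside the unreflected window. The folded indices have bounded times, and a
  subsequence of them converges.\<close>

lemma folded_time:
  obtains t' where "q t' = q t" "\<bar>G t'\<bar> \<le> M_p V"
proof -
  have "\<exists>l'. X n l' = X n \<lfloor>t / h n\<rfloor> \<and> - int (p n) \<le> l' \<and> l' \<le> int (N n) - int (p n) \<and> \<bar>l'\<bar> \<le> \<bar>\<lfloor>t / h n\<rfloor>\<bar>" for n
    by (rule reflected_geodesic.reflected_folds[OF geodesic, of n "\<lfloor>t / h n\<rfloor>"]) blast
  then obtain l' where l': "\<And>n. X n (l' n) = X n \<lfloor>t / h n\<rfloor>" "\<And>n. - int (p n) \<le> l' n"
    "\<And>n. l' n \<le> int (N n) - int (p n)" "\<And>n. \<bar>l' n\<bar> \<le> \<bar>\<lfloor>t / h n\<rfloor>\<bar>" by metis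
  have fl: "(\<lambda>n. of_int \<lfloor>t / h n\<rfloor> * h n) \<longlonglongrightarrow> t" by (rule floor_mult_tendsto[OF h])
  then have "Bseq (\<lambda>n. of_int \<lfloor>t / h n\<rfloor> * h n)" by (auto intro: convergent_imp_Bseq convergentI)
  then obtain R where R: "\<And>n. \<bar>of_int \<lfloor>t / h n\<rfloor> * h n\<bar> \<le> R" unfolding Bseq_def by auto
  have "\<bar>of_int (l' n) * h n\<bar> \<le> R" for n
  proof -
    have "\<bar>of_int (l' n) * h n\<bar> = of_int \<bar>l' n\<bar> * h n" using h(1)[of n] by (simp add: abs_mult)
    also have "\<dots> \<le> of_int \<bar>\<lfloor>t / h n\<rfloor>\<bar> * h n"
      using l'(4)[of n] h(1)[of n] by (intro mult_right_mono) (auto simp del: of_int_abs)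
    also have "\<dots> = \<bar>of_int \<lfloor>t / h n\<rfloor> * h n\<bar>" using h(1)[of n] by (simp add: abs_mult)
    finally show ?thesis using R[of n] by linarith
  qed
  then obtain s t' where s: "strict_mono s" and t': "(\<lambda>m. of_int (l' (s m)) * h (s m)) \<longlonglongrightarrow> t'"
    by (rule convergent_subsequence_real)
  have "(\<lambda>m. X (s m) (l' (s m))) \<longlonglongrightarrow> q t'" by (rule lim_q[OF s t'])
  moreover have "(\<lambda>m. X (s m) (l' (s m))) \<longlonglongrightarrow> q t"
    unfolding l'(1) by (rule lim_q[OF s]) (use LIMSEQ_subseq_LIMSEQ[OF fl s] in \<open>simp add: o_def\<close>)
  ultimately have "q t' = q t" by (rule LIMSEQ_unique)
  moreover have "\<bar>G t'\<bar> \<le> M_p V" by (rule G_limit_bound[OF s t']) (use l' in simp)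
  ultimately show thesis by (rule that)
qed

text \<open>By the mean value theorem the Lagrangian equals the average slope of \<open>G\<close> at
  some time, which is small on a long interval of bounded action.\<close>

lemma small_potential:
  assumes ab: "a < b" "2 * M_p V < (b - a) * \<delta>" and G: "\<bar>G a\<bar> \<le> M_p V" "\<bar>G b\<bar> \<le> M_p V"
  obtains t where "a < t" "t < b" "W (q t) < \<delta>"
proof -
  have "(G has_real_derivative 1 / 2 * (norm (v t))\<^sup>2 + W (q t)) (at t)" for t
    using G_deriv by (simp add: has_real_derivative_iff_has_vector_derivative)
  then obtain t where t: "a < t" "t < b" "G b - G a = (b - a) * (1 / 2 * (norm (v t))\<^sup>2 + W (q t))"
    using MVT2[OF ab(1), of G "\<lambda>t. 1 / 2 * (norm (v t))\<^sup>2 + W (q t)"] by blast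
  have "(b - a) * (1 / 2 * (norm (v t))\<^sup>2 + W (q t)) < (b - a) * \<delta>" using t(3) ab(2) G by linarith
  then have "1 / 2 * (norm (v t))\<^sup>2 + W (q t) < \<delta>" using ab(1) by simp
  then have "W (q t) < \<delta>" using zero_le_power2[of "norm (v t)"] by linarith
  with t show thesis by (intro that)
qed

text \<open>If the times \<open>h * p\<close> stay bounded along a subsequence, the starting nodes
  converge to a point of the orbit. Otherwise every negative time eventually lies in the window, the
  action on the past half-line is bounded, and \<open>W\<close> becomes small there.\<close>

lemma approaches_start:
  assumes "\<rho> > 0"
  obtains t y where "y \<in> sublevel_at V c 0" "norm (q t - y) < \<rho>"
proof (cases "\<forall>S. eventually (\<lambda>n. \<not> h n * real (p n) \<le> S) sequentially")
  case False
  then obtain S where "\<not> eventually (\<lambda>n. \<not> h n * real (p n) \<le> S) sequentially" by blast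
  from frequently_subsequence[OF this] obtain s :: "nat \<Rightarrow> nat" where
    s: "strict_mono s" "\<forall>n. h (s n) * real (p (s n)) \<le> S" by blast
  have "\<bar>of_int (- int (p (s n))) * h (s n)\<bar> \<le> S" for n
    using s(2)[rule_format, of n] h(1)[of "s n"] by (simp add: abs_mult mult.commute)
  then obtain s' t where s': "strict_mono s'" "(\<lambda>n. of_int (- int (p (s (s' n)))) * h (s (s' n))) \<longlonglongrightarrow> t"
    by (rule convergent_subsequence_real)
  have Xlim: "(\<lambda>n. X (s (s' n)) (- int (p (s (s' n))))) \<longlonglongrightarrow> q t"
    using lim_q[OF strict_mono_o[OF s(1) s'(1)], of "\<lambda>n. - int (p (s (s' n)))" t] s'(2) by (simp add: o_def)
  have Xin: "X n (- int (p n)) \<in> sublevel_at V c 0" for n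
    using X_index[of n "- int (p n)"] conn[of n] unfolding discrete_connection_def by simp
  have cl: "closed (sublevel_at V c 0)" using compact_central_well compact_imp_closed by blast
  have "q t \<in> sublevel_at V c 0" by (rule closed_sequentially[OF cl Xin Xlim])
  then show thesis using that[of "q t" t] assms by simp
next
  case True
  have idx: "eventually (\<lambda>n. - int (p n) \<le> \<lfloor>t / h n\<rfloor> \<and> \<lfloor>t / h n\<rfloor> < 0) sequentially" if "t < 0" for t
  proof -
    have "eventually (\<lambda>n. \<not> h n * real (p n) \<le> - t + 1) sequentially" using True by blast
    moreover have "eventually (\<lambda>n. h n < 1) sequentially" using h(2) by (intro order_tendstoD(2)) auto
    ultimately show ?thesis
    proof eventually_elim
      case (elim n)
      have "- real (p n) * h n \<le> t" using elim by (simp add: algebra_simps)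
      then have "- real (p n) \<le> t / h n" using h(1)[of n] by (simp add: field_simps)
      moreover have "t / h n < 0" using that h(1)[of n] by (simp add: divide_neg_pos)
      ultimately show ?case by (simp add: le_floor_iff floor_less_iff)
    qed
  qed
  have G: "\<bar>G t\<bar> \<le> M_p V" if "t < 0" for t
  proof (rule G_limit_bound[OF strict_mono_id, of "\<lambda>n. \<lfloor>t / h n\<rfloor>"])
    show "(\<lambda>n. of_int \<lfloor>t / h n\<rfloor> * h (id n)) \<longlonglongrightarrow> t" using floor_mult_tendsto[OF h] by simp
    show "eventually (\<lambda>n. - int (p (id n)) \<le> \<lfloor>t / h n\<rfloor> \<and> \<lfloor>t / h n\<rfloor> \<le> int (N (id n)) - int (p (id n))) sequentially"
      using idx[OF that]
    proof eventually_elim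
      case (elim n)
      have "int (p n) \<le> int (N n)" using p_le_N[of n] by simp
      with elim show ?case unfolding id_apply by linarith
    qed
  qed
  have inball: "norm (q t) \<le> 1/3" if "t < 0" for t
  proof (rule tendsto_upperbound[OF tendsto_norm _ sequentially_bot])
    show "(\<lambda>n. X n \<lfloor>t / h n\<rfloor>) \<longlonglongrightarrow> q t"
      using lim_q[OF strict_mono_id, of "\<lambda>n. \<lfloor>t / h n\<rfloor>" t] floor_mult_tendsto[OF h] by simp
    show "eventually (\<lambda>n. norm (X n \<lfloor>t / h n\<rfloor>) \<le> 1/3) sequentially"
      using idx[OF that]
    proof eventually_elim
      case (elim n)
      have "\<forall>i<p n. norm (x n i) < 1/3" using conn[of n] unfolding discrete_connection_def by blast
      moreover define l where "l = \<lfloor>t / h n\<rfloor>"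
      then have "nat (int (p n) + \<lfloor>t / h n\<rfloor>) < p n" using elim unfolding l_def[symmetric] by auto
      ultimately have "norm (x n (nat (int (p n) + \<lfloor>t / h n\<rfloor>))) < 1/3" by blast
      then show ?case using X_index[of n "\<lfloor>t / h n\<rfloor>"] elim p_le_N[of n] by simp
    qed
  qed
  obtain \<delta> where \<delta>: "\<delta> > 0" "\<And>z. W z < \<delta> \<Longrightarrow> \<exists>y. V y \<le> c \<and> norm (z - y) < min \<rho> (1/3)"
    using near_sublevel[of "min \<rho> (1/3)"] assms by auto
  have M: "0 \<le> M_p V" using G[of "-1"] by simp
  define S where "S = (2 * M_p V + 1) / \<delta>"
  have S: "S > 0" "S * \<delta> = 2 * M_p V + 1" using \<delta> M by (auto simp: S_def)
  obtain t where t: "- S - 1 < t" "t < - 1" "W (q t) < \<delta>"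
    by (rule small_potential[of "- S - 1" "-1" \<delta>]) (use S G[of "- S - 1"] G[of "-1"] in auto)
  obtain y where y: "V y \<le> c" "norm (q t - y) < min \<rho> (1/3)" using \<delta>(2)[OF t(3)] by blast
  obtain \<xi> where \<xi>: "\<xi> \<in> int_vecs" "norm (y - \<xi>) < 1/3" using covered[OF y(1)] by blast
  \<comment> \<open>Three contributions, none above 1/3 and two of them strictly below, add up to
    less than the minimal length 1 of a nonzero lattice vector.\<close>
  have "\<xi> = 0"
  proof (rule ccontr)
    assume "\<xi> \<noteq> 0"
    then have "1 \<le> norm \<xi>" by (rule norm_int_vec_ge_1[OF \<xi>(1)])
    moreover have "norm \<xi> \<le> norm (q t) + norm (q t - y) + norm (y - \<xi>)"
      using norm_triangle_ineq4[of "q t" "q t - y + (y - \<xi>)"] norm_triangle_ineq[of "q t - y" "y - \<xi>"] by simp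
    ultimately show False using inball[of t] t y \<xi> by auto
  qed
  then have "y \<in> sublevel_at V c 0" using \<xi> y by (simp add: sublevel_at_iff)
  then show thesis using that[of y t] y by simp
qed

lemma approaches_end:
  assumes "\<rho> > 0" "\<rho> * (1 / 2 + \<Lambda> * \<rho>) < \<delta>\<^sub>0"
  obtains t y where "y \<in> wells (int_vecs - L)" "norm (q t - y) < \<rho>"
proof (cases "\<forall>S. eventually (\<lambda>n. \<not> h n * real (N n - p n) \<le> S) sequentially")
  case False
  then obtain S where "\<not> eventually (\<lambda>n. \<not> h n * real (N n - p n) \<le> S) sequentially" by blast
  from frequently_subsequence[OF this] obtain s :: "nat \<Rightarrow> nat" where
    s: "strict_mono s" "\<forall>n. h (s n) * real (N (s n) - p (s n)) \<le> S" by blast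
  have "\<bar>of_int (int (N (s n) - p (s n))) * h (s n)\<bar> \<le> S" for n
    using s(2)[rule_format, of n] h(1)[of "s n"] by (simp add: abs_mult mult.commute del: of_nat_diff)
  then obtain s' t where s': "strict_mono s'" "(\<lambda>n. of_int (int (N (s (s' n)) - p (s (s' n)))) * h (s (s' n))) \<longlonglongrightarrow> t"
    by (rule convergent_subsequence_real)
  have Xlim: "(\<lambda>n. X (s (s' n)) (int (N (s (s' n)) - p (s (s' n))))) \<longlonglongrightarrow> q t"
    using lim_q[OF strict_mono_o[OF s(1) s'(1)], of "\<lambda>n. int (N (s (s' n)) - p (s (s' n)))" t] s'(2) by (simp add: o_def)
  have Xin: "X n (int (N n - p n)) \<in> wells (int_vecs - L)" for n
    using X_index[of n "int (N n - p n)"] conn[of n] p_le_N[of n] unfolding discrete_connection_def by simp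
  have cl: "closed (wells (int_vecs - L))" by (rule closed_wells) blast
  have "q t \<in> wells (int_vecs - L)" by (rule closed_sequentially[OF cl Xin Xlim])
  then show thesis using that[of "q t" t] assms by simp
next
  case True
  have idx: "eventually (\<lambda>n. 0 \<le> \<lfloor>t / h n\<rfloor> \<and> \<lfloor>t / h n\<rfloor> \<le> int (N n) - int (p n)) sequentially" if "t > 0" for t
  proof -
    have "eventually (\<lambda>n. \<not> h n * real (N n - p n) \<le> t) sequentially" using True by blast
    then show ?thesis
    proof eventually_elim
      case (elim n)
      have "t / h n \<le> real (N n - p n)" using elim h(1)[of n] by (simp add: field_simps)
      then have "\<lfloor>t / h n\<rfloor> \<le> int (N n - p n)" by linarith
      moreover have "0 \<le> \<lfloor>t / h n\<rfloor>" using that h(1)[of n] by simp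
      ultimately show ?case using p_le_N[of n] by simp
    qed
  qed
  have G: "\<bar>G t\<bar> \<le> M_p V" if "t > 0" for t
  proof (rule G_limit_bound[OF strict_mono_id, of "\<lambda>n. \<lfloor>t / h n\<rfloor>"])
    show "(\<lambda>n. of_int \<lfloor>t / h n\<rfloor> * h (id n)) \<longlonglongrightarrow> t" using floor_mult_tendsto[OF h] by simp
    show "eventually (\<lambda>n. - int (p (id n)) \<le> \<lfloor>t / h n\<rfloor> \<and> \<lfloor>t / h n\<rfloor> \<le> int (N (id n)) - int (p (id n))) sequentially"
      using idx[OF that]
    proof eventually_elim
      case (elim n)
      have "int (p n) \<le> int (N n)" using p_le_N[of n] by simp
      with elim show ?case unfolding id_apply by linarith
    qed
  qed
  obtain \<delta> where \<delta>: "\<delta> > 0" "\<And>z. W z < \<delta> \<Longrightarrow> \<exists>y. V y \<le> c \<and> norm (z - y) < \<rho>"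
    using near_sublevel[OF assms(1)] by blast
  have M: "0 \<le> M_p V" using G[of 1] by simp
  define S where "S = (2 * M_p V + 1) / \<delta>"
  have S: "S > 0" "S * \<delta> = 2 * M_p V + 1" using \<delta> M by (auto simp: S_def)
  obtain t where t: "1 < t" "t < S + 1" "W (q t) < \<delta>"
    by (rule small_potential[of 1 "S + 1" \<delta>]) (use S G[of "S + 1"] G[of 1] in auto)
  obtain y where y: "V y \<le> c" "norm (q t - y) < \<rho>" using \<delta>(2)[OF t(3)] by blast
  \<comment> \<open>Otherwise the discrete paths would pass within \<open>\<rho>\<close> of
    \<open>y\<close> after the exit index, and the last clause of \<open>discrete_connection\<close>
    would give in the limit the reverse of the smallness assumed for \<open>\<rho>\<close>.\<close>
  have "y \<notin> wells L"
  proof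
    assume yL: "y \<in> wells L"
    have "(\<lambda>n. norm (X n \<lfloor>t / h n\<rfloor> - y)) \<longlonglongrightarrow> norm (q t - y)"
      using lim_q[OF strict_mono_id, of "\<lambda>n. \<lfloor>t / h n\<rfloor>" t] floor_mult_tendsto[OF h, of t] by (intro tendsto_intros) simp
    then have "eventually (\<lambda>n. norm (X n \<lfloor>t / h n\<rfloor> - y) < \<rho>) sequentially"
      by (rule order_tendstoD(2)) (rule y(2))
    moreover have "eventually (\<lambda>n. 0 \<le> \<lfloor>t / h n\<rfloor> \<and> \<lfloor>t / h n\<rfloor> \<le> int (N n) - int (p n)) sequentially"
      using idx t by simp
    ultimately have "eventually (\<lambda>n. \<delta>\<^sub>0 \<le> (\<rho> + h n) * (1 / 2 + \<Lambda> * \<rho> + \<epsilon> n)) sequentially"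
    proof eventually_elim
      case (elim n)
      define i where "i = nat (int (p n) + \<lfloor>t / h n\<rfloor>)"
      define l where "l = \<lfloor>t / h n\<rfloor>"
      have "p n \<le> i" "i \<le> N n" using elim(2) unfolding i_def l_def[symmetric] by auto
      moreover have "norm (x n i - y) \<le> \<rho>" using elim X_index[of n "\<lfloor>t / h n\<rfloor>"] unfolding i_def by simp
      ultimately show ?case using conn[of n] yL assms(1) unfolding discrete_connection_def by blast
    qed
    moreover have "(\<lambda>n. (\<rho> + h n) * (1 / 2 + \<Lambda> * \<rho> + \<epsilon> n)) \<longlonglongrightarrow> (\<rho> + 0) * (1 / 2 + \<Lambda> * \<rho> + 0)"
      by (intro tendsto_intros h \<epsilon>)
    ultimately have "\<delta>\<^sub>0 \<le> (\<rho> + 0) * (1 / 2 + \<Lambda> * \<rho> + 0)"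
      by (intro tendsto_lowerbound[OF _ _ sequentially_bot])
    then show False using assms(2) by simp
  qed
  moreover have "y \<in> wells int_vecs" using y wells_int_vecs by blast
  ultimately have "y \<in> wells (int_vecs - L)" unfolding wells_def by blast
  then show thesis using that y by blast
qed

end

section \<open>Existence of connecting orbits\<close>

definition connecting_orbit :: "(real ^ 'n \<Rightarrow> real) \<Rightarrow> real \<Rightarrow> real \<Rightarrow> real ^ 'n \<Rightarrow> (real \<Rightarrow> real ^ 'n) \<Rightarrow> bool" where
  "connecting_orbit V c R \<xi> q \<longleftrightarrow>
     C2_curve q \<and> (\<forall>t. vel (vel q) t = grad V (q t)) \<and> (\<forall>t. energy V q t = - c) \<and>
     (INF t. infdist (q t) (sublevel_at V c 0)) = 0 \<and>
     (INF t. infdist (q t) (sublevel_at V c \<xi>)) = 0 \<and>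
     (\<forall>t. norm (q t) \<le> R + 1)"

definition displacement_bound :: "(real ^ 'n \<Rightarrow> real) \<Rightarrow> real \<Rightarrow> real \<Rightarrow> bool" where
  "displacement_bound V c R \<longleftrightarrow>
     (\<forall>q q' \<sigma> \<tau>. W12_loc q q' \<and> \<sigma> < \<tau> \<and> (\<forall>t\<in>{\<sigma><..<\<tau>}. V (q t) \<ge> c) \<and>
        J V c \<sigma> \<tau> q q' \<le> M_p V + 1 \<longrightarrow> norm (q \<tau> - q \<sigma>) \<le> R)"

lemma INF_infdist_eq_0:
  assumes "\<And>\<rho>. \<rho> > 0 \<Longrightarrow> \<exists>t. infdist (q t) S < \<rho>"
  shows "(INF t. infdist (q t) S) = 0"
proof (rule antisym)
  show "(INF t. infdist (q t) S) \<le> 0"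
  proof (rule field_le_epsilon)
    fix \<rho> :: real assume "\<rho> > 0"
    then obtain t where "infdist (q t) S < \<rho>" using assms by blast
    moreover have "bdd_below (range (\<lambda>t. infdist (q t) S))" by (intro bdd_belowI[of _ 0]) (auto simp: infdist_nonneg)
    then have "(INF t. infdist (q t) S) \<le> infdist (q t) S" by (rule cINF_lower) simp
    ultimately show "(INF t. infdist (q t) S) \<le> 0 + \<rho>" by linarith
  qed
  show "0 \<le> (INF t. infdist (q t) S)" by (rule cINF_greatest) (auto simp: infdist_nonneg)
qed

lemma Linf_norm_le:
  fixes q :: "real \<Rightarrow> real ^ 'n"
  assumes "continuous_on UNIV q" "\<And>t. norm (q t) \<le> R"
  shows "Linf_norm q \<le> ereal R"
  unfolding Linf_norm_def
proof (rule esssup_I)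
  have "(\<lambda>t. norm (q t)) \<in> borel_measurable borel"
    by (intro borel_measurable_continuous_onI continuous_intros assms(1))
  then show "(\<lambda>t. ereal (norm (q t))) \<in> borel_measurable lborel" by simp
qed (use assms(2) in auto)

context orbit_limit
begin

lemma vel_eq: "vel q = v" "vel v = (\<lambda>t. grad V (q t))"
  using vector_derivative_at[OF q_deriv] vector_derivative_at[OF v_deriv] by (auto simp: vel_def fun_eq_iff)

lemma C2_curve_q: "C2_curve q"
  unfolding C2_curve_def vel_eq
proof (intro conjI)
  show "q differentiable_on UNIV" "v differentiable_on UNIV"
    using q_deriv v_deriv unfolding differentiable_on_def has_vector_derivative_def differentiable_def
    by (blast intro: has_derivative_at_withinI)+
  show "continuous_on UNIV (\<lambda>t. grad V (q t))"
    by (rule continuous_on_compose2[OF grad_cont q_cont]) simp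
qed

lemma energy_q: "energy V q t = - c"
  using energy_conserved[of t] unfolding energy_def vel_eq by simp

text \<open>The displacement bound is applied between time 0 and the folded time, where the action
  is at most \<open>M_p V\<close>. Since \<open>norm (q 0)\<close> is 1/3, \<open>R + 1\<close>
  suffices.\<close>

lemma norm_q_le:
  assumes "displacement_bound V c R"
    and R: "R \<ge> 0"
  shows "norm (q t) \<le> R + 1"
proof -
  have W12: "W12_loc q v" by (rule W12_loc_C1[OF q_deriv v_cont])
  obtain t' where t': "q t' = q t" "\<bar>G t'\<bar> \<le> M_p V" by (rule folded_time)
  have step: "norm (q \<tau> - q \<sigma>) \<le> R" if "\<sigma> < \<tau>" "G \<tau> - G \<sigma> \<le> M_p V" for \<sigma> \<tau>
  proof -
    have "W12_loc q v \<and> \<sigma> < \<tau> \<and> (\<forall>t\<in>{\<sigma><..<\<tau>}. V (q t) \<ge> c) \<and> J V c \<sigma> \<tau> q v \<le> M_p V + 1"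
      using W12 that V_q_ge J_eq[OF that(1)] by simp
    then show ?thesis using assms(1) unfolding displacement_bound_def by blast
  qed
  have "norm (q t' - q 0) \<le> R"
  proof (cases t' "0 :: real" rule: linorder_cases)
    case less
    then show ?thesis using step[of t' 0] t' G_0 by (simp add: norm_minus_commute)
  next
    case greater
    then show ?thesis using step[of 0 t'] t' G_0 by simp
  qed (use R in simp)
  then show ?thesis
    using norm_triangle_sub[of "q t'" "q 0"] norm_q0 t'(1) by simp
qed

text \<open>The well approached may change with \<open>\<rho>\<close>. A bounded orbit leaves only
  finitely many candidates; if each failed at its own radius, all would fail at the smallest
  one.\<close>

lemma approaches_single_well:
  assumes "\<And>t. norm (q t) \<le> R"
  obtains \<xi> where "\<xi> \<in> int_vecs - L" "\<And>\<rho>. \<rho> > 0 \<Longrightarrow> \<exists>t. infdist (q t) (sublevel_at V c \<xi>) < \<rho>"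
proof -
  define F where "F = {\<xi> \<in> int_vecs - L. norm \<xi> \<le> R + 2}"
  have "finite F"
    by (rule finite_subset[OF _ finite_int_vecs_bounded[of "R + 2"]]) (auto simp: F_def)
  \<comment> \<open>For \<open>\<rho> \<le> r\<close> the smallness condition of
    \<open>approaches_end\<close> holds, with a factor 2 to spare.\<close>
  define r where "r = min 1 (\<delta>\<^sub>0 / (2 * (1 / 2 + \<Lambda>)))"
  have r: "r > 0" unfolding r_def using d0_pos \<Lambda> by simp
  have small: "\<rho> * (1 / 2 + \<Lambda> * \<rho>) < \<delta>\<^sub>0" if "0 < \<rho>" "\<rho> \<le> r" for \<rho>
  proof -
    have "\<rho> * (1 / 2 + \<Lambda> * \<rho>) \<le> \<delta>\<^sub>0 / (2 * (1 / 2 + \<Lambda>)) * (1 / 2 + \<Lambda> * 1)"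
      using that \<Lambda> d0_pos unfolding r_def by (intro mult_mono add_mono mult_left_mono) auto
    also have "\<dots> = \<delta>\<^sub>0 / 2" using \<Lambda> by (simp add: field_simps)
    also have "\<dots> < \<delta>\<^sub>0" using d0_pos by simp
    finally show ?thesis .
  qed
  have near: "\<exists>\<xi>\<in>F. \<exists>t. infdist (q t) (sublevel_at V c \<xi>) < \<rho>" if \<rho>: "0 < \<rho>" "\<rho> \<le> r" for \<rho>
  proof -
    obtain t y where y: "y \<in> wells (int_vecs - L)" "norm (q t - y) < \<rho>"
      by (rule approaches_end[OF \<rho>(1) small[OF \<rho>]])
    obtain \<xi> where \<xi>: "\<xi> \<in> int_vecs - L" "y \<in> sublevel_at V c \<xi>" using y(1) unfolding wells_def by blast
    have "norm \<xi> \<le> norm (q t) + norm (q t - y) + norm (y - \<xi>)"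
      using norm_triangle_ineq4[of "q t" "q t - y + (y - \<xi>)"] norm_triangle_ineq[of "q t - y" "y - \<xi>"] by simp
    moreover have "norm (y - \<xi>) < 1/3" using \<xi>(2) by (simp add: sublevel_at_iff)
    moreover have "r \<le> 1" unfolding r_def by simp
    ultimately have "\<xi> \<in> F" unfolding F_def using \<xi>(1) y(2) assms[of t] \<rho> by simp
    moreover have "infdist (q t) (sublevel_at V c \<xi>) < \<rho>"
      using infdist_le[OF \<xi>(2), of "q t"] y(2) by (simp add: dist_norm)
    ultimately show ?thesis by blast
  qed
  have "\<exists>\<xi>\<in>F. \<forall>\<rho>>0. \<exists>t. infdist (q t) (sublevel_at V c \<xi>) < \<rho>"
  proof (rule ccontr)
    assume "\<not> ?thesis"
    then obtain \<rho> where \<rho>: "\<And>\<xi>. \<xi> \<in> F \<Longrightarrow> \<rho> \<xi> > 0" "\<And>\<xi> t. \<xi> \<in> F \<Longrightarrow> \<not> infdist (q t) (sublevel_at V c \<xi>) < \<rho> \<xi>"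
      by metis
    define m where "m = Min (insert r (\<rho> ` F))"
    have "m > 0" unfolding m_def using r \<rho>(1) \<open>finite F\<close> by (subst Min_gr_iff) auto
    moreover have "m \<le> r" unfolding m_def using \<open>finite F\<close> by (intro Min_le) auto
    ultimately obtain \<xi> t where \<xi>: "\<xi> \<in> F" "infdist (q t) (sublevel_at V c \<xi>) < m" using near by blast
    have "m \<le> \<rho> \<xi>" unfolding m_def using \<open>finite F\<close> \<xi>(1) by (intro Min_le) auto
    then show False using \<rho>(2)[OF \<xi>(1), of t] \<xi>(2) by linarith
  qed
  then show thesis using that unfolding F_def by blast
qed

lemma connecting_orbit_q:
  assumes "displacement_bound V c R"
    and R: "R \<ge> 0"
  shows "\<exists>\<xi>\<in>int_vecs - L. connecting_orbit V c R \<xi> q"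
proof -
  have bound: "norm (q t) \<le> R + 1" for t by (rule norm_q_le[OF assms])
  obtain \<xi> where \<xi>: "\<xi> \<in> int_vecs - L" "\<And>\<rho>. \<rho> > 0 \<Longrightarrow> \<exists>t. infdist (q t) (sublevel_at V c \<xi>) < \<rho>"
    using approaches_single_well[OF bound] by blast
  have "\<exists>t. infdist (q t) (sublevel_at V c 0) < \<rho>" if \<rho>: "\<rho> > 0" for \<rho>
  proof -
    obtain t y where y: "y \<in> sublevel_at V c 0" "norm (q t - y) < \<rho>" by (rule approaches_start[OF \<rho>])
    then have "infdist (q t) (sublevel_at V c 0) < \<rho>" using infdist_le[OF y(1), of "q t"] by (simp add: dist_norm)
    then show ?thesis by blast
  qed
  then have "connecting_orbit V c R \<xi> q"
    unfolding connecting_orbit_def vel_eq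
    using C2_curve_q energy_q bound INF_infdist_eq_0[OF \<xi>(2)] by (simp add: INF_infdist_eq_0)
  with \<xi>(1) show ?thesis by blast
qed

end

lemma continuous_on_phase_field:
  fixes g :: "'a::real_inner \<Rightarrow> 'a"
  assumes "continuous_on UNIV W" "continuous_on UNIV g"
  shows "continuous_on UNIV (phase_field W g)"
  unfolding phase_field_def case_prod_beta
  by (intro continuous_intros continuous_on_compose2[OF assms(1)] continuous_on_compose2[OF assms(2)]) auto

lemma scheme_error_tendsto:
  assumes "h \<longlonglongrightarrow> 0" "\<epsilon> \<longlonglongrightarrow> 0"
  shows "(\<lambda>n. scheme_error \<Lambda> B d (h n) (\<epsilon> n)) \<longlonglongrightarrow> 0"
proof -
  let ?C = "speed_bound B"
  have "(\<lambda>n. h n * \<Lambda> * (1 + ?C) + (2 * (2 * sqrt (\<Lambda> * ?C * h n + \<epsilon> n)) + h n * \<Lambda>) * (1 + h n * (1 + ?C)) * (1 + 1 / d))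
      \<longlonglongrightarrow> 0 * \<Lambda> * (1 + ?C) + (2 * (2 * sqrt (\<Lambda> * ?C * 0 + 0)) + 0 * \<Lambda>) * (1 + 0 * (1 + ?C)) * (1 + 1 / d)"
    by (intro tendsto_add tendsto_mult tendsto_const tendsto_real_sqrt assms)
  then show ?thesis unfolding scheme_error_def by simp
qed

context lattice_wells
begin

lemma connecting_orbit_exists:
  assumes e: "e \<in> int_vecs - L" "norm e = 1"
    and R: "displacement_bound V c R" "R \<ge> 0"
  shows "\<exists>\<xi>\<in>int_vecs - L. \<exists>q. connecting_orbit V c R \<xi> q"
proof -
  obtain n0 :: nat where n0: "1 / d\<^sub>0 < real n0" using reals_Archimedean2 by blast
  \<comment> \<open>Reciprocals of integers, so that whole steps fill unit time; the shift by
    \<open>n0\<close> ensures \<open>h n \<le> d\<^sub>0\<close> from the beginning.\<close>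
  define h where "h n = 1 / real (n + n0 + 1)" for n
  define \<epsilon> where "\<epsilon> n = 1 / real (Suc n)" for n
  have h_pos: "h n > 0" "h n * real (n + n0 + 1) = 1" for n by (auto simp: h_def)
  have h_le: "h n \<le> d\<^sub>0" for n
  proof -
    have "1 / d\<^sub>0 \<le> real (n + n0 + 1)" using n0 by simp
    then show ?thesis unfolding h_def using d0_pos by (simp add: field_simps)
  qed
  have \<epsilon>_lim: "\<epsilon> \<longlonglongrightarrow> 0" unfolding \<epsilon>_def using LIMSEQ_inverse_real_of_nat by (simp add: inverse_eq_divide)
  have h_lim: "h \<longlonglongrightarrow> 0"
  proof -
    have "(\<lambda>n. \<epsilon> (n + n0)) \<longlonglongrightarrow> 0" using \<epsilon>_lim by (rule LIMSEQ_ignore_initial_segment)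
    then show ?thesis unfolding \<epsilon>_def h_def by simp
  qed
  have \<epsilon>: "0 < \<epsilon> n" "\<epsilon> n \<le> 1" for n by (auto simp: \<epsilon>_def)
  have "\<exists>x N p. discrete_connection (h n) (\<epsilon> n) x N p" for n
    using discrete_connection_exists[OF h_pos(1) h_le h_pos(2) \<epsilon> e] by blast
  then obtain x N p where conn: "\<And>n. discrete_connection (h n) (\<epsilon> n) (x n) (N n) (p n)" by metis
  have rg: "reflected_geodesic W \<Lambda> B (h n) (\<epsilon> n) (x n) (N n) (grad V) (p n) d\<^sub>0" for n
    using conn[of n] unfolding discrete_connection_def by blast
  define z where "z n = phase_point W (h n) (reflected (x n) (N n) (p n))" for n
  have vel_le: "norm (velocity (h n) (reflected (x n) (N n) (p n)) l) \<le> C" for n l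
    by (rule reflected_geodesic.velocity_le[OF rg])
  have bound: "norm (phase_field W (grad V) (z n l)) \<le> C + (\<Lambda> + (1 / 2 * C\<^sup>2 + B))" for n l
  proof -
    let ?v = "velocity (h n) (reflected (x n) (N n) (p n)) l"
    have "norm (1 / 2 * (norm ?v)\<^sup>2 + W (reflected (x n) (N n) (p n) l)) \<le> 1 / 2 * C\<^sup>2 + B"
      using power_mono[OF vel_le[of n l], of 2] W_simps(2,4)[of "reflected (x n) (N n) (p n) l"] by simp
    then show ?thesis
      unfolding z_def phase_point_def phase_field_def
      by (simp del: real_norm_def) (intro order_trans[OF norm_Pair_le] add_mono vel_le \<Lambda>(2))
  qed
  have start: "norm (z n 0) \<le> (1/3 + C * d\<^sub>0) + (C + 0)" for n
  proof -
    interpret rg: reflected_geodesic W \<Lambda> B "h n" "\<epsilon> n" "x n" "N n" "grad V" "p n" d\<^sub>0 by (rule rg)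
    have "reflected (x n) (N n) (p n) 0 = x n (p n)"
      unfolding reflected_def by (subst fold_index_id[OF rg.N_pos]) (use rg.p_le in auto)
    moreover have "norm (x n (p n)) \<le> 1/3 + C * h n" using conn[of n] unfolding discrete_connection_def by blast
    moreover have "C * h n \<le> C * d\<^sub>0" using h_le[of n] C_pos by simp
    ultimately have "norm (reflected (x n) (N n) (p n) 0) \<le> 1/3 + C * d\<^sub>0" by simp
    moreover have "accumulated_action W (h n) (reflected (x n) (N n) (p n)) 0 = 0"
      by (simp add: accumulated_action_def)
    ultimately show ?thesis
      unfolding z_def phase_point_def
      by (intro order_trans[OF norm_Pair_le] add_mono vel_le) auto
  qed
  have err_nonneg: "0 \<le> scheme_error \<Lambda> B d\<^sub>0 (h n) (\<epsilon> n)" for n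
    by (rule reflected_geodesic.scheme_error_nonneg[OF rg])
  have step: "norm (z n j - z n i - h n *\<^sub>R (\<Sum>l\<in>{i..<j}. phase_field W (grad V) (z n l)))
      \<le> scheme_error \<Lambda> B d\<^sub>0 (h n) (\<epsilon> n) * (1 + of_int (j - i) * h n)" if "i \<le> j" for n i j
    unfolding z_def by (rule reflected_geodesic.phase_error[OF rg that])
  obtain r Z where r: "strict_mono (r :: nat \<Rightarrow> nat)"
    and Z: "\<And>t. (Z has_vector_derivative phase_field W (grad V) (Z t)) (at t)"
    and lim: "\<And>s l t. strict_mono (s :: nat \<Rightarrow> nat) \<Longrightarrow> (\<lambda>m. of_int (l m) * h (r (s m))) \<longlonglongrightarrow> t
       \<Longrightarrow> (\<lambda>m. z (r (s m)) (l m)) \<longlonglongrightarrow> Z t"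
    using euler_scheme_limit[where \<Phi> = "phase_field W (grad V)" and z = z and h = h
        and e = "\<lambda>n. scheme_error \<Lambda> B d\<^sub>0 (h n) (\<epsilon> n)", OF continuous_on_phase_field[OF W_cont grad_cont]
        h_pos(1) h_lim err_nonneg scheme_error_tendsto[OF h_lim \<epsilon>_lim] bound start step]
    by blast
  interpret orbit_limit V c \<Lambda> B w\<^sub>0 L "h \<circ> r" "\<epsilon> \<circ> r" "x \<circ> r" "N \<circ> r" "p \<circ> r"
    "\<lambda>t. fst (Z t)" "\<lambda>t. fst (snd (Z t))" "\<lambda>t. snd (snd (Z t))"
  proof
    show "(h \<circ> r) \<longlonglongrightarrow> 0" "(\<epsilon> \<circ> r) \<longlonglongrightarrow> 0"
      by (rule LIMSEQ_subseq_LIMSEQ[OF h_lim r], rule LIMSEQ_subseq_LIMSEQ[OF \<epsilon>_lim r])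
    show "((\<lambda>t. fst (Z t)) has_vector_derivative fst (snd (Z t))) (at t)" for t
      using bounded_linear.has_vector_derivative[OF bounded_linear_fst Z[of t]]
      by (simp add: phase_field_def case_prod_beta)
    show "((\<lambda>t. fst (snd (Z t))) has_vector_derivative grad V (fst (Z t))) (at t)" for t
      using bounded_linear.has_vector_derivative[OF bounded_linear_fst
          bounded_linear.has_vector_derivative[OF bounded_linear_snd Z[of t]]]
      by (simp add: phase_field_def case_prod_beta)
    show "((\<lambda>t. snd (snd (Z t))) has_vector_derivative 1 / 2 * (norm (fst (snd (Z t))))\<^sup>2 + W (fst (Z t))) (at t)" for t
      using bounded_linear.has_vector_derivative[OF bounded_linear_snd
          bounded_linear.has_vector_derivative[OF bounded_linear_snd Z[of t]]]
      by (simp add: phase_field_def case_prod_beta)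
    show "(\<lambda>m. phase_point W ((h \<circ> r) (s m)) (reflected ((x \<circ> r) (s m)) ((N \<circ> r) (s m)) ((p \<circ> r) (s m))) (l m))
        \<longlonglongrightarrow> (fst (Z t), fst (snd (Z t)), snd (snd (Z t)))"
      if "strict_mono s" "(\<lambda>m. of_int (l m) * (h \<circ> r) (s m)) \<longlonglongrightarrow> t" for s :: "nat \<Rightarrow> nat" and l t
      using lim[OF that(1), of l t] that(2) by (simp add: z_def)
  qed (use conn h_pos in auto)
  show ?thesis using connecting_orbit_q[OF R] by blast
qed

end

section \<open>Constants of the potential and the generating set\<close>

lemma periodic_bounded:
  fixes f :: "real ^ 'n \<Rightarrow> 'b::real_normed_vector"
  assumes "continuous_on UNIV f" "\<And>x \<xi>. \<xi> \<in> int_vecs \<Longrightarrow> f (x + \<xi>) = f x"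
  obtains B where "\<And>x. norm (f x) \<le> B"
proof -
  have "compact (f ` cbox 0 1)"
    by (intro compact_continuous_image continuous_on_subset[OF assms(1)]) auto
  then obtain B where B: "\<And>x. x \<in> cbox 0 1 \<Longrightarrow> norm (f x) \<le> B"
    using compact_imp_bounded[of "f ` cbox 0 1"] by (auto simp: bounded_iff)
  have "norm (f x) \<le> B" for x
  proof -
    obtain \<xi> where \<xi>: "\<xi> \<in> int_vecs" "x + \<xi> \<in> cbox 0 1" by (rule int_vecs_representative)
    show ?thesis using B[OF \<xi>(2)] assms(2)[OF \<xi>(1), of x] by simp
  qed
  then show thesis by (rule that)
qed

lemma lattice_wells_exists:
  fixes V :: "real ^ 'n \<Rightarrow> real"
  assumes V5: "C1_fun V" "int_periodic V"
    and V6: "\<And>x. V x \<ge> 0" "\<And>x. V x = 0 \<longleftrightarrow> x \<in> int_vecs"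
    and c: "c \<ge> 0" "sublevel V c \<subseteq> (\<Union>\<xi>\<in>int_vecs. ball \<xi> (1/3))"
    and L: "L \<subseteq> int_vecs" "0 \<in> L" "\<And>x y. x \<in> L \<Longrightarrow> y \<in> L \<Longrightarrow> x + y \<in> L" "\<And>n x. x \<in> L \<Longrightarrow> of_int n *\<^sub>R x \<in> L"
  obtains \<Lambda> B w\<^sub>0 where "lattice_wells V c \<Lambda> B w\<^sub>0 L"
proof -
  have deriv: "(V has_derivative (\<lambda>d. grad V x \<bullet> d)) (at x)" for x
    by (rule grad_works) (use V5(1) in \<open>auto simp: C1_fun_def differentiable_on_def\<close>)
  have cont: "continuous_on UNIV V" and gcont: "continuous_on UNIV (grad V)"
    using V5(1) by (auto simp: C1_fun_def intro: differentiable_imp_continuous_on)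
  have per: "V (x + \<xi>) = V x" if "\<xi> \<in> int_vecs" for x \<xi> using V5(2) that unfolding int_periodic_def by blast
  have gper: "grad V (x + \<xi>) = grad V x" if "\<xi> \<in> int_vecs" for x \<xi>
    by (rule grad_periodic) (rule per[OF that])
  obtain B where B: "\<And>x. norm (V x) \<le> B" using periodic_bounded[OF cont per] by blast
  obtain \<Lambda>0 where \<Lambda>0: "\<And>x. norm (grad V x) \<le> \<Lambda>0"
    using periodic_bounded[OF gcont gper] by blast
  have covered: "\<exists>\<xi>\<in>int_vecs. norm (x - \<xi>) < 1/3" if "V x \<le> c" for x
    using c(2) that by (force simp: sublevel_def dist_norm norm_minus_commute)
  \<comment> \<open>A point of this sphere is too far from 0 to be covered by its open ball, and at
    distance at least 2/3 from all other lattice points. The minimum over the compact sphere then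
    gives the barrier \<open>w\<^sub>0\<close>.\<close>
  have sphere: "V y > c" if y: "norm y = 1/3" for y
  proof (rule ccontr)
    assume "\<not> V y > c"
    then obtain \<xi> where \<xi>: "\<xi> \<in> int_vecs" "norm (y - \<xi>) < 1/3" using covered[of y] by auto
    have "\<xi> \<noteq> 0" using \<xi> y by auto
    then have "1 \<le> norm \<xi>" by (rule norm_int_vec_ge_1[OF \<xi>(1)])
    also have "norm \<xi> \<le> norm y + norm (y - \<xi>)" using norm_triangle_ineq4[of y "y - \<xi>"] by simp
    finally show False using y \<xi> by simp
  qed
  obtain y0 where y0: "norm y0 = 1/3" "\<And>y. norm y = 1/3 \<Longrightarrow> V y0 \<le> V y"
  proof -
    have "sphere (0 :: real ^ 'n) (1/3) \<noteq> {}" by simp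
    then show thesis
      using continuous_attains_inf[OF compact_sphere _ continuous_on_subset[OF cont], of 0 "1/3"] that by auto
  qed
  show thesis
  proof (rule that[of "max 1 \<Lambda>0" B "V y0 - c"])
    show "lattice_wells V c (max 1 \<Lambda>0) B (V y0 - c) L"
    proof
      show "norm (grad V x) \<le> max 1 \<Lambda>0" for x using \<Lambda>0[of x] by simp
      show "V x \<le> B" for x using B[of x] by simp
    qed (use deriv gcont per V6 c(1) covered sphere[OF y0(1)] y0(2) L in auto)
  qed
qed

theorem proposition3p10:
  fixes V :: "real ^ 'n \<Rightarrow> real" and c\<^sub>p R\<^sub>p :: real
  assumes dim: "CARD('n) \<ge> 2"
    and V5: "C1_fun V" "int_periodic V"
    and V6: "\<And>x. V x \<ge> 0" "\<And>x. V x = 0 \<longleftrightarrow> x \<in> int_vecs"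
    and c\<^sub>p: "c\<^sub>p > 0"
      "\<And>c. c \<in> {0..<c\<^sub>p} \<Longrightarrow> sublevel V c \<subseteq> (\<Union>\<xi>\<in>int_vecs. ball \<xi> (1/3))"
    and R\<^sub>p: "R\<^sub>p > 0"
      "\<And>c q q' \<sigma> \<tau>. \<lbrakk>c \<in> {0..<c\<^sub>p}; W12_loc q q'; \<sigma> < \<tau>;
          \<forall>t\<in>{\<sigma><..<\<tau>}. V (q t) \<ge> c; J V c \<sigma> \<tau> q q' \<le> M_p V + 1\<rbrakk>
        \<Longrightarrow> norm (q \<tau> - q \<sigma>) \<le> R\<^sub>p"
  shows "\<forall>c\<in>{0..<c\<^sub>p}. \<exists>(k::nat) (\<xi> :: nat \<Rightarrow> real ^ 'n).
      (\<forall>j\<in>{1..k}. \<xi> j \<in> int_vecs - {0}) \<and>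
      (\<forall>i\<in>{1..k}. \<forall>j\<in>{1..k}. i \<noteq> j \<longrightarrow> \<xi> i \<noteq> \<xi> j) \<and>
      {\<Sum>j=1..k. of_int (n j) *\<^sub>R \<xi> j | n :: nat \<Rightarrow> int. True} = int_vecs \<and>
      (\<forall>j\<in>{1..k}. \<exists>q :: real \<Rightarrow> real ^ 'n.
         C2_curve q \<and>
         (\<forall>t. vel (vel q) t = grad V (q t)) \<and>
         (\<forall>t. energy V q t = - c) \<and>
         (INF t. infdist (q t) (sublevel_at V c 0)) = 0 \<and>
         (INF t. infdist (q t) (sublevel_at V c (\<xi> j))) = 0 \<and>
         Linf_norm q \<le> ereal (R\<^sub>p + 1))"
proof
  fix c assume c: "c \<in> {0..<c\<^sub>p}"
  \<comment> \<open>All vectors reached by a good orbit are taken, not a selection. The uniform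
    bound on the orbits makes \<open>S\<close> finite, and any newly found vector automatically
    belongs to \<open>S\<close>, hence to its span.\<close>
  define S where "S = {\<xi> \<in> int_vecs - {0}. \<exists>q. connecting_orbit V c R\<^sub>p \<xi> q}"
  have "norm \<xi> \<le> R\<^sub>p + 1 + 2" if "connecting_orbit V c R\<^sub>p \<xi> q" "\<xi> \<in> int_vecs" for \<xi> q
  proof -
    have q: "(INF t. infdist (q t) (sublevel_at V c \<xi>)) = 0" "\<And>t. norm (q t) \<le> R\<^sub>p + 1"
      using that unfolding connecting_orbit_def by blast+
    have "\<xi> \<in> sublevel_at V c \<xi>"
      using V6(2)[of \<xi>] that(2) c by (simp add: sublevel_at_def sublevel_def)
    \<comment> \<open>By convention \<open>infdist\<close> to the empty set is 0, so a vanishing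
      infimum is informative only because the well contains \<open>\<xi>\<close>.\<close>
    then have ne: "sublevel_at V c \<xi> \<noteq> {}" by blast
    have "\<exists>t. infdist (q t) (sublevel_at V c \<xi>) < 1"
    proof (rule ccontr)
      assume "\<not> ?thesis"
      then have "1 \<le> (INF t. infdist (q t) (sublevel_at V c \<xi>))" by (intro cINF_greatest) (auto simp: not_less)
      then show False using q(1) by simp
    qed
    then obtain t where "infdist (q t) (sublevel_at V c \<xi>) < 1" by blast
    then obtain y where y: "y \<in> sublevel_at V c \<xi>" "dist (q t) y < 1"
      using ne unfolding infdist_def by (auto simp: cINF_less_iff)
    have "norm \<xi> \<le> norm (q t) + norm (q t - y) + norm (y - \<xi>)"
      using norm_triangle_ineq4[of "q t" "q t - y + (y - \<xi>)"] norm_triangle_ineq[of "q t - y" "y - \<xi>"] by simp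
    moreover have "norm (y - \<xi>) < 1/3" using y(1) by (simp add: sublevel_at_def dist_norm norm_minus_commute)
    ultimately show ?thesis using q(2)[of t] y(2) by (simp add: dist_norm)
  qed
  then have "finite S"
    by (intro finite_subset[OF _ finite_int_vecs_bounded[of "R\<^sub>p + 1 + 2"]]) (auto simp: S_def)
  then obtain \<xi> where \<xi>: "bij_betw \<xi> {1..card S} S" using ex_bij_betw_nat_finite_1 by blast
  have \<xi>S: "\<xi> j \<in> S" if "j \<in> {1..card S}" for j using \<xi> that by (auto simp: bij_betw_def)
  define L where "L = {\<Sum>j=1..card S. of_int (n j) *\<^sub>R \<xi> j | n :: nat \<Rightarrow> int. True}"
  have L_sub: "L \<subseteq> int_vecs"
  proof
    fix x assume "x \<in> L"
    then obtain n :: "nat \<Rightarrow> int" where x: "x = (\<Sum>j=1..card S. of_int (n j) *\<^sub>R \<xi> j)" unfolding L_def by blast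
    have "(\<Sum>j\<in>A. of_int (n j) *\<^sub>R \<xi> j) \<in> int_vecs" if "A \<subseteq> {1..card S}" for A
      using that
      by (induction A rule: infinite_finite_induct)
        (use \<xi>S in \<open>auto simp: S_def intro!: int_vecs_closed\<close>)
    then show "x \<in> int_vecs" unfolding x by blast
  qed
  have L0: "0 \<in> L" unfolding L_def by (intro CollectI exI[of _ "\<lambda>_. 0"]) simp
  have L_add: "x + y \<in> L" if xy: "x \<in> L" "y \<in> L" for x y
  proof -
    obtain n m :: "nat \<Rightarrow> int" where "x = (\<Sum>j=1..card S. of_int (n j) *\<^sub>R \<xi> j)" "y = (\<Sum>j=1..card S. of_int (m j) *\<^sub>R \<xi> j)"
      using xy unfolding L_def by blast
    then have "x + y = (\<Sum>j=1..card S. of_int (n j + m j) *\<^sub>R \<xi> j)" by (simp add: sum.distrib scaleR_add_left)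
    then show ?thesis unfolding L_def by (intro CollectI exI[of _ "\<lambda>j. n j + m j"]) simp
  qed
  have L_scale: "of_int m *\<^sub>R x \<in> L" if x: "x \<in> L" for m x
  proof -
    obtain n :: "nat \<Rightarrow> int" where "x = (\<Sum>j=1..card S. of_int (n j) *\<^sub>R \<xi> j)"
      using x unfolding L_def by blast
    then have "of_int m *\<^sub>R x = (\<Sum>j=1..card S. of_int (m * n j) *\<^sub>R \<xi> j)" by (simp add: scaleR_sum_right)
    then show ?thesis unfolding L_def by (intro CollectI exI[of _ "\<lambda>j. m * n j"]) simp
  qed
  have L_eq: "L = int_vecs"
  proof (rule ccontr)
    assume "L \<noteq> int_vecs"
    then obtain e where e: "e \<in> int_vecs - L" "norm e = 1"
      using axis_notin_proper_subgroup[OF L_sub _ L0 L_add L_scale] by blast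
    have "c \<ge> 0" using c by simp
    then obtain \<Lambda> B w\<^sub>0 where "lattice_wells V c \<Lambda> B w\<^sub>0 L"
      using lattice_wells_exists[OF V5 V6 _ c\<^sub>p(2)[OF c] L_sub L0 L_add L_scale] by blast
    then interpret lattice_wells V c \<Lambda> B w\<^sub>0 L .
    have "displacement_bound V c R\<^sub>p"
      unfolding displacement_bound_def using R\<^sub>p(2)[OF c] by blast
    then have "\<exists>\<xi>\<in>int_vecs - L. \<exists>q. connecting_orbit V c R\<^sub>p \<xi> q"
      using R\<^sub>p(1) by (intro connecting_orbit_exists[OF e]) auto
    then obtain \<eta> q where \<eta>: "\<eta> \<in> int_vecs" "\<eta> \<notin> L" "connecting_orbit V c R\<^sub>p \<eta> q" by blast
    \<comment> \<open>A vector outside \<open>L\<close> is nonzero because \<open>L\<close> contains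
      0. Being in \<open>S\<close>, it is one of the generators, which puts it into \<open>L\<close>
      after all.\<close>
    then have "\<eta> \<in> S" using L0 unfolding S_def by auto
    then obtain i where i: "i \<in> {1..card S}" "\<eta> = \<xi> i" using bij_betw_imp_surj_on[OF \<xi>] by blast
    have "(\<Sum>j=1..card S. of_int (if j = i then 1 else 0) *\<^sub>R \<xi> j) = (\<Sum>j=1..card S. if j = i then \<xi> j else 0)"
      by (rule sum.cong) auto
    also have "\<dots> = \<eta>" using i by simp
    finally have "\<eta> \<in> L" unfolding L_def by (intro CollectI exI[of _ "\<lambda>j. if j = i then 1 else 0"]) simp
    with \<eta> show False by blast
  qed
  show "\<exists>(k::nat) (\<xi> :: nat \<Rightarrow> real ^ 'n).
      (\<forall>j\<in>{1..k}. \<xi> j \<in> int_vecs - {0}) \<and>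
      (\<forall>i\<in>{1..k}. \<forall>j\<in>{1..k}. i \<noteq> j \<longrightarrow> \<xi> i \<noteq> \<xi> j) \<and>
      {\<Sum>j=1..k. of_int (n j) *\<^sub>R \<xi> j | n :: nat \<Rightarrow> int. True} = int_vecs \<and>
      (\<forall>j\<in>{1..k}. \<exists>q :: real \<Rightarrow> real ^ 'n.
         C2_curve q \<and>
         (\<forall>t. vel (vel q) t = grad V (q t)) \<and>
         (\<forall>t. energy V q t = - c) \<and>
         (INF t. infdist (q t) (sublevel_at V c 0)) = 0 \<and>
         (INF t. infdist (q t) (sublevel_at V c (\<xi> j))) = 0 \<and>
         Linf_norm q \<le> ereal (R\<^sub>p + 1))"
  proof (intro exI[of _ "card S"] exI[of _ \<xi>] conjI ballI impI)
    fix j assume j: "j \<in> {1..card S}"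
    show "\<xi> j \<in> int_vecs - {0}" using \<xi>S[OF j] by (simp add: S_def)
    obtain q where q: "connecting_orbit V c R\<^sub>p (\<xi> j) q" using \<xi>S[OF j] unfolding S_def by blast
    then have "continuous_on UNIV q"
      unfolding connecting_orbit_def C2_curve_def by (blast intro: differentiable_imp_continuous_on)
    then have "Linf_norm q \<le> ereal (R\<^sub>p + 1)"
      by (rule Linf_norm_le) (use q in \<open>auto simp: connecting_orbit_def\<close>)
    with q show "\<exists>q :: real \<Rightarrow> real ^ 'n.
         C2_curve q \<and> (\<forall>t. vel (vel q) t = grad V (q t)) \<and> (\<forall>t. energy V q t = - c) \<and>
         (INF t. infdist (q t) (sublevel_at V c 0)) = 0 \<and>
         (INF t. infdist (q t) (sublevel_at V c (\<xi> j))) = 0 \<and> Linf_norm q \<le> ereal (R\<^sub>p + 1)"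
      by (intro exI[of _ q]) (simp add: connecting_orbit_def)
  next
    fix i j assume "i \<in> {1..card S}" "j \<in> {1..card S}" "i \<noteq> j"
    then show "\<xi> i \<noteq> \<xi> j" using inj_onD[OF bij_betw_imp_inj_on[OF \<xi>], of i j] by blast
  next
    show "{\<Sum>j=1..card S. of_int (n j) *\<^sub>R \<xi> j | n :: nat \<Rightarrow> int. True} = int_vecs"
      using L_eq unfolding L_def .
  qed
qed

end
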